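(* Let $V$ be a finite-dimensional vector space over a field of characteristic zero, let $s\ge 1$, and let $P\in\Lambda^sV$. Then $P$ is simple if and only if the component of $P\otimes P\in\Lambda^sV\otimes\Lambda^sV$ in $Y^{s+2,s-2}$ vanishes.
   Context: An element $P\in\Lambda^sV$ is called simple (or decomposable) if it can be written as $P=u\wedge v\wedge\cdots\wedge w$ with $s$ vectors $u,v,\dots,w\in V$ (so $P=0$ is simple). For integers $p\ge q\ge 0$, $Y^{p,q}$ denotes the irreducible representation of $\mathrm{GL}(V)$ corresponding to the Young diagram with two columns, the first of length $p$ and the second of length $q$ (equivalently, the Schur functor of the partition conjugate to $(p,q)$ applied to $V$). It is zero if $p>\dim V$, and by convention $Y^{p,q}=0$ if $q<0$. In particular $Y^{p,0}=\Lambda^pV$. By the Littlewood–Richardson rules there is a multiplicity-free decomposition as $\mathrm{GL}(V)$-representations $$\Lambda^sV\otimes\Lambda^sV=Y^{s,s}\oplus Y^{s+1,s-1}\oplus Y^{s+2,s-2}\oplus\cdots\oplus Y^{2s,0},$$ with symmetric part $\Lambda^sV\odot\Lambda^sV=Y^{s,s}\oplus Y^{s+2,s-2}\oplus\cdots$ and skew part $\Lambda^sV\wedge\Lambda^sV=Y^{s+1,s-1}\oplus Y^{s+3,s-3}\oplus\cdots$. The component of $P\otimes P$ in $Y^{s+2,s-2}$ is its image under the corresponding ($\mathrm{GL}(V)$-equivariant) projection onto this summand. *)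

theory Defs
  imports Complex_Main "HOL-Library.Function_Algebras" "HOL-Combinatorics.Permutations"
    "HOL-Combinatorics.List_Permutation"
begin

text \<open>
  A vector space is a type with a scalar multiplication \<open>scale\<close>, as in the locale
  \<open>vector_space\<close>. As \<open>V\<close> is finite-dimensional, the tensor power \<open>V\<^sup>\<otimes>\<^sup>d\<close> is realised as the
  space of multilinear forms on \<open>d\<close>-tuples of covectors, the tensor \<open>v\<^sub>1 \<otimes> \<dots> \<otimes> v\<^sub>d\<close> being the
  form \<open>(\<alpha>\<^sub>1, \<dots>, \<alpha>\<^sub>d) \<mapsto> \<alpha>\<^sub>1 v\<^sub>1 \<cdots> \<alpha>\<^sub>d v\<^sub>d\<close>. Tuples are lists, and a form takes the value \<open>0\<close> on every
  list that is not a \<open>d\<close>-tuple of covectors, so that equality of tensors is equality of functions.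
\<close>

type_synonym ('k, 'v) tensor = "('v \<Rightarrow> 'k) list \<Rightarrow> 'k"

definition fscale :: "'k::field \<Rightarrow> ('a \<Rightarrow> 'k) \<Rightarrow> 'a \<Rightarrow> 'k" where
  "fscale c f = (\<lambda>x. c * f x)"

definition dual :: "('k::field \<Rightarrow> 'v::ab_group_add \<Rightarrow> 'v) \<Rightarrow> ('v \<Rightarrow> 'k) set" where
  "dual scale = {\<alpha>. Vector_Spaces.linear scale (*) \<alpha>}"

definition covectors ::
  "('k::field \<Rightarrow> 'v::ab_group_add \<Rightarrow> 'v) \<Rightarrow> nat \<Rightarrow> ('v \<Rightarrow> 'k) list set" where
  "covectors scale d = {\<alpha>s. length \<alpha>s = d \<and> set \<alpha>s \<subseteq> dual scale}"

definition tensor_power ::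
  "('k::field \<Rightarrow> 'v::ab_group_add \<Rightarrow> 'v) \<Rightarrow> nat \<Rightarrow> ('k, 'v) tensor set" where
  "tensor_power scale d = {t.
     (\<forall>\<alpha>s. \<alpha>s \<notin> covectors scale d \<longrightarrow> t \<alpha>s = 0) \<and>
     (\<forall>\<alpha>s \<in> covectors scale d. \<forall>i<d. \<forall>\<beta> \<in> dual scale. \<forall>\<gamma> \<in> dual scale. \<forall>c.
        t (\<alpha>s[i := \<beta> + \<gamma>]) = t (\<alpha>s[i := \<beta>]) + t (\<alpha>s[i := \<gamma>]) \<and>
        t (\<alpha>s[i := fscale c \<beta>]) = c * t (\<alpha>s[i := \<beta>]))}"

text \<open>The exterior power \<open>\<Lambda>\<^sup>sV\<close>: the alternating tensors of degree \<open>s\<close>.\<close>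

definition ext_power ::
  "('k::field \<Rightarrow> 'v::ab_group_add \<Rightarrow> 'v) \<Rightarrow> nat \<Rightarrow> ('k, 'v) tensor set" where
  "ext_power scale s = {t \<in> tensor_power scale s.
     \<forall>\<alpha>s \<in> covectors scale s. \<forall>i<s. \<forall>j<s. i \<noteq> j \<and> \<alpha>s ! i = \<alpha>s ! j \<longrightarrow> t \<alpha>s = 0}"

text \<open>The wedge product of vectors is the sum of
  \<open>sign \<sigma> \<cdot> v\<^bsub>\<sigma> 0\<^esub> \<otimes> \<dots> \<otimes> v\<^bsub>\<sigma> (s - 1)\<^esub>\<close> over all permutations \<open>\<sigma>\<close>.\<close>

definition wedge ::
  "('k::field \<Rightarrow> 'v::ab_group_add \<Rightarrow> 'v) \<Rightarrow> 'v list \<Rightarrow> ('k, 'v) tensor" where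
  "wedge scale vs = (\<lambda>\<alpha>s.
     if \<alpha>s \<in> covectors scale (length vs)
     then \<Sum>\<sigma> | \<sigma> permutes {..<length vs}.
            of_int (sign \<sigma>) * (\<Prod>i<length vs. (\<alpha>s ! i) (vs ! \<sigma> i))
     else 0)"

definition simple ::
  "('k::field \<Rightarrow> 'v::ab_group_add \<Rightarrow> 'v) \<Rightarrow> nat \<Rightarrow> ('k, 'v) tensor \<Rightarrow> bool" where
  "simple scale s P \<longleftrightarrow> (\<exists>vs. length vs = s \<and> P = wedge scale vs)"

definition tensor_prod ::
  "nat \<Rightarrow> ('k::field, 'v) tensor \<Rightarrow> ('k, 'v) tensor \<Rightarrow> ('k, 'v) tensor" where
  "tensor_prod s P Q = (\<lambda>\<alpha>s. P (take s \<alpha>s) * Q (drop s \<alpha>s))"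

text \<open>\<open>\<Lambda>\<^sup>sV \<otimes> \<Lambda>\<^sup>sV\<close> as a subspace of \<open>V\<^sup>\<otimes>\<^sup>s \<otimes> V\<^sup>\<otimes>\<^sup>s\<close>, the latter being the tensor power of degree \<open>2s\<close>.\<close>

definition ext_square ::
  "('k::field \<Rightarrow> 'v::ab_group_add \<Rightarrow> 'v) \<Rightarrow> nat \<Rightarrow> ('k, 'v) tensor set" where
  "ext_square scale s =
     module.span fscale {tensor_prod s P Q |P Q. P \<in> ext_power scale s \<and> Q \<in> ext_power scale s}"

definition GL :: "('k::field \<Rightarrow> 'v::ab_group_add \<Rightarrow> 'v) \<Rightarrow> ('v \<Rightarrow> 'v) set" where
  "GL scale = {g. Vector_Spaces.linear scale scale g \<and> bij g}"

text \<open>Evaluating \<open>g v\<^sub>1 \<otimes> \<dots> \<otimes> g v\<^sub>d\<close> on covectors \<open>\<alpha>\<^sub>i\<close> is evaluating \<open>v\<^sub>1 \<otimes> \<dots> \<otimes> v\<^sub>d\<close> on the \<open>\<alpha>\<^sub>i \<circ> g\<close>.\<close>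

definition act :: "('v \<Rightarrow> 'v) \<Rightarrow> ('k, 'v) tensor \<Rightarrow> ('k, 'v) tensor" where
  "act g t = (\<lambda>\<alpha>s. t (map (\<lambda>\<alpha>. \<alpha> \<circ> g) \<alpha>s))"

text \<open>
  The tensor positions \<open>0, \<dots>, p + q - 1\<close> fill the Young diagram with columns of lengths \<open>p \<ge> q\<close>
  column by column: the first column holds \<open>0, \<dots>, p - 1\<close> and the second \<open>p, \<dots>, p + q - 1\<close>.
  The Young symmetrizer antisymmetrizes along the columns and then symmetrizes along the rows;
  its image on \<open>V\<^sup>\<otimes>\<^sup>p\<^sup>+\<^sup>q\<close> is the Schur functor of that diagram.
\<close>

definition column_group :: "nat \<Rightarrow> nat \<Rightarrow> (nat \<Rightarrow> nat) set" where
  "column_group p q = {\<sigma>. \<sigma> permutes {..<p + q} \<and> (\<forall>i<p + q. \<sigma> i < p \<longleftrightarrow> i < p)}"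

definition row_index :: "nat \<Rightarrow> nat \<Rightarrow> nat" where
  "row_index p i = (if i < p then i else i - p)"

definition row_group :: "nat \<Rightarrow> nat \<Rightarrow> (nat \<Rightarrow> nat) set" where
  "row_group p q =
     {\<sigma>. \<sigma> permutes {..<p + q} \<and> (\<forall>i<p + q. row_index p (\<sigma> i) = row_index p i)}"

definition young_symmetrizer ::
  "nat \<Rightarrow> nat \<Rightarrow> ('k::field, 'v) tensor \<Rightarrow> ('k, 'v) tensor" where
  "young_symmetrizer p q t = (\<lambda>\<alpha>s.
     \<Sum>\<rho> \<in> row_group p q. \<Sum>\<kappa> \<in> column_group p q.
       of_int (sign \<kappa>) * t (permute_list (\<rho> \<circ> \<kappa>) \<alpha>s))"

text \<open>\<open>Y\<^sup>p\<^sup>,\<^sup>q\<close> for \<open>p \<ge> q\<close>, with the convention that it is zero for \<open>q < 0\<close>.\<close>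

definition Y ::
  "('k::field \<Rightarrow> 'v::ab_group_add \<Rightarrow> 'v) \<Rightarrow> nat \<Rightarrow> int \<Rightarrow> ('k, 'v) tensor set" where
  "Y scale p q =
     (if q < 0 then {0} else young_symmetrizer p (nat q) ` tensor_power scale (p + nat q))"

definition GL_hom ::
  "('k::field \<Rightarrow> 'v::ab_group_add \<Rightarrow> 'v) \<Rightarrow> ('k, 'v) tensor set \<Rightarrow> ('k, 'v) tensor set
     \<Rightarrow> (('k, 'v) tensor \<Rightarrow> ('k, 'v) tensor) set" where
  "GL_hom scale U W = {\<phi>. \<phi> ` U \<subseteq> W \<and>
     (\<forall>x\<in>U. \<forall>y\<in>U. \<phi> (x + y) = \<phi> x + \<phi> y) \<and>
     (\<forall>c. \<forall>x\<in>U. \<phi> (fscale c x) = fscale c (\<phi> x)) \<and>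
     (\<forall>g\<in>GL scale. \<forall>x\<in>U. \<phi> (act g x) = act g (\<phi> x))}"

definition GL_isomorphic ::
  "('k::field \<Rightarrow> 'v::ab_group_add \<Rightarrow> 'v) \<Rightarrow> ('k, 'v) tensor set \<Rightarrow> ('k, 'v) tensor set \<Rightarrow> bool" where
  "GL_isomorphic scale U W \<longleftrightarrow> (\<exists>\<phi> \<in> GL_hom scale U W. bij_betw \<phi> U W)"

definition equivariant_projection ::
  "('k::field \<Rightarrow> 'v::ab_group_add \<Rightarrow> 'v) \<Rightarrow> ('k, 'v) tensor set \<Rightarrow> ('k, 'v) tensor set
     \<Rightarrow> (('k, 'v) tensor \<Rightarrow> ('k, 'v) tensor) \<Rightarrow> bool" where
  "equivariant_projection scale X W \<pi> \<longleftrightarrow>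
     \<pi> \<in> GL_hom scale X X \<and> (\<forall>x\<in>X. \<pi> (\<pi> x) = \<pi> x) \<and> GL_isomorphic scale (\<pi> ` X) W"

text \<open>
  The component of \<open>x \<in> X\<close> in the summand of \<open>X\<close> isomorphic to \<open>W\<close>. The description is definite
  when \<open>X\<close> is multiplicity-free and \<open>W\<close> is zero or one of its irreducible constituents:
  the equivariant projection is then unique on \<open>X\<close>, and its kernel is the sum of the other summands.
\<close>

definition component ::
  "('k::field \<Rightarrow> 'v::ab_group_add \<Rightarrow> 'v) \<Rightarrow> ('k, 'v) tensor set \<Rightarrow> ('k, 'v) tensor set
     \<Rightarrow> ('k, 'v) tensor \<Rightarrow> ('k, 'v) tensor" where
  "component scale X W x = (THE y. \<exists>\<pi>. equivariant_projection scale X W \<pi> \<and> y = \<pi> x)"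

end

theory Submission
  imports Defs
begin

text \<open>
  The symmetric group acts on \<open>V\<^sup>\<otimes>\<^sup>d\<close>, and the sum of all transpositions lies in the linear span of
  the image of \<open>GL(V)\<close>, because \<open>\<Sum>\<^sub>i\<^sub>j E\<^sub>i\<^sub>j \<otimes> E\<^sub>j\<^sub>i\<close> is the swap. So every equivariant map commutes
  with it. On a pair of columns it is, up to a factor and an additive constant, the operator moving
  one place from the second column to the first and back. Hence it is diagonalizable on \<open>\<Lambda>\<^sup>sV \<otimes> \<Lambda>\<^sup>sV\<close> and acts on
  \<open>Y\<^sup>p\<^sup>,\<^sup>q\<close> by the scalar \<open>content p q\<close>. These scalars separate the summands, the equivariant
  projection is unique, and the component of \<open>P \<otimes> P\<close> vanishes if and only if the tensor \<open>U\<close> obtained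
  by moving two places to the first column and symmetrizing along the rows does.

  If \<open>P\<close> is simple, moving one place already gives \<open>0\<close>, by Cramer's rule. Conversely, the values of
  \<open>U\<close> on tuples that agree in every row are multiples of the three-term expressions
  \<open>P(\<Phi>ab)P(\<Phi>ce) - P(\<Phi>ac)P(\<Phi>be) + P(\<Phi>ae)P(\<Phi>bc)\<close>. If these vanish, the annihilator of the vectors
  \<open>P(\<alpha>\<^sub>1, \<dots>, \<cdot>, \<dots>, \<alpha>\<^sub>s)\<close> does not change when one \<open>\<alpha>\<^sub>i\<close> is exchanged, as long as \<open>P\<close> stays nonzero.
  Any two tuples are connected by such exchanges, so \<open>P\<close> is a wedge product of these vectors.
\<close>

section \<open>Place permutations\<close>

text \<open>\<open>component\<close> is a definite description over all equivariant projections, so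
  the summand has to be pinned down from equivariance alone. Let T be \<open>swap_sum\<close>, and
  let E and F move one place into the first column and back. These are the raising and lowering
  operators of a Lie algebra gl(2) commuting with GL(V) on pairs of exterior powers, and T is its
  Casimir element up to affine rescaling. Both 2 F E and 2 E F equal c - T with the same constant c,
  and the eigentensors for the content of their own shape are the highest weight vectors. All
  spectral facts follow from these two identities by induction on the length of the second column.
  An isomorphism with \<open>Y\<close> forces the image of a projection into one eigenspace of T,
  and a comparison of dimensions makes it the whole eigenspace.

  The obstacle in the converse is that the three-term relations only compare values of P at tuples
  sharing s - 2 entries. Information at one tuple therefore has to be carried to all others one
  entry at a time, and each step needs a nonzero value of P to divide by.\<close>

lemma sum_fun_apply: "(\<Sum>i\<in>A. f i) x = (\<Sum>i\<in>A. f i x)"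
  for f :: "'a \<Rightarrow> 'b \<Rightarrow> 'c::comm_monoid_add"
  by (induction A rule: infinite_finite_induct) auto

interpretation fs: vector_space "fscale :: 'k::field \<Rightarrow> ('a \<Rightarrow> 'k) \<Rightarrow> 'a \<Rightarrow> 'k"
  by standard (auto simp: fscale_def fun_eq_iff algebra_simps)

lemma fscale_apply: "fscale c f x = c * f x"
  by (simp add: fscale_def)

text \<open>The value at lists of other lengths is set to zero because \<open>permute_list\<close>
  could read past the end of a shorter list. With this guard the composition law needs no hypothesis
  on the tensor.\<close>

definition perm_op :: "nat \<Rightarrow> (nat \<Rightarrow> nat) \<Rightarrow> ('k::field, 'v) tensor \<Rightarrow> ('k, 'v) tensor" where
  "perm_op d \<sigma> t = (\<lambda>\<alpha>s. if length \<alpha>s = d then t (permute_list \<sigma> \<alpha>s) else 0)"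

abbreviation swap_op :: "nat \<Rightarrow> nat \<Rightarrow> nat \<Rightarrow> ('k::field, 'v) tensor \<Rightarrow> ('k, 'v) tensor" where
  "swap_op d i j \<equiv> perm_op d (transpose i j)"

definition degree :: "nat \<Rightarrow> ('k::field, 'v) tensor \<Rightarrow> bool" where
  "degree d t \<longleftrightarrow> (\<forall>\<alpha>s. length \<alpha>s \<noteq> d \<longrightarrow> t \<alpha>s = 0)"

lemma perm_op_add: "perm_op d \<sigma> (t + u) = perm_op d \<sigma> t + perm_op d \<sigma> u"
  and perm_op_diff: "perm_op d \<sigma> (t - u) = perm_op d \<sigma> t - perm_op d \<sigma> u"
  and perm_op_minus: "perm_op d \<sigma> (- t) = - perm_op d \<sigma> t"
  and perm_op_scale: "perm_op d \<sigma> (fscale c t) = fscale c (perm_op d \<sigma> t)"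
  by (auto simp: perm_op_def fun_eq_iff fscale_def)

lemma perm_op_zero: "perm_op d \<sigma> 0 = 0"
  by (auto simp: perm_op_def fun_eq_iff)

lemma perm_op_sum: "perm_op d \<sigma> (\<Sum>i\<in>A. f i) = (\<Sum>i\<in>A. perm_op d \<sigma> (f i))"
  by (simp add: perm_op_def fun_eq_iff sum_fun_apply)

lemmas perm_op_linear = perm_op_add perm_op_diff perm_op_minus perm_op_scale perm_op_zero perm_op_sum

lemma perm_op_comp:
  assumes "\<tau> permutes {..<d}"
  shows "perm_op d \<sigma> (perm_op d \<tau> t) = perm_op d (\<sigma> \<circ> \<tau>) t"
  using assms by (auto simp: perm_op_def fun_eq_iff permute_list_compose)

lemma perm_op_id: "degree d t \<Longrightarrow> perm_op d id t = t"
  by (auto simp: perm_op_def fun_eq_iff degree_def)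

text \<open>Conjugating a transposition relabels it. Products such as \<open>(j x)(i x)\<close> are
  rewritten by this rule until the factor acting first is one that an alternating tensor turns into
  -1.\<close>

lemma perm_op_swap_op:
  assumes \<sigma>: "\<sigma> permutes {..<d}" and ij: "i < d" "j < d"
  shows "perm_op d \<sigma> (swap_op d i j t) = swap_op d (\<sigma> i) (\<sigma> j) (perm_op d \<sigma> t)"
proof -
  have "\<sigma> \<circ> transpose i j = transpose (\<sigma> i) (\<sigma> j) \<circ> \<sigma>"
    using permutes_bij[OF \<sigma>] by (simp add: transpose_comp_eq permutes_inverses[OF \<sigma>])
  then show ?thesis
    using assms by (simp add: perm_op_comp permutes_swap_id)
qed

lemma swap_op_conj:
  assumes "k < d" "l < d" "i < d" "j < d"
  shows "swap_op d k l (swap_op d i j t) =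
    swap_op d (transpose k l i) (transpose k l j) (swap_op d k l t)"
  using assms by (simp add: perm_op_swap_op permutes_swap_id)

lemma swap_op_twice:
  assumes "k < d" "l < d" "degree d t"
  shows "swap_op d k l (swap_op d k l t) = t"
  using assms by (simp add: perm_op_comp permutes_swap_id perm_op_id)

section \<open>Alternation in a set of places, and moving one place into it\<close>

definition alternating :: "nat \<Rightarrow> nat set \<Rightarrow> ('k::field, 'v) tensor \<Rightarrow> bool" where
  "alternating d S t \<longleftrightarrow> (\<forall>i\<in>S. \<forall>j\<in>S. i \<noteq> j \<longrightarrow> swap_op d i j t = - t)"

text \<open>For a tensor alternating in the places \<open>C\<close>, this antisymmetrizes over \<open>C \<union> {x}\<close>: it moves the
  place \<open>x\<close> into the column \<open>C\<close>.\<close>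

definition shift_op :: "nat \<Rightarrow> nat set \<Rightarrow> nat \<Rightarrow> ('k::field, 'v) tensor \<Rightarrow> ('k, 'v) tensor" where
  "shift_op d C x t = t - (\<Sum>i\<in>C. swap_op d i x t)"

text \<open>The sum runs over all ordered pairs \<open>(a, b)\<close>, including \<open>a = b\<close>, so it is twice the sum of the
  transpositions plus \<open>d\<close> times the identity.\<close>

definition swap_sum :: "nat \<Rightarrow> ('k::field, 'v) tensor \<Rightarrow> ('k, 'v) tensor" where
  "swap_sum d t = (\<Sum>a<d. \<Sum>b<d. swap_op d a b t)"

lemma shift_op_linear:
  "shift_op d C x (t + u) = shift_op d C x t + shift_op d C x u"
  "shift_op d C x (t - u) = shift_op d C x t - shift_op d C x u"
  "shift_op d C x (fscale c t) = fscale c (shift_op d C x t)"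
  "shift_op d C x 0 = 0"
  by (simp_all add: shift_op_def perm_op_linear sum.distrib sum_subtractf algebra_simps
      fs.scale_right_diff_distrib fs.scale_sum_right)

lemma swap_sum_linear:
  "swap_sum d (t + u) = swap_sum d t + swap_sum d u"
  "swap_sum d (t - u) = swap_sum d t - swap_sum d u"
  "swap_sum d (fscale c t) = fscale c (swap_sum d t)"
  "swap_sum d 0 = 0"
  by (simp_all add: swap_sum_def perm_op_linear sum.distrib sum_subtractf fs.scale_sum_right)

lemma swap_sum_sum: "swap_sum d (\<Sum>i\<in>A. f i) = (\<Sum>i\<in>A. swap_sum d (f i))"
  using sum_comp_morphism[of "swap_sum d" f A] by (simp add: o_def swap_sum_linear)

text \<open>Conjugation permutes the pairs \<open>(a, b)\<close>, so the sum of all transpositions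
  is central in the group algebra.\<close>

lemma swap_sum_perm_op:
  assumes \<sigma>: "\<sigma> permutes {..<d}"
  shows "swap_sum d (perm_op d \<sigma> t) = perm_op d \<sigma> (swap_sum d t)"
proof -
  have "perm_op d \<sigma> (swap_sum d t) = (\<Sum>a<d. \<Sum>b<d. swap_op d (\<sigma> a) (\<sigma> b) (perm_op d \<sigma> t))"
    by (simp add: swap_sum_def perm_op_sum perm_op_swap_op[OF \<sigma>])
  also have "\<dots> = (\<Sum>a<d. \<Sum>b<d. swap_op d (\<sigma> a) b (perm_op d \<sigma> t))"
    using sum.permute[OF \<sigma>, of "\<lambda>b. swap_op d (\<sigma> _) b (perm_op d \<sigma> t)"] by (simp add: o_def)
  also have "\<dots> = swap_sum d (perm_op d \<sigma> t)"
    using sum.permute[OF \<sigma>, of "\<lambda>a. \<Sum>b<d. swap_op d a b (perm_op d \<sigma> t)"]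
    by (simp add: o_def swap_sum_def)
  finally show ?thesis ..
qed

lemma swap_sum_shift_op:
  assumes "C \<subseteq> {..<d}" "x < d"
  shows "swap_sum d (shift_op d C x t) = shift_op d C x (swap_sum d t)"
  using assms
  by (auto simp: shift_op_def swap_sum_linear swap_sum_sum swap_sum_perm_op permutes_swap_id subset_iff intro!: sum.cong)

lemma alternating_subset: "alternating d S t \<Longrightarrow> T \<subseteq> S \<Longrightarrow> alternating d T t"
  unfolding alternating_def by blast

lemma alternating_shift_op_other:
  assumes alt: "alternating d C' t" and C: "C \<subseteq> {..<d}" "x < d" "C' \<subseteq> {..<d}"
    and disj: "C' \<inter> insert x C = {}"
  shows "alternating d C' (shift_op d C x t)"
  unfolding alternating_def
proof (intro ballI impI)
  fix i j assume ij: "i \<in> C'" "j \<in> C'" "i \<noteq> j"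
  have "swap_op d i j (swap_op d k x t) = - swap_op d k x t" if "k \<in> C" for k
  proof -
    have "k \<noteq> i" "k \<noteq> j" "x \<noteq> i" "x \<noteq> j" "k < d" "i < d" "j < d"
      using that ij C disj by auto
    then have "swap_op d i j (swap_op d k x t) = swap_op d k x (swap_op d i j t)"
      by (subst swap_op_conj) (use C in auto)
    then show ?thesis
      using alt ij by (simp add: alternating_def perm_op_linear)
  qed
  then show "swap_op d i j (shift_op d C x t) = - shift_op d C x t"
    using alt ij by (simp add: alternating_def shift_op_def perm_op_linear sum_negf)
qed

text \<open>The identity and the transpositions \<open>(i x)\<close> with \<open>i\<close> in
  \<open>C\<close> represent the cosets of the symmetric group on \<open>C\<close> in that on
  \<open>insert x C\<close>. Their signed sum completes the antisymmetrization of a tensor that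
  already alternates in \<open>C\<close>.\<close>

lemma alternating_shift_op:
  assumes alt: "alternating d C t" and C: "C \<subseteq> {..<d}" "x < d" "x \<notin> C" and t: "degree d t"
  shows "alternating d (insert x C) (shift_op d C x t)"
proof -
  have fin: "finite C" using C(1) finite_subset by blast
  have inner: "swap_op d i j (shift_op d C x t) = - shift_op d C x t"
    if ij: "i \<in> C" "j \<in> C" "i \<noteq> j" for i j
  proof -
    have lt: "i < d" "j < d" and ne: "x \<noteq> i" "x \<noteq> j" using ij C by auto
    \<comment> \<open>\<open>(i j)\<close> fixes \<open>x\<close> and permutes \<open>C\<close>, so
      conjugation by it only reorders the summands.\<close>
    have "(\<Sum>k\<in>C. swap_op d i j (swap_op d k x t)) =
        (\<Sum>k\<in>C. - swap_op d (transpose i j k) x t)"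
      using alt ij ne lt C
      by (intro sum.cong refl, subst swap_op_conj) (auto simp: alternating_def perm_op_linear)
    also have "\<dots> = (\<Sum>k\<in>C. - swap_op d k x t)"
      using sum.permute[OF permutes_swap_id[OF ij(1,2)], of "\<lambda>k. - swap_op d k x t"]
      by (simp add: o_def)
    finally show ?thesis
      using alt ij by (simp add: alternating_def shift_op_def perm_op_linear sum_negf)
  qed
  have outer: "swap_op d i x (shift_op d C x t) = - shift_op d C x t" if i: "i \<in> C" for i
  proof -
    have lt: "i < d" and ne: "x \<noteq> i" using i C by auto
    \<comment> \<open>\<open>(i x)(k x) = (k x)(i k)\<close>, and \<open>(i k)\<close> acts by -1.
      The summand \<open>k = i\<close> turns back into \<open>t\<close> and trades places with the
      leading term.\<close>
    have *: "swap_op d i x (swap_op d k x t) = - swap_op d k x t" if "k \<in> C - {i}" for k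
    proof -
      have k: "k < d" "k \<in> C" "k \<noteq> i" "k \<noteq> x" using that C by auto
      have "swap_op d k x (swap_op d i k t) = swap_op d i x (swap_op d k x t)"
        by (subst swap_op_conj) (use k lt ne C in auto)
      then show ?thesis
        using alt i k by (simp add: alternating_def perm_op_linear)
    qed
    have "(\<Sum>k\<in>C. swap_op d i x (swap_op d k x t)) =
        swap_op d i x (swap_op d i x t) + (\<Sum>k\<in>C - {i}. swap_op d i x (swap_op d k x t))"
      using fin i by (rule sum.remove)
    also have "\<dots> = t - (\<Sum>k\<in>C - {i}. swap_op d k x t)"
      using swap_op_twice[OF lt C(2) t] * by (simp add: sum_negf)
    also have "\<dots> = t - (\<Sum>k\<in>C. swap_op d k x t) + swap_op d i x t"
      using sum.remove[OF fin i, of "\<lambda>k. swap_op d k x t"] by simp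
    finally show ?thesis
      by (simp add: shift_op_def perm_op_linear)
  qed
  show ?thesis
    unfolding alternating_def
    using inner outer by (auto simp: transpose_commute)
qed

text \<open>Since \<open>t\<close> alternates in \<open>insert x C2\<close>, the product
  \<open>(j x)(i x) = (i j)(j x)\<close> acts as \<open>- (i j)\<close>. Moving \<open>x\<close>
  over and back thus leaves a scalar and the transpositions between the columns, which are the mixed
  part of \<open>swap_sum\<close>.\<close>

lemma shift_op_shift_op:
  assumes alt: "alternating d (insert x C2) t"
    and C: "C1 \<subseteq> {..<d}" "C2 \<subseteq> {..<d}" "x < d" "x \<notin> C1" "x \<notin> C2" "C1 \<inter> C2 = {}"
    and t: "degree d t"
  shows "shift_op d C2 x (shift_op d C1 x t) =
    fscale (of_nat (card C2 + 1)) t - (\<Sum>i\<in>C1. \<Sum>j\<in>insert x C2. swap_op d i j t)"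
proof -
  have fin: "finite C1" "finite C2" using C finite_subset by blast+
  have 1: "swap_op d j x (swap_op d i x t) = - swap_op d i j t" if "i \<in> C1" "j \<in> C2" for i j
  proof -
    have "i < d" "j < d" "i \<noteq> j" "i \<noteq> x" using that C by auto
    then have "swap_op d j x (swap_op d i x t) = swap_op d i j (swap_op d j x t)"
      by (subst swap_op_conj) (use C in auto)
    then show ?thesis using alt that C by (auto simp: alternating_def perm_op_linear)
  qed
  have 2: "swap_op d j x t = - t" if "j \<in> C2" for j
    using alt that C by (auto simp: alternating_def)
  have "(\<Sum>j\<in>C2. swap_op d j x (shift_op d C1 x t)) =
      (\<Sum>j\<in>C2. - t + (\<Sum>i\<in>C1. swap_op d i j t))"
    by (intro sum.cong refl) (simp add: shift_op_def perm_op_linear 1 2 sum_negf)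
  also have "\<dots> = - fscale (of_nat (card C2)) t + (\<Sum>i\<in>C1. \<Sum>j\<in>C2. swap_op d i j t)"
    by (simp add: sum.distrib sum_negf fs.sum_constant_scale sum.swap[of _ C1] sum_subtractf del: sum_constant)
  finally show ?thesis
    using fin C
    by (simp add: shift_op_def[of d C2] sum.distrib fs.scale_left_distrib)
      (simp add: shift_op_def)
qed

lemma sum_swap_op_alternating:
  assumes "alternating d C t" "finite C" "a \<in> C" and t: "degree d t"
  shows "(\<Sum>b\<in>C. swap_op d a b t) = fscale (2 - of_nat (card C)) t"
proof -
  have "(\<Sum>b\<in>C. swap_op d a b t) = swap_op d a a t + (\<Sum>b\<in>C-{a}. swap_op d a b t)"
    using assms by (intro sum.remove)
  also have "(\<Sum>b\<in>C-{a}. swap_op d a b t) = (\<Sum>b\<in>C-{a}. - t)"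
    using assms by (intro sum.cong) (auto simp: alternating_def)
  also have "swap_op d a a t + \<dots> = t - fscale (of_nat (card C - 1)) t"
    using assms by (simp add: fs.sum_constant_scale perm_op_id sum_negf del: sum_constant)
  also have "of_nat (card C - 1) = (of_nat (card C) - 1 :: 'b)"
    using assms(2,3) by (metis One_nat_def Suc_leI card_gt_0_iff empty_iff of_nat_1 of_nat_diff)
  finally show ?thesis
    by (simp add: fun_eq_iff fscale_def algebra_simps)
qed

text \<open>A column of length n contributes n(2 - n): its n diagonal pairs count +1 and its n(n -
  1) proper pairs count -1. Mixed pairs occur in both orders, whence the factor 2.\<close>

lemma swap_sum_alternating:
  assumes C: "C1 \<union> C2 = {..<d}" "C1 \<inter> C2 = {}"
    and alt: "alternating d C1 t" "alternating d C2 t" and t: "degree d t"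
  shows "swap_sum d t =
    fscale (of_nat (card C1) * (2 - of_nat (card C1)) + of_nat (card C2) * (2 - of_nat (card C2))) t
      + fscale 2 (\<Sum>i\<in>C1. \<Sum>j\<in>C2. swap_op d i j t)"
proof -
  have fin: "finite C1" "finite C2"
    using C finite_subset[of _ "{..<d}"] by blast+
  have same: "(\<Sum>a\<in>C. \<Sum>b\<in>C. swap_op d a b t) = fscale (of_nat (card C) * (2 - of_nat (card C))) t"
    if "alternating d C t" "finite C" for C
    using that t by (simp add: sum_swap_op_alternating fs.sum_constant_scale del: sum_constant)
  have "swap_sum d t = (\<Sum>a\<in>C1 \<union> C2. \<Sum>b\<in>C1 \<union> C2. swap_op d a b t)"
    unfolding swap_sum_def C ..
  also have "\<dots> = (\<Sum>a\<in>C1. \<Sum>b\<in>C1. swap_op d a b t) + (\<Sum>a\<in>C2. \<Sum>b\<in>C2. swap_op d a b t)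
      + (\<Sum>a\<in>C1. \<Sum>b\<in>C2. swap_op d a b t) + (\<Sum>a\<in>C2. \<Sum>b\<in>C1. swap_op d a b t)"
    using fin C(2) by (simp add: sum.union_disjoint sum.distrib)
  also have "(\<Sum>a\<in>C2. \<Sum>b\<in>C1. swap_op d a b t) = (\<Sum>a\<in>C1. \<Sum>b\<in>C2. swap_op d a b t)"
    by (subst sum.swap) (simp add: transpose_commute)
  finally show ?thesis
    using alt fin by (simp add: same) (simp add: fun_eq_iff fscale_def algebra_simps)
qed

section \<open>Tensors alternating in two columns\<close>

text \<open>With the normalization of \<^const>\<open>swap_sum\<close>, its eigenvalue on \<open>Y\<^sup>p\<^sup>,\<^sup>q\<close>: twice the sum of the
  contents of the boxes plus \<open>p + q\<close>.\<close>

definition content :: "nat \<Rightarrow> nat \<Rightarrow> 'k::field_char_0" where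
  "content p q = 2 * of_nat p + 4 * of_nat q - of_nat p ^ 2 - of_nat q ^ 2"

text \<open>Moving \<open>k\<close> boxes from the second column to the first lowers the content by
  \<open>2 * k * (1 + k + r)\<close> with \<open>r = p - q\<close>, which is nonzero in
  characteristic zero.\<close>

lemma content_neq:
  assumes "p + q = p' + q'" "q \<le> p" "p < p'"
  shows "content p' q' \<noteq> (content p q :: 'k::field_char_0)"
proof -
  obtain k where k: "p' = p + k" "q = q' + k" "k > 0"
    using assms by (metis add.assoc add_left_cancel less_imp_add_positive add.commute)
  then obtain r where r: "p = q' + k + r"
    using assms(2) le_Suc_ex by blast
  have "content p q - content p' q' = (of_nat (2 * k * (1 + k + r)) :: 'k)"
    unfolding k(1,2) r content_def by (simp add: algebra_simps power2_eq_square)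
  moreover have "(of_nat (2 * k * (1 + k + r)) :: 'k) \<noteq> 0"
    using k(3) by (simp only: of_nat_eq_0_iff) simp
  ultimately show ?thesis by force
qed

lemma tensor_power_outside: "t \<in> tensor_power scale d \<Longrightarrow> \<alpha>s \<notin> covectors scale d \<Longrightarrow> t \<alpha>s = 0"
  by (simp add: tensor_power_def)

lemma tensor_power_add:
  "t \<in> tensor_power scale d \<Longrightarrow> \<alpha>s \<in> covectors scale d \<Longrightarrow> i < d \<Longrightarrow> \<beta> \<in> dual scale \<Longrightarrow>
    \<gamma> \<in> dual scale \<Longrightarrow> t (\<alpha>s[i := \<beta> + \<gamma>]) = t (\<alpha>s[i := \<beta>]) + t (\<alpha>s[i := \<gamma>])"
  by (simp add: tensor_power_def)

lemma tensor_power_scale: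
  "t \<in> tensor_power scale d \<Longrightarrow> \<alpha>s \<in> covectors scale d \<Longrightarrow> i < d \<Longrightarrow> \<beta> \<in> dual scale \<Longrightarrow>
    t (\<alpha>s[i := fscale c \<beta>]) = c * t (\<alpha>s[i := \<beta>])"
  by (simp add: tensor_power_def)

lemma degree_tensor_power: "t \<in> tensor_power scale d \<Longrightarrow> degree d t"
  by (auto simp: degree_def tensor_power_def covectors_def)

lemma covectors_update:
  "\<alpha>s \<in> covectors scale d \<Longrightarrow> \<beta> \<in> dual scale \<Longrightarrow> \<alpha>s[i := \<beta>] \<in> covectors scale d"
  using set_update_subset_insert[of \<alpha>s i \<beta>] by (auto simp: covectors_def)

lemma covectors_nth: "\<alpha>s \<in> covectors scale d \<Longrightarrow> i < d \<Longrightarrow> \<alpha>s ! i \<in> dual scale"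
  by (auto simp: covectors_def)

lemma covectors_permute_list:
  "\<sigma> permutes {..<d} \<Longrightarrow> length \<alpha>s = d \<Longrightarrow>
    permute_list \<sigma> \<alpha>s \<in> covectors scale d \<longleftrightarrow> \<alpha>s \<in> covectors scale d"
  by (simp add: covectors_def)

lemma permute_list_update:
  assumes "\<sigma> permutes {..<length xs}" "i < length xs"
  shows "permute_list \<sigma> (xs[\<sigma> i := y]) = (permute_list \<sigma> xs)[i := y]"
proof (rule nth_equalityI)
  fix j assume "j < length (permute_list \<sigma> (xs[\<sigma> i := y]))"
  then show "permute_list \<sigma> (xs[\<sigma> i := y]) ! j = (permute_list \<sigma> xs)[i := y] ! j"
    using assms permutes_inj[OF assms(1)] permutes_in_image[OF assms(1)]
    by (auto simp: permute_list_nth nth_list_update inj_eq)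
qed simp

lemma subspace_tensor_power: "fs.subspace (tensor_power scale d)"
  by (rule fs.subspaceI) (auto simp: tensor_power_def fscale_def algebra_simps)

lemma perm_op_tensor_power:
  assumes \<sigma>: "\<sigma> permutes {..<d}" and t: "t \<in> tensor_power scale d"
  shows "perm_op d \<sigma> t \<in> tensor_power scale d"
  unfolding tensor_power_def
proof (intro CollectI conjI allI ballI impI)
  fix \<alpha>s assume "\<alpha>s \<notin> covectors scale d"
  then show "perm_op d \<sigma> t \<alpha>s = 0"
    using tensor_power_outside[OF t] covectors_permute_list[OF \<sigma>] by (auto simp: perm_op_def)
next
  fix \<alpha>s i \<beta> \<gamma> c
  assume \<alpha>s: "\<alpha>s \<in> covectors scale d" and i: "i < d" and \<beta>: "\<beta> \<in> dual scale" "\<gamma> \<in> dual scale"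
  have len: "length \<alpha>s = d" using \<alpha>s by (simp add: covectors_def)
  define j where "j = inv \<sigma> i"
  have j: "j < d" "\<sigma> j = i"
    using permutes_in_image[OF permutes_inv[OF \<sigma>], of i] i permutes_inverses[OF \<sigma>]
    by (auto simp: j_def)
  have "permute_list \<sigma> (\<alpha>s[i := y]) = (permute_list \<sigma> \<alpha>s)[j := y]" for y
    using permute_list_update[of \<sigma> \<alpha>s j y] \<sigma> j len by simp
  moreover have "permute_list \<sigma> \<alpha>s \<in> covectors scale d"
    using \<alpha>s covectors_permute_list[OF \<sigma> len] by simp
  ultimately show "perm_op d \<sigma> t (\<alpha>s[i := \<beta> + \<gamma>]) =
        perm_op d \<sigma> t (\<alpha>s[i := \<beta>]) + perm_op d \<sigma> t (\<alpha>s[i := \<gamma>])"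
      "perm_op d \<sigma> t (\<alpha>s[i := fscale c \<beta>]) = c * perm_op d \<sigma> t (\<alpha>s[i := \<beta>])"
    using t \<beta> j len by (simp_all add: perm_op_def tensor_power_add tensor_power_scale)
qed

lemma swap_op_tensor_power:
  "i < d \<Longrightarrow> j < d \<Longrightarrow> t \<in> tensor_power scale d \<Longrightarrow> swap_op d i j t \<in> tensor_power scale d"
  by (simp add: perm_op_tensor_power permutes_swap_id)

lemma shift_op_tensor_power:
  assumes "C \<subseteq> {..<d}" "x < d" "t \<in> tensor_power scale d"
  shows "shift_op d C x t \<in> tensor_power scale d"
  unfolding shift_op_def using assms
  by (intro fs.subspace_diff[OF subspace_tensor_power] fs.subspace_sum[OF subspace_tensor_power]
      swap_op_tensor_power) auto

lemma swap_sum_tensor_power: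
  "t \<in> tensor_power scale d \<Longrightarrow> swap_sum d t \<in> tensor_power scale d"
  unfolding swap_sum_def
  by (intro fs.subspace_sum[OF subspace_tensor_power] swap_op_tensor_power) auto

definition bialternating ::
  "('k::field \<Rightarrow> 'v::ab_group_add \<Rightarrow> 'v) \<Rightarrow> nat \<Rightarrow> nat set \<Rightarrow> nat set \<Rightarrow> ('k, 'v) tensor set" where
  "bialternating scale d C1 C2 =
    {t \<in> tensor_power scale d. alternating d C1 t \<and> alternating d C2 t}"

lemma bialternating_commute: "bialternating scale d C1 C2 = bialternating scale d C2 C1"
  by (auto simp: bialternating_def)

lemma subspace_alternating: "fs.subspace {t. alternating d C t}"
  by (rule fs.subspaceI) (auto simp: alternating_def perm_op_linear)

lemma subspace_bialternating: "fs.subspace (bialternating scale d C1 C2)"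
proof -
  have "bialternating scale d C1 C2 =
      tensor_power scale d \<inter> ({t. alternating d C1 t} \<inter> {t. alternating d C2 t})"
    by (auto simp: bialternating_def)
  then show ?thesis
    by (simp add: fs.subspace_inter subspace_tensor_power subspace_alternating)
qed

lemma swap_sum_bialternating:
  assumes "C1 \<subseteq> {..<d}" "C2 \<subseteq> {..<d}" "t \<in> bialternating scale d C1 C2"
  shows "swap_sum d t \<in> bialternating scale d C1 C2"
proof -
  have "swap_op d i j (swap_sum d t) = - swap_sum d t"
    if "swap_op d i j t = - t" "i < d" "j < d" for i j
    using that swap_sum_linear(2)[of d 0 t]
    by (simp flip: swap_sum_perm_op add: permutes_swap_id swap_sum_linear)
  then show ?thesis
    using assms by (auto simp: bialternating_def alternating_def swap_sum_tensor_power subset_iff)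
qed

lemma shift_op_bialternating:
  assumes "C1 \<subseteq> {..<d}" "C2 \<subseteq> {..<d}" "x < d" "x \<notin> C1" "x \<notin> C2" "C1 \<inter> C2 = {}"
    and "t \<in> bialternating scale d C1 (insert x C2)"
  shows "shift_op d C1 x t \<in> bialternating scale d (insert x C1) C2"
proof -
  have t: "t \<in> tensor_power scale d" "alternating d C1 t" "alternating d C2 t"
    using assms(7) by (auto simp: bialternating_def elim: alternating_subset)
  have "alternating d (insert x C1) (shift_op d C1 x t)"
    using t assms by (intro alternating_shift_op degree_tensor_power) auto
  moreover have "alternating d C2 (shift_op d C1 x t)"
    using t assms by (intro alternating_shift_op_other) auto
  ultimately show ?thesis
    using t assms by (simp add: bialternating_def shift_op_tensor_power)
qed

section \<open>The identities for the raising and lowering operators\<close>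

definition columns :: "nat \<Rightarrow> nat set \<Rightarrow> nat set \<Rightarrow> bool" where
  "columns d C1 C2 \<longleftrightarrow> C1 \<union> C2 = {..<d} \<and> C1 \<inter> C2 = {}"

lemma columns_insert_iff:
  assumes "x \<notin> C1" "x \<notin> C2"
  shows "columns d C1 (insert x C2) \<longleftrightarrow> columns d (insert x C1) C2"
  using assms by (auto simp: columns_def)

lemma columns_finite: "columns d C1 C2 \<Longrightarrow> finite C1 \<and> finite C2"
  unfolding columns_def by (metis finite_Un finite_lessThan)

lemma columns_card: "columns d C1 C2 \<Longrightarrow> card C1 + card C2 = d"
  by (metis card_Un_disjoint card_lessThan columns_def columns_finite)

text \<open>The constant is the content of the very shape on which \<open>t\<close> lives. So a
  tensor killed by the move into the first column is an eigentensor of \<open>swap_sum\<close> for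
  its own shape.\<close>

lemma shift_op_shift_op_columns:
  fixes t :: "('k::field_char_0, 'v::ab_group_add) tensor"
  assumes C: "columns d C1 (insert x C2)" "x \<notin> C2"
    and t: "t \<in> bialternating scale d C1 (insert x C2)"
  shows "fscale 2 (shift_op d C2 x (shift_op d C1 x t)) =
    fscale (content (card C1) (card C2 + 1)) t - swap_sum d t"
proof -
  have fin: "finite C1" "finite C2" using columns_finite[OF C(1)] by auto
  have alt: "alternating d C1 t" "alternating d (insert x C2) t" and deg: "degree d t"
    using t by (auto simp: bialternating_def degree_tensor_power)
  define S where "S = (\<Sum>i\<in>C1. \<Sum>j\<in>insert x C2. swap_op d i j t)"
  have 1: "shift_op d C2 x (shift_op d C1 x t) = fscale (of_nat (card C2 + 1)) t - S"
    unfolding S_def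
    by (rule shift_op_shift_op[OF alt(2) _ _ _ _ C(2) _ deg]) (use C in \<open>auto simp: columns_def\<close>)
  have 2: "swap_sum d t = fscale (of_nat (card C1) * (2 - of_nat (card C1)) +
      of_nat (card (insert x C2)) * (2 - of_nat (card (insert x C2)))) t + fscale 2 S"
    unfolding S_def
    by (rule swap_sum_alternating[OF _ _ alt deg]) (use C in \<open>auto simp: columns_def\<close>)
  show ?thesis
    unfolding 1 2 using fin C(2)
    by (simp add: fun_eq_iff fscale_def content_def algebra_simps power2_eq_square)
qed

text \<open>This is the previous identity with the columns exchanged. The constant stays the same
  because \<open>content m (n + 1)\<close> is symmetric in \<open>m\<close> and
  \<open>n\<close>.\<close>

lemma shift_op_shift_op_columns':
  fixes t :: "('k::field_char_0, 'v::ab_group_add) tensor"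
  assumes C: "columns d C1 (insert x C2)" "x \<notin> C2"
    and t: "t \<in> bialternating scale d (insert x C1) C2"
  shows "fscale 2 (shift_op d C1 x (shift_op d C2 x t)) =
    fscale (content (card C1) (card C2 + 1)) t - swap_sum d t"
proof -
  have "content (card C2) (card C1 + 1) = (content (card C1) (card C2 + 1) :: 'k)"
    by (simp add: content_def algebra_simps power2_eq_square)
  then show ?thesis
    using shift_op_shift_op_columns[of d C2 x C1 t] assms
    by (auto simp: columns_def bialternating_commute)
qed

lemma swap_sum_one_column:
  fixes t :: "('k::field_char_0, 'v::ab_group_add) tensor"
  assumes "columns d C1 {}" "t \<in> bialternating scale d C1 {}"
  shows "swap_sum d t = fscale (content (card C1) 0) t"
  using assms swap_sum_alternating[of C1 "{}" d t] degree_tensor_power[of t scale d]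
  by (simp add: columns_def bialternating_def content_def algebra_simps power2_eq_square)

section \<open>Spectral decomposition of the sum of transpositions\<close>

lemma shift_op_step:
  assumes "columns d C1 C2" "x \<in> C2" and "t \<in> bialternating scale d C1 C2"
  shows "columns d (insert x C1) (C2 - {x})"
    and "shift_op d C1 x t \<in> bialternating scale d (insert x C1) (C2 - {x})"
    and "u \<in> bialternating scale d (insert x C1) (C2 - {x}) \<Longrightarrow>
      shift_op d (C2 - {x}) x u \<in> bialternating scale d C1 C2"
proof -
  have x: "x \<notin> C1" "insert x (C2 - {x}) = C2" "x < d" "C1 \<subseteq> {..<d}" "C2 \<subseteq> {..<d}" "C1 \<inter> C2 = {}"
    using assms(1,2) by (auto simp: columns_def)
  then show "columns d (insert x C1) (C2 - {x})"
    using columns_insert_iff[of x C1 "C2 - {x}"] assms(1) by auto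
  show "shift_op d C1 x t \<in> bialternating scale d (insert x C1) (C2 - {x})"
    by (rule shift_op_bialternating) (use x assms in auto)
  show "shift_op d (C2 - {x}) x u \<in> bialternating scale d C1 C2"
    if "u \<in> bialternating scale d (insert x C1) (C2 - {x})"
    using shift_op_bialternating[of "C2 - {x}" d C1 x u scale] that x
    by (auto simp: bialternating_commute)
qed

text \<open>Moving a place into the first column keeps the eigenvalue and lengthens the column, so
  by induction it gives zero. Then \<open>t\<close> is an eigentensor for the content of its own
  shape, and \<open>content_neq\<close> separates that from \<open>content p q\<close>.\<close>

lemma eigentensor_above:
  fixes t :: "('k::field_char_0, 'v::ab_group_add) tensor"
  assumes "columns d C1 C2" "t \<in> bialternating scale d C1 C2"
    and "p + q = d" "q \<le> p" "p < card C1"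
    and "swap_sum d t = fscale (content p q) t"
  shows "t = 0"
  using assms
proof (induction "card C2" arbitrary: C1 C2 t)
  case 0
  then have "C2 = {}" using columns_finite by fastforce
  then have "swap_sum d t = fscale (content (card C1) 0) t" "card C1 = d"
    using 0 swap_sum_one_column columns_card by fastforce+
  then show ?case
    using 0 content_neq[of p q "card C1" 0, where ?'k='k] by (metis add_0_right fs.scale_right_imp_eq)
next
  case (Suc n)
  then obtain x where x: "x \<in> C2" by fastforce
  note step = shift_op_step[OF Suc.prems(1) x]
  have C2: "insert x (C2 - {x}) = C2" "x \<notin> C2 - {x}" using x by auto
  have xC1: "x \<notin> C1" using Suc.prems(1) x by (auto simp: columns_def)
  have fin: "finite C1" "finite C2" using Suc.prems(1) columns_finite by auto
  have card_C2: "card (C2 - {x}) + 1 = card C2" using card_Suc_Diff1[OF fin(2) x] by simp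
  have sub: "C1 \<subseteq> {..<d}" "x < d" using Suc.prems(1) x by (auto simp: columns_def)
  have "shift_op d C1 x t = 0"
  proof (rule Suc.hyps(1))
    show "n = card (C2 - {x})" using Suc.hyps(2) x fin by simp
    show "columns d (insert x C1) (C2 - {x})"
      "shift_op d C1 x t \<in> bialternating scale d (insert x C1) (C2 - {x})"
      using step Suc.prems by blast+
    show "swap_sum d (shift_op d C1 x t) = fscale (content p q) (shift_op d C1 x t)"
      using Suc.prems by (simp add: swap_sum_shift_op sub shift_op_linear)
  qed (use Suc.prems xC1 fin in auto)
  then have "fscale (content (card C1) (card C2)) t = swap_sum d t"
    using shift_op_shift_op_columns[of d C1 x "C2 - {x}" t scale, unfolded C2(1) card_C2] Suc.prems C2
    by (simp add: shift_op_linear)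
  moreover have "content (card C1) (card C2) \<noteq> (content p q :: 'k)"
    using Suc.prems columns_card[OF Suc.prems(1)] by (intro content_neq) auto
  ultimately show ?case
    using Suc.prems(6) by (metis fs.scale_right_imp_eq)
qed

text \<open>With T for \<open>swap_sum\<close> and c for \<open>content p q\<close>, the kernel and
  the image of T - c together span: this is diagonalizability as far as the single eigenvalue c is
  concerned. In the induction E moves \<open>x\<close> into the first column, F moves it back, and e
  is the content of the present shape. Then 2 F E = e - T here, and 2 E F = e - T one shape
  above.\<close>

lemma eigen_decomposition:
  fixes t :: "('k::field_char_0, 'v::ab_group_add) tensor"
  assumes "columns d C1 C2" "t \<in> bialternating scale d C1 C2"
    and "p + q = d" "q \<le> p" "card C2 \<le> card C1"
  shows "\<exists>u \<in> bialternating scale d C1 C2. \<exists>v \<in> bialternating scale d C1 C2.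
    swap_sum d u = fscale (content p q) u \<and> t = u + (swap_sum d v - fscale (content p q) v)"
  using assms
proof (induction "card C2" arbitrary: C1 C2 t)
  case 0
  then have "C2 = {}" using columns_finite by fastforce
  let ?c = "content p q :: 'k" and ?e = "content (card C1) 0 :: 'k"
  have eig: "swap_sum d t = fscale ?e t" if "t \<in> bialternating scale d C1 C2" for t
    using swap_sum_one_column that 0 \<open>C2 = {}\<close> by blast
  note sub = subspace_bialternating[of scale d C1 C2]
  show ?case
  proof (cases "?e = ?c")
    case True
    then have "swap_sum d t = fscale ?c t" using eig 0 by simp
    moreover have "t = t + (swap_sum d 0 - fscale ?c 0)"
      by (simp only: swap_sum_linear fs.scale_zero_right diff_self add_0_right)
    ultimately show ?thesis using 0(3) fs.subspace_0[OF sub] by blast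
  next
    case False
    define v where "v = fscale (1 / (?e - ?c)) t"
    have v: "v \<in> bialternating scale d C1 C2"
      unfolding v_def by (rule fs.subspace_scale[OF sub 0(3)])
    have "swap_sum d v - fscale ?c v = t"
      using False by (simp add: eig[OF v] fs.scale_left_diff_distrib[symmetric]) (simp add: v_def)
    then have "t = 0 + (swap_sum d v - fscale ?c v)" by (simp only: add_0)
    moreover have "swap_sum d 0 = fscale ?c (0 :: ('k, 'v) tensor)"
      by (simp only: swap_sum_linear fs.scale_zero_right)
    ultimately show ?thesis using v fs.subspace_0[OF sub] by blast
  qed
next
  case (Suc n)
  then obtain x where x: "x \<in> C2" by fastforce
  note step = shift_op_step[OF Suc.prems(1) x]
  have C2: "insert x (C2 - {x}) = C2" "x \<notin> C2 - {x}" using x by auto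
  have xC1: "x \<notin> C1" using Suc.prems(1) x by (auto simp: columns_def)
  have fin: "finite C1" "finite C2" using Suc.prems(1) columns_finite by auto
  have card_C2: "card (C2 - {x}) + 1 = card C2" using card_Suc_Diff1[OF fin(2) x] by simp
  have sub: "C2 - {x} \<subseteq> {..<d}" "C1 \<subseteq> {..<d}" "x < d"
    using Suc.prems(1) x by (auto simp: columns_def)
  let ?c = "content p q :: 'k" and ?e = "content (card C1) (card C2) :: 'k"
  let ?E = "shift_op d C1 x :: ('k, 'v) tensor \<Rightarrow> _" and ?F = "shift_op d (C2 - {x}) x :: ('k, 'v) tensor \<Rightarrow> _"
  have FE: "fscale 2 (?F (?E t)) = fscale ?e t - swap_sum d t"
    if "t \<in> bialternating scale d C1 C2" for t
    using shift_op_shift_op_columns[of d C1 x "C2 - {x}" t scale, unfolded C2(1) card_C2] Suc.prems(1) that C2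
    by simp
  have EF: "fscale 2 (?E (?F t)) = fscale ?e t - swap_sum d t"
    if "t \<in> bialternating scale d (insert x C1) (C2 - {x})" for t
    using shift_op_shift_op_columns'[of d C1 x "C2 - {x}" t scale, unfolded C2(1) card_C2] Suc.prems(1) that C2
    by simp
  have IH: "\<exists>u\<in>bialternating scale d (insert x C1) (C2 - {x}). \<exists>v\<in>bialternating scale d (insert x C1) (C2 - {x}).
      swap_sum d u = fscale ?c u \<and> t = u + (swap_sum d v - fscale ?c v)"
    if "t \<in> bialternating scale d (insert x C1) (C2 - {x})" for t
    by (rule Suc.hyps(1)) (use that Suc.hyps(2) Suc.prems x fin step xC1 in auto)
  show ?case
  proof (cases "?e = ?c")
    case False
    obtain u v where uv: "u \<in> bialternating scale d (insert x C1) (C2 - {x})"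
      "v \<in> bialternating scale d (insert x C1) (C2 - {x})"
      "swap_sum d u = fscale ?c u" "?E t = u + (swap_sum d v - fscale ?c v)"
      using IH[OF step(2)[OF Suc.prems(2)]] by blast
    \<comment> \<open>The equation to solve is (e - c) t = 2 F E t + (T - c) t. Decomposing E t by
      induction and applying F, which commutes with T, gives both witnesses.\<close>
    define u' where "u' = fscale (1 / (?e - ?c)) (fscale 2 (?F u))"
    define v' where "v' = fscale (1 / (?e - ?c)) (fscale 2 (?F v) + t)"
    have "u' \<in> bialternating scale d C1 C2" "v' \<in> bialternating scale d C1 C2"
      unfolding u'_def v'_def
      by (intro fs.subspace_scale fs.subspace_add subspace_bialternating step(3)[OF Suc.prems(2)] uv Suc.prems)+
    moreover have "swap_sum d u' = fscale ?c u'"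
      using sub by (simp add: u'_def swap_sum_linear swap_sum_shift_op uv(3) shift_op_linear mult.commute)
    moreover have "u' + (swap_sum d v' - fscale ?c v') = t"
    proof -
      have "fscale (?e - ?c) t = fscale 2 (?F (?E t)) + (swap_sum d t - fscale ?c t)"
        using FE[OF Suc.prems(2)] by (simp add: fs.scale_left_diff_distrib)
      also have "\<dots> = fscale 2 (?F u) + (swap_sum d (fscale 2 (?F v) + t) - fscale ?c (fscale 2 (?F v) + t))"
        using sub unfolding uv(4)
        by (simp add: swap_sum_linear swap_sum_shift_op shift_op_linear)
          (simp add: fun_eq_iff fscale_def algebra_simps)
      finally have "fscale (1 / (?e - ?c)) (fscale (?e - ?c) t) = u' + (swap_sum d v' - fscale ?c v')"
        by (simp only: u'_def v'_def swap_sum_linear fs.scale_left_commute[of ?c]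
            fs.scale_right_diff_distrib fs.scale_right_distrib)
      then show ?thesis using False by simp
    qed
    ultimately show ?thesis by metis
  next
    case True
    \<comment> \<open>Equal contents force at least \<open>p\<close> boxes in the first column. So c
      is not an eigenvalue one shape above, and the induction hypothesis makes T - c surjective
      there.\<close>
    have "card (insert x C1) > p"
    proof (rule ccontr)
      assume "\<not> ?thesis"
      then have "card C1 < p" using xC1 fin by simp
      then have "?c \<noteq> ?e"
        using Suc.prems columns_card[OF Suc.prems(1)] by (intro content_neq) auto
      then show False using True by simp
    qed
    then have above: "\<exists>u\<in>bialternating scale d (insert x C1) (C2 - {x}). t = swap_sum d u - fscale ?c u"
      if "t \<in> bialternating scale d (insert x C1) (C2 - {x})" for t
      using IH[OF that] eigentensor_above[OF step(1)[OF Suc.prems(2)] _ Suc.prems(3,4)] by (metis add_0)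
    obtain u where u: "u \<in> bialternating scale d (insert x C1) (C2 - {x})" "?E t = swap_sum d u - fscale ?c u"
      using above[OF step(2)[OF Suc.prems(2)]] by blast
    obtain v where v: "v \<in> bialternating scale d (insert x C1) (C2 - {x})" "u = swap_sum d v - fscale ?c v"
      using above[OF u(1)] by blast
    let ?G = "fscale 2 (?F v)"
    \<comment> \<open>Inverting T - c twice gave E t = (T - c)(T - c) v. As 2 E F = -(T - c) one
      shape above, adding (T - c)(2 F v) to t cancels this and makes E t0 = 0.\<close>
    define t0 where "t0 = t + (swap_sum d ?G - fscale ?c ?G)"
    have G: "?G \<in> bialternating scale d C1 C2"
      by (intro fs.subspace_scale subspace_bialternating step(3)[OF Suc.prems(2)] v)
    have t0: "t0 \<in> bialternating scale d C1 C2"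
      unfolding t0_def using Suc.prems(1)
      by (intro fs.subspace_scale fs.subspace_diff fs.subspace_add subspace_bialternating
          swap_sum_bialternating Suc.prems(2) G) (auto simp: columns_def)
    have "?E t0 = ?E t + (swap_sum d (fscale 2 (?E (?F v))) - fscale ?c (fscale 2 (?E (?F v))))"
      using sub by (simp add: t0_def swap_sum_linear swap_sum_shift_op shift_op_linear)
    also have "fscale 2 (?E (?F v)) = - u"
      using EF[OF v(1)] True v(2) by simp
    also have "?E t + (swap_sum d (- u) - fscale ?c (- u)) = 0"
      using u(2) swap_sum_linear(2)[of d 0 u] by (simp add: swap_sum_linear)
    finally have "fscale 2 (?F (?E t0)) = 0" by (simp add: shift_op_linear)
    then have "swap_sum d t0 = fscale ?c t0"
      using FE[OF t0] True by simp
    moreover have "t = t0 + (swap_sum d (- ?G) - fscale ?c (- ?G))"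
      using swap_sum_linear(2)[of d 0 ?G] by (simp add: t0_def swap_sum_linear)
    moreover have "- ?G \<in> bialternating scale d C1 C2"
      by (rule fs.subspace_neg[OF subspace_bialternating G])
    ultimately show ?thesis using t0 by metis
  qed
qed

section \<open>Symmetrization along the rows\<close>

lemma permute_list_transpose:
  assumes "i < length xs" "j < length xs"
  shows "permute_list (transpose i j) xs = xs[i := xs ! j, j := xs ! i]"
  using assms by (intro nth_equalityI) (auto simp: permute_list_def nth_list_update transpose_def)

lemma eq_uminus_self: "x = - x \<Longrightarrow> x = 0" for x :: "'a::field_char_0"
proof -
  assume "x = - x"
  then have "2 * x = 0" by (metis add.right_inverse mult_2)
  then show "x = 0" by simp
qed

lemma alternating_eq_0:
  fixes t :: "('k::field_char_0, 'v) tensor"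
  assumes "alternating d S t" "i \<in> S" "j \<in> S" "i \<noteq> j" "i < d" "j < d"
    and "length \<alpha>s = d" "\<alpha>s ! i = \<alpha>s ! j"
  shows "t \<alpha>s = 0"
proof -
  have "permute_list (transpose i j) \<alpha>s = \<alpha>s"
    using assms by (simp add: permute_list_transpose) (metis list_update_id)
  then have "swap_op d i j t \<alpha>s = t \<alpha>s"
    using assms by (simp add: perm_op_def)
  moreover have "swap_op d i j t \<alpha>s = - t \<alpha>s"
    using assms by (simp add: alternating_def)
  ultimately show ?thesis by (metis eq_uminus_self)
qed

lemma perm_op_alternating:
  fixes t :: "('k::field, 'v) tensor"
  assumes "\<sigma> permutes S" "S \<subseteq> {..<d}" "alternating d S t" "degree d t"
  shows "perm_op d \<sigma> t = fscale (of_int (sign \<sigma>)) t"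
proof -
  have fin: "finite S" using assms(2) finite_subset by blast
  show ?thesis
    using assms(1) fin
  proof (induction rule: permutes_induct)
    case id
    show ?case using perm_op_id[OF assms(4)] by (metis fs.scale_one of_int_1 sign_id)
  next
    case (swap a b \<sigma>)
    have "perm_op d (transpose a b \<circ> \<sigma>) t = swap_op d a b (perm_op d \<sigma> t)"
      using swap assms(2) permutes_subset by (subst perm_op_comp) blast+
    also have "\<dots> = fscale (of_int (sign \<sigma>)) (- t)"
      using swap assms(3) by (simp add: perm_op_linear alternating_def)
    also have "\<dots> = fscale (of_int (sign (transpose a b \<circ> \<sigma>))) t"
      using swap permutes_imp_permutation[OF fin swap(4)]
      by (simp add: sign_compose permutation_swap_id sign_swap_id)
    finally show ?case .
  qed
qed

section \<open>The Young symmetrizer as a row operator after a column operator\<close>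

definition row_op :: "nat \<Rightarrow> nat \<Rightarrow> ('k::field, 'v) tensor \<Rightarrow> ('k, 'v) tensor" where
  "row_op p q t = (\<Sum>\<rho>\<in>row_group p q. perm_op (p + q) \<rho> t)"

definition column_op :: "nat \<Rightarrow> nat \<Rightarrow> ('k::field, 'v) tensor \<Rightarrow> ('k, 'v) tensor" where
  "column_op p q t =
    (\<Sum>\<kappa>\<in>column_group p q. fscale (of_int (sign \<kappa>)) (perm_op (p + q) \<kappa> t))"

lemma finite_row_group: "finite (row_group p q)"
  by (rule finite_subset[OF _ finite_permutations[of "{..<p + q}"]]) (auto simp: row_group_def)

lemma finite_column_group: "finite (column_group p q)"
  by (rule finite_subset[OF _ finite_permutations[of "{..<p + q}"]]) (auto simp: column_group_def)

lemma young_symmetrizer_eq: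
  assumes "t \<in> tensor_power scale (p + q)"
  shows "young_symmetrizer p q t = row_op p q (column_op p q t)"
proof (rule ext)
  fix \<alpha>s
  have perm: "perm_op (p + q) \<sigma> t \<alpha>s = t (permute_list \<sigma> \<alpha>s)" for \<sigma>
    using degree_tensor_power[OF assms] by (auto simp: perm_op_def degree_def)
  have "row_op p q (column_op p q t) =
    (\<Sum>\<rho>\<in>row_group p q. \<Sum>\<kappa>\<in>column_group p q. fscale (of_int (sign \<kappa>)) (perm_op (p + q) (\<rho> \<circ> \<kappa>) t))"
    by (auto simp: row_op_def column_op_def perm_op_linear perm_op_comp column_group_def intro!: sum.cong)
  then show "young_symmetrizer p q t \<alpha>s = row_op p q (column_op p q t) \<alpha>s"
    by (simp add: young_symmetrizer_def sum_fun_apply fscale_apply perm)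
qed

lemma transpose_column_group:
  assumes "i < p + q" "j < p + q" "i < p \<longleftrightarrow> j < p" "\<kappa> \<in> column_group p q"
  shows "transpose i j \<circ> \<kappa> \<in> column_group p q"
proof -
  have "transpose i j k < p \<longleftrightarrow> k < p" for k
    using assms(3) by (cases "k = i"; cases "k = j") simp_all
  moreover have "\<kappa> permutes {..<p + q}" "\<forall>k<p + q. \<kappa> k < p \<longleftrightarrow> k < p"
    using assms(4) by (auto simp: column_group_def)
  ultimately show ?thesis
    using assms(1,2) by (simp add: column_group_def permutes_compose permutes_swap_id)
qed

lemma alternating_column_op:
  assumes "\<And>i. i \<in> S \<Longrightarrow> i < p + q" "\<And>i j. i \<in> S \<Longrightarrow> j \<in> S \<Longrightarrow> i < p \<longleftrightarrow> j < p"
  shows "alternating (p + q) S (column_op p q t)"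
  unfolding alternating_def
proof (intro ballI impI)
  fix i j assume ij: "i \<in> S" "j \<in> S" "i \<noteq> j"
  have perm: "\<kappa> permutes {..<p + q}" "permutation \<kappa>" if "\<kappa> \<in> column_group p q" for \<kappa>
    using that permutes_imp_permutation[of "{..<p + q}"] by (auto simp: column_group_def)
  have "swap_op (p + q) i j (column_op p q t) =
      (\<Sum>\<kappa>\<in>column_group p q. fscale (of_int (sign \<kappa>)) (perm_op (p + q) (transpose i j \<circ> \<kappa>) t))"
    by (simp add: column_op_def perm_op_linear perm_op_comp perm cong: sum.cong)
  also have "\<dots> = (\<Sum>\<kappa>\<in>column_group p q. - fscale (of_int (sign \<kappa>)) (perm_op (p + q) \<kappa> t))"
  proof (rule sum.reindex_bij_witness[of _ "\<lambda>\<kappa>. transpose i j \<circ> \<kappa>" "\<lambda>\<kappa>. transpose i j \<circ> \<kappa>"])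
    fix \<kappa> assume \<kappa>: "\<kappa> \<in> column_group p q"
    show "transpose i j \<circ> \<kappa> \<in> column_group p q" "transpose i j \<circ> \<kappa> \<in> column_group p q"
      by (rule transpose_column_group[OF assms(1)[OF ij(1)] assms(1)[OF ij(2)] assms(2)[OF ij(1,2)] \<kappa>])+
    show "- fscale (of_int (sign (transpose i j \<circ> \<kappa>))) (perm_op (p + q) (transpose i j \<circ> \<kappa>) t) =
        fscale (of_int (sign \<kappa>)) (perm_op (p + q) (transpose i j \<circ> \<kappa>) t)"
      using perm[OF \<kappa>] ij by (simp add: sign_compose permutation_swap_id sign_swap_id)
  qed (simp_all add: fun_eq_iff)
  finally show "swap_op (p + q) i j (column_op p q t) = - column_op p q t"
    by (simp add: column_op_def sum_negf)
qed

lemma column_op_bialternating: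
  assumes "t \<in> tensor_power scale (p + q)"
  shows "column_op p q t \<in> bialternating scale (p + q) {..<p} {p..<p + q}"
proof -
  have "column_op p q t \<in> tensor_power scale (p + q)"
    unfolding column_op_def using assms
    by (intro fs.subspace_sum fs.subspace_scale subspace_tensor_power perm_op_tensor_power)
      (auto simp: column_group_def)
  then show ?thesis
    by (auto simp: bialternating_def intro!: alternating_column_op)
qed

text \<open>A permutation preserving both columns is the product of one permutation inside each, and
  the sign is multiplicative.\<close>

lemma perm_op_column_group:
  assumes \<kappa>: "\<kappa> \<in> column_group p q" and t: "t \<in> bialternating scale (p + q) {..<p} {p..<p + q}"
  shows "perm_op (p + q) \<kappa> t = fscale (of_int (sign \<kappa>)) t"
proof -
  have \<kappa>p: "\<kappa> permutes {..<p + q}" and \<kappa>i: "\<And>i. i < p + q \<Longrightarrow> \<kappa> i < p \<longleftrightarrow> i < p"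
    using \<kappa> by (auto simp: column_group_def)
  define \<kappa>1 where "\<kappa>1 = (\<lambda>i. if i < p then \<kappa> i else i)"
  define \<kappa>2 where "\<kappa>2 = (\<lambda>i. if i < p then i else \<kappa> i)"
  have inj: "inj \<kappa>" using \<kappa>p permutes_inj by blast
  have lt: "\<kappa> i < p + q \<longleftrightarrow> i < p + q" for i
    using permutes_in_image[OF \<kappa>p, of i] by simp
  have out: "\<kappa> i = i" if "i \<ge> p + q" for i
    using \<kappa>p that by (intro permutes_not_in[OF \<kappa>p]) auto
  have 1: "\<kappa>1 permutes {..<p}"
  proof (rule inj_imp_permutes)
    show "inj_on \<kappa>1 {..<p}" using inj by (auto simp: \<kappa>1_def inj_on_def)
  qed (use \<kappa>i in \<open>auto simp: \<kappa>1_def\<close>)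
  have 2: "\<kappa>2 permutes {p..<p + q}"
  proof (rule inj_imp_permutes)
    show "inj_on \<kappa>2 {p..<p + q}" using inj by (auto simp: \<kappa>2_def inj_on_def)
    show "\<kappa>2 i \<in> {p..<p + q}" if "i \<in> {p..<p + q}" for i
      using that \<kappa>i[of i] lt[of i] by (auto simp: \<kappa>2_def)
    show "\<kappa>2 i = i" if "i \<notin> {p..<p + q}" for i
      using that out by (auto simp: \<kappa>2_def)
  qed simp
  have eq: "\<kappa> = \<kappa>1 \<circ> \<kappa>2"
  proof
    fix i show "\<kappa> i = (\<kappa>1 \<circ> \<kappa>2) i"
      using \<kappa>i[of i] out[of i] by (cases "i < p + q") (auto simp: \<kappa>1_def \<kappa>2_def)
  qed
  have deg: "degree (p + q) t" and alt: "alternating (p + q) {..<p} t" "alternating (p + q) {p..<p + q} t"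
    using t by (auto simp: bialternating_def degree_tensor_power)
  have "perm_op (p + q) \<kappa> t = perm_op (p + q) \<kappa>1 (perm_op (p + q) \<kappa>2 t)"
    unfolding eq by (rule perm_op_comp[symmetric], rule permutes_subset[OF 2]) auto
  also have "\<dots> = fscale (of_int (sign \<kappa>2)) (fscale (of_int (sign \<kappa>1)) t)"
    using perm_op_alternating[OF 1 _ alt(1) deg] perm_op_alternating[OF 2 _ alt(2) deg]
    by (simp add: perm_op_linear subset_iff)
  also have "\<dots> = fscale (of_int (sign \<kappa>)) t"
    using permutes_imp_permutation[OF _ 1] permutes_imp_permutation[OF _ 2]
    by (simp add: eq sign_compose mult.commute)
  finally show ?thesis .
qed

lemma id_row_group: "id \<in> row_group p q"
  by (simp add: row_group_def permutes_id)

lemma id_column_group: "id \<in> column_group p q"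
  by (simp add: column_group_def permutes_id)

lemma column_op_of_bialternating:
  assumes t: "t \<in> bialternating scale (p + q) {..<p} {p..<p + q}"
  shows "column_op p q t = fscale (of_nat (card (column_group p q))) t"
proof -
  have "column_op p q t = (\<Sum>\<kappa>\<in>column_group p q. t)"
    unfolding column_op_def
    by (intro sum.cong refl) (simp add: perm_op_column_group[OF _ t] flip: of_int_mult)
  then show ?thesis by (simp add: fs.sum_constant_scale del: sum_constant)
qed

lemma row_op_linear:
  "row_op p q (t + u) = row_op p q t + row_op p q u"
  "row_op p q (t - u) = row_op p q t - row_op p q u"
  "row_op p q (- t) = - row_op p q t"
  "row_op p q (fscale c t) = fscale c (row_op p q t)"
  "row_op p q 0 = 0"
  by (simp_all add: row_op_def perm_op_linear sum.distrib sum_subtractf sum_negf fs.scale_sum_right)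

lemma row_op_sum: "row_op p q (\<Sum>i\<in>A. f i) = (\<Sum>i\<in>A. row_op p q (f i))"
  using sum_comp_morphism[of "row_op p q" f A] by (simp add: o_def row_op_linear)

text \<open>\<open>column_op\<close> maps onto the tensors alternating in both columns, because on
  these it is multiplication by the order of the column group, which is invertible in characteristic
  zero.\<close>

lemma Y_eq_row_op:
  fixes scale :: "'k::field_char_0 \<Rightarrow> 'v::ab_group_add \<Rightarrow> 'v"
  shows "Y scale p (int q) = row_op p q ` bialternating scale (p + q) {..<p} {p..<p + q}"
proof
  show "Y scale p (int q) \<subseteq> row_op p q ` bialternating scale (p + q) {..<p} {p..<p + q}"
    by (auto simp: Y_def young_symmetrizer_eq column_op_bialternating)
  show "row_op p q ` bialternating scale (p + q) {..<p} {p..<p + q} \<subseteq> Y scale p (int q)"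
  proof
    fix y assume "y \<in> row_op p q ` bialternating scale (p + q) {..<p} {p..<p + q}"
    then obtain t where t: "t \<in> bialternating scale (p + q) {..<p} {p..<p + q}" "y = row_op p q t" by blast
    let ?n = "of_nat (card (column_group p q)) :: 'k"
    have n: "?n \<noteq> 0" using id_column_group[of p q] finite_column_group[of p q] by auto
    let ?u = "fscale (1 / ?n) t"
    have u: "?u \<in> bialternating scale (p + q) {..<p} {p..<p + q}"
      using t by (simp add: fs.subspace_scale subspace_bialternating)
    then have up: "?u \<in> tensor_power scale (p + q)" by (simp add: bialternating_def)
    have "young_symmetrizer p q ?u = row_op p q (fscale ?n ?u)"
      using young_symmetrizer_eq[OF up] column_op_of_bialternating[OF u] by simp
    also have "\<dots> = y" using n t by simp
    finally have "y = young_symmetrizer p q ?u" ..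
    moreover have "Y scale p (int q) = young_symmetrizer p q ` tensor_power scale (p + q)"
      by (simp add: Y_def)
    ultimately show "y \<in> Y scale p (int q)"
      using up by (metis imageI)
  qed
qed

lemma row_op_swap_op:
  assumes "i < q" "q \<le> p"
  shows "row_op p q (swap_op (p + q) i (p + i) t) = row_op p q t"
proof -
  let ?\<tau> = "transpose i (p + i)"
  have \<tau>: "?\<tau> permutes {..<p + q}" using assms by (intro permutes_swap_id) auto
  have mem: "\<rho> \<circ> ?\<tau> \<in> row_group p q" if "\<rho> \<in> row_group p q" for \<rho>
  proof -
    have "row_index p (?\<tau> k) = row_index p k" for k
      using assms by (auto simp: transpose_def row_index_def)
    moreover have "?\<tau> k < p + q" if "k < p + q" for k
      using permutes_in_image[OF \<tau>] that by simp
    ultimately show ?thesis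
      using that \<tau> by (auto simp: row_group_def intro!: permutes_compose)
  qed
  have "row_op p q (swap_op (p + q) i (p + i) t) =
      (\<Sum>\<rho>\<in>row_group p q. perm_op (p + q) (\<rho> \<circ> ?\<tau>) t)"
    unfolding row_op_def by (simp add: perm_op_comp[OF \<tau>])
  also have "\<dots> = row_op p q t"
    unfolding row_op_def
    by (rule sum.reindex_bij_witness[of _ "\<lambda>\<rho>. \<rho> \<circ> ?\<tau>" "\<lambda>\<rho>. \<rho> \<circ> ?\<tau>"])
      (simp_all add: mem comp_assoc)
  finally show ?thesis .
qed

text \<open>\<open>row_op\<close> absorbs the transposition of row \<open>j\<close>. By conjugation
  that transposition turns \<open>(i, p + j) t\<close> into \<open>(i, p + j)(i j) t\<close>, which
  is \<open>- (i, p + j) t\<close> because \<open>i\<close> and \<open>j\<close> lie in the first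
  column. So the value equals its own negative.\<close>

lemma row_op_swap_op_other:
  fixes t :: "('k::field_char_0, 'v) tensor"
  assumes "q \<le> p" "i < p" "j < q" "i \<noteq> j" and alt: "alternating (p + q) {..<p} t"
  shows "row_op p q (swap_op (p + q) i (p + j) t) = 0"
proof -
  have "swap_op (p + q) j (p + j) (swap_op (p + q) i (p + j) t) =
      swap_op (p + q) i j (swap_op (p + q) j (p + j) t)"
    using assms by (subst swap_op_conj) auto
  also have "\<dots> = swap_op (p + q) i (p + j) (swap_op (p + q) i j t)"
    using assms by (subst swap_op_conj) auto
  also have "\<dots> = - swap_op (p + q) i (p + j) t"
    using assms by (simp add: alternating_def perm_op_linear)
  finally have "row_op p q (swap_op (p + q) i (p + j) t) = - row_op p q (swap_op (p + q) i (p + j) t)"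
    using row_op_swap_op[of j q p "swap_op (p + q) i (p + j) t"] assms by (simp add: row_op_linear)
  then have "row_op p q (swap_op (p + q) i (p + j) t) \<alpha>s = 0" for \<alpha>s
    by (intro eq_uminus_self) (metis uminus_apply)
  then show ?thesis by (simp add: fun_eq_iff)
qed

lemma swap_sum_row_op:
  "swap_sum (p + q) (row_op p q t) = row_op p q (swap_sum (p + q) t)"
  by (auto simp: row_op_def swap_sum_sum swap_sum_perm_op row_group_def intro!: sum.cong)

lemma columns_standard: "columns (p + q) {..<p} {p..<p + q}"
  by (auto simp: columns_def)

text \<open>Of the transpositions between the columns, those within a row are absorbed by
  \<open>row_op\<close> and the others are killed. The \<open>q\<close> rows of length two thus add
  \<open>2 * q\<close> to the contribution of the columns, which completes the content.\<close>

lemma row_op_eigentensor: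
  fixes t :: "('k::field_char_0, 'v::ab_group_add) tensor"
  assumes "q \<le> p" and t: "t \<in> bialternating scale (p + q) {..<p} {p..<p + q}"
  shows "swap_sum (p + q) (row_op p q t) = fscale (content p q) (row_op p q t)"
proof -
  have deg: "degree (p + q) t" and alt: "alternating (p + q) {..<p} t" "alternating (p + q) {p..<p + q} t"
    using t by (auto simp: bialternating_def degree_tensor_power)
  have "row_op p q (\<Sum>i<p. \<Sum>j\<in>{p..<p + q}. swap_op (p + q) i j t) =
      (\<Sum>j<q. \<Sum>i<p. row_op p q (swap_op (p + q) i (p + j) t))"
    by (subst sum.swap, simp add: row_op_sum)
      (rule sum.reindex_bij_witness[of _ "\<lambda>j. p + j" "\<lambda>j. j - p"], auto)
  also have "\<dots> = (\<Sum>j<q. \<Sum>i<p. if i = j then row_op p q t else 0)"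
    using assms by (intro sum.cong refl) (auto simp: row_op_swap_op row_op_swap_op_other[OF _ _ _ _ alt(1)])
  also have "\<dots> = fscale (of_nat q) (row_op p q t)"
    using assms by (simp add: sum.delta fs.sum_constant_scale del: sum_constant)
  finally have S: "row_op p q (\<Sum>i<p. \<Sum>j\<in>{p..<p + q}. swap_op (p + q) i j t) = fscale (of_nat q) (row_op p q t)" .
  have "swap_sum (p + q) t =
      fscale (of_nat p * (2 - of_nat p) + of_nat q * (2 - of_nat q)) t
        + fscale 2 (\<Sum>i<p. \<Sum>j\<in>{p..<p + q}. swap_op (p + q) i j t)"
    using swap_sum_alternating[OF _ _ alt deg] columns_standard[of p q] by (simp add: columns_def)
  then have "swap_sum (p + q) (row_op p q t) =
      fscale (of_nat p * (2 - of_nat p) + of_nat q * (2 - of_nat q) + 2 * of_nat q) (row_op p q t)"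
    by (simp only: swap_sum_row_op row_op_linear S fs.scale_left_distrib fs.scale_scale)
  moreover have "of_nat p * (2 - of_nat p) + of_nat q * (2 - of_nat q) + 2 * of_nat q = (content p q :: 'k)"
    by (simp add: content_def algebra_simps power2_eq_square)
  ultimately show ?thesis by simp
qed

text \<open>The highest weight property: after the move the tensor would have the content of a shape
  whose first column is shorter than its own, which \<open>eigentensor_above\<close>
  excludes.\<close>

lemma shift_op_eigentensor:
  fixes t :: "('k::field_char_0, 'v::ab_group_add) tensor"
  assumes "columns d C1 C2" "t \<in> bialternating scale d C1 C2" "x \<in> C2" "card C2 \<le> card C1"
    and "swap_sum d t = fscale (content (card C1) (card C2)) t"
  shows "shift_op d C1 x t = 0"
proof (rule eigentensor_above)
  note step = shift_op_step[OF assms(1,3,2)]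
  have x: "x \<notin> C1" "C1 \<subseteq> {..<d}" "x < d" using assms(1,3) by (auto simp: columns_def)
  show "columns d (insert x C1) (C2 - {x})"
    "shift_op d C1 x t \<in> bialternating scale d (insert x C1) (C2 - {x})" using step by blast+
  show "card C1 + card C2 = d" by (rule columns_card) fact
  show "card C2 \<le> card C1" by fact
  show "card C1 < card (insert x C1)" using x columns_finite[OF assms(1)] by simp
  show "swap_sum d (shift_op d C1 x t) = fscale (content (card C1) (card C2)) (shift_op d C1 x t)"
    using assms(5) x by (simp add: swap_sum_shift_op shift_op_linear)
qed

section \<open>Injectivity of the row operator on an eigenspace\<close>

lemma row_op_diagonal:
  assumes "length \<alpha>s = p + q" "\<And>i. i < q \<Longrightarrow> \<alpha>s ! (p + i) = \<alpha>s ! i"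
  shows "row_op p q t \<alpha>s = of_nat (card (row_group p q)) * t \<alpha>s"
proof -
  have row: "\<alpha>s ! i = \<alpha>s ! row_index p i" if "i < p + q" for i
    using assms(2)[of "i - p"] that by (cases "i < p") (auto simp: row_index_def)
  have "permute_list \<rho> \<alpha>s = \<alpha>s" if \<rho>: "\<rho> \<in> row_group p q" for \<rho>
  proof (rule nth_equalityI)
    fix i assume "i < length (permute_list \<rho> \<alpha>s)"
    then have i: "i < p + q" using assms(1) by simp
    have "\<rho> permutes {..<p + q}" "row_index p (\<rho> i) = row_index p i"
      using \<rho> i by (auto simp: row_group_def)
    moreover from this have "\<rho> i < p + q" using permutes_in_image[of \<rho> "{..<p + q}" i] i by simp
    ultimately show "permute_list \<rho> \<alpha>s ! i = \<alpha>s ! i"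
      using row[of i] row[of "\<rho> i"] i assms(1) by (simp add: permute_list_nth)
  qed simp
  then show ?thesis
    using assms(1) by (simp add: row_op_def sum_fun_apply perm_op_def)
qed

lemma dual_add:
  assumes "vector_space scale" "\<alpha> \<in> dual scale" "\<beta> \<in> dual scale"
  shows "\<alpha> + \<beta> \<in> dual scale"
  using assms(2,3) by (auto simp: dual_def Vector_Spaces.linear_iff algebra_simps)

text \<open>Expand the tensor with the sum of the two entries in both slots. Vanishing is assumed
  with the other slots fixed, because in \<open>row_op_inj\<close> it is known only for tuples of a
  special form.\<close>

lemma swap_op_polarization:
  assumes vs: "vector_space scale" and t: "t \<in> tensor_power scale d" and \<alpha>s: "\<alpha>s \<in> covectors scale d"
    and ij: "i < d" "j < d" "i \<noteq> j" and diag: "\<And>a. a \<in> dual scale \<Longrightarrow> t (\<alpha>s[i := a, j := a]) = 0"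
  shows "swap_op d i j t \<alpha>s = - t \<alpha>s"
proof -
  define f where "f a b = t (\<alpha>s[i := a, j := b])" for a b
  let ?x = "\<alpha>s ! i" and ?y = "\<alpha>s ! j"
  have dual: "?x \<in> dual scale" "?y \<in> dual scale" "?x + ?y \<in> dual scale"
    using covectors_nth[OF \<alpha>s] ij dual_add[OF vs] by auto
  have add1: "f (?x + ?y) b = f ?x b + f ?y b" if "b \<in> dual scale" for b
    unfolding f_def list_update_swap[OF ij(3)]
    by (rule tensor_power_add[OF t covectors_update[OF \<alpha>s that] ij(1) dual(1,2)])
  have add2: "f a (?x + ?y) = f a ?x + f a ?y" if "a \<in> dual scale" for a
    unfolding f_def by (rule tensor_power_add[OF t covectors_update[OF \<alpha>s that] ij(2) dual(1,2)])
  have "f a a = 0" if "a \<in> dual scale" for a using diag[OF that] by (simp add: f_def)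
  then have "f ?x ?y + f ?y ?x = 0"
    using dual add1[OF dual(3)] add2[OF dual(1)] add2[OF dual(2)] by (metis add_0 add_0_right)
  moreover have "f ?x ?y = t \<alpha>s" by (simp add: f_def)
  moreover have "f ?y ?x = swap_op d i j t \<alpha>s"
    using ij \<alpha>s by (simp add: f_def perm_op_def permute_list_transpose covectors_def)
  ultimately show ?thesis by (simp add: eq_neg_iff_add_eq_0 add.commute)
qed

text \<open>Downward induction on \<open>m\<close>, for tuples constant along the rows with index
  below \<open>m\<close>. If all rows of length two are constant, \<open>row_op_diagonal\<close>
  applies. Dropping one row combines polarization in that row with the highest weight
  property.\<close>

lemma row_op_inj:
  fixes t :: "('k::field_char_0, 'v::ab_group_add) tensor"
  assumes vs: "vector_space scale" and qp: "q \<le> p"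
    and t: "t \<in> bialternating scale (p + q) {..<p} {p..<p + q}"
    and eig: "swap_sum (p + q) t = fscale (content p q) t"
    and row: "row_op p q t = 0"
  shows "t = 0"
proof -
  let ?d = "p + q"
  have tp: "t \<in> tensor_power scale ?d" and alt: "alternating ?d {..<p} t" "alternating ?d {p..<p + q} t"
    using t by (auto simp: bialternating_def)
  have len: "length \<alpha>s = ?d" if "\<alpha>s \<in> covectors scale ?d" for \<alpha>s
    using that by (simp add: covectors_def)
  have "t \<alpha>s = 0" if "m \<le> q" "\<alpha>s \<in> covectors scale ?d" "\<And>i. i < m \<Longrightarrow> \<alpha>s ! (p + i) = \<alpha>s ! i" for m \<alpha>s
    using that
  proof (induction m arbitrary: \<alpha>s rule: inc_induct)
    case base
    then have "of_nat (card (row_group p q)) * t \<alpha>s = 0"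
      using row_op_diagonal[of \<alpha>s p q t] row len by simp
    moreover have "card (row_group p q) \<noteq> 0"
      using id_row_group[of p q] finite_row_group[of p q] by auto
    ultimately show ?case by simp
  next
    case (step m)
    have polar: "swap_op ?d m (p + m) t \<alpha>s = - t \<alpha>s"
      if \<alpha>s: "\<alpha>s \<in> covectors scale ?d" and eq: "\<And>i. i < m \<Longrightarrow> \<alpha>s ! (p + i) = \<alpha>s ! i" for \<alpha>s
    proof -
      have m: "m < ?d" "p + m < ?d" "m \<noteq> p + m" using step.hyps qp by auto
      show ?thesis
      proof (rule swap_op_polarization[OF vs tp \<alpha>s m])
        fix a assume a: "a \<in> dual scale"
        show "t (\<alpha>s[m := a, p + m := a]) = 0"
        proof (rule step.IH)
          show "\<alpha>s[m := a, p + m := a] \<in> covectors scale ?d"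
            using \<alpha>s a by (simp add: covectors_update)
          fix i assume "i < Suc m"
          then show "\<alpha>s[m := a, p + m := a] ! (p + i) = \<alpha>s[m := a, p + m := a] ! i"
            using eq[of i] m step.hyps qp len[OF \<alpha>s] by (cases "i = m") auto
        qed
      qed
    qed
    \<comment> \<open>Reordering the first column carries the case \<open>i = m\<close> to every
      later \<open>i\<close>, and it leaves the rows with index below \<open>m\<close>
      untouched.\<close>
    have above: "swap_op ?d i (p + m) t \<alpha>s = - t \<alpha>s" if "i \<in> {m..<p}" for i
    proof (cases "i = m")
      case True
      then show ?thesis using polar step.prems by blast
    next
      case False
      then have i: "i < ?d" "m < ?d" "p + m < ?d" "i \<noteq> m" "i < p" "m < p" "m < i"
        using that step.hyps qp by auto
      let ?\<alpha>s = "permute_list (transpose i m) \<alpha>s"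
      have \<alpha>s: "?\<alpha>s \<in> covectors scale ?d"
        using covectors_permute_list[of "transpose i m" ?d \<alpha>s scale] step.prems(1) len i
        by (simp add: permutes_swap_id)
      have "swap_op ?d m (p + m) t ?\<alpha>s = - t ?\<alpha>s"
      proof (rule polar[OF \<alpha>s])
        fix j assume "j < m"
        then show "?\<alpha>s ! (p + j) = ?\<alpha>s ! j"
          using step.prems(2)[of j] len[OF step.prems(1)] i by (simp add: permute_list_transpose)
      qed
      moreover have "swap_op ?d m (p + m) t ?\<alpha>s = swap_op ?d i m (swap_op ?d m (p + m) t) \<alpha>s"
        using len[OF step.prems(1)] by (simp add: perm_op_def)
      moreover have "swap_op ?d i m (swap_op ?d m (p + m) t) = - swap_op ?d i (p + m) t"
        using i alt(1) by (subst swap_op_conj) (auto simp: alternating_def perm_op_linear)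
      moreover have "t ?\<alpha>s = - t \<alpha>s"
      proof -
        have "t ?\<alpha>s = swap_op ?d i m t \<alpha>s" using len[OF step.prems(1)] by (simp add: perm_op_def)
        then show ?thesis using alt(1) i by (simp add: alternating_def)
      qed
      ultimately show ?thesis by simp (metis minus_minus)
    qed
    \<comment> \<open>The exchange puts \<open>\<alpha>s ! i\<close>, which already stands at
      \<open>p + i\<close>, a second time into the second column.\<close>
    have below: "swap_op ?d i (p + m) t \<alpha>s = 0" if "i < m" for i
    proof -
      have i: "i < ?d" "p + m < ?d" "p + i < ?d" "i < q" "i < p" "m < q" using that step.hyps qp by auto
      let ?\<alpha>s = "permute_list (transpose i (p + m)) \<alpha>s"
      have "t ?\<alpha>s = 0"
        by (rule alternating_eq_0[OF alt(2), of "p + i" "p + m"])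
          (use i that step.prems(2)[OF that] len[OF step.prems(1)] in
            \<open>auto simp: permute_list_transpose nth_list_update\<close>)
      then show ?thesis using len[OF step.prems(1)] by (simp add: perm_op_def)
    qed
    \<comment> \<open>Of the \<open>p\<close> transpositions in this relation, \<open>m\<close>
      contribute zero and \<open>p - m\<close> contribute \<open>- t \<alpha>s\<close>. What remains
      is \<open>(1 + (p - m)) * t \<alpha>s = 0\<close>.\<close>
    have "shift_op ?d {..<p} (p + m) t = 0"
      by (rule shift_op_eigentensor[OF columns_standard t]) (use step.hyps qp eig in auto)
    then have "t \<alpha>s = (\<Sum>i<p. swap_op ?d i (p + m) t \<alpha>s)"
      by (metis (no_types, lifting) shift_op_def eq_iff_diff_eq_0 sum_fun_apply sum.cong)
    also have "{..<p} = {..<m} \<union> {m..<p}" using step.hyps qp by auto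
    also have "(\<Sum>i\<in>{..<m} \<union> {m..<p}. swap_op ?d i (p + m) t \<alpha>s) = - of_nat (p - m) * t \<alpha>s"
      by (subst sum.union_disjoint) (auto simp: above below)
    finally have "t \<alpha>s - (- of_nat (p - m) * t \<alpha>s) = 0" by (metis diff_self)
    then have "of_nat (1 + (p - m)) * t \<alpha>s = 0" by (simp add: algebra_simps)
    moreover have "(of_nat (1 + (p - m)) :: 'k) \<noteq> 0"
      by (metis add_is_0 of_nat_eq_0_iff one_neq_zero)
    ultimately show ?case by (metis mult_eq_0_iff)
  qed
  from this[of 0] have "t \<alpha>s = 0" for \<alpha>s
    using tensor_power_outside[OF tp] by (cases "\<alpha>s \<in> covectors scale ?d") auto
  then show ?thesis by (simp add: fun_eq_iff)
qed

section \<open>Equivariant maps commute with the sum of all transpositions\<close>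

lemma vector_space_mult: "vector_space ((*) :: 'k::field \<Rightarrow> 'k \<Rightarrow> 'k)"
  by standard (auto simp: algebra_simps)

lemma act_linear:
  "act g (t + u) = act g t + act g u"
  "act g (t - u) = act g t - act g u"
  "act g (fscale c t) = fscale c (act g t)"
  by (simp_all add: act_def fun_eq_iff fscale_def)

lemma act_sum: "act g (\<Sum>i\<in>A. f i) = (\<Sum>i\<in>A. act g (f i))"
  by (simp add: act_def fun_eq_iff sum_fun_apply)

lemma act_act: "act g (act h t) = act (g \<circ> h) t"
  by (simp add: act_def o_assoc o_def)

lemma act_id: "act id t = t"
  by (simp add: act_def)

lemma act_perm_op: "\<sigma> permutes {..<d} \<Longrightarrow> act g (perm_op d \<sigma> t) = perm_op d \<sigma> (act g t)"
  by (auto simp: act_def perm_op_def fun_eq_iff permute_list_map)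

lemma act_shift_op:
  "C \<subseteq> {..<d} \<Longrightarrow> x < d \<Longrightarrow> act g (shift_op d C x t) = shift_op d C x (act g t)"
  by (auto simp: shift_op_def act_linear act_sum act_perm_op permutes_swap_id subset_iff intro!: sum.cong)

lemma act_row_op: "act g (row_op p q t) = row_op p q (act g t)"
  by (auto simp: row_op_def act_sum act_perm_op row_group_def intro!: sum.cong)

lemma act_alternating: "S \<subseteq> {..<d} \<Longrightarrow> alternating d S t \<Longrightarrow> alternating d S (act g t)"
  unfolding alternating_def
proof (intro ballI impI)
  fix i j assume *: "S \<subseteq> {..<d}" "i \<in> S" "j \<in> S" "i \<noteq> j"
    "\<forall>i\<in>S. \<forall>j\<in>S. i \<noteq> j \<longrightarrow> swap_op d i j t = - t"
  then have "i < d" "j < d" by auto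
  then have "swap_op d i j (act g t) = act g (swap_op d i j t)"
    by (simp add: act_perm_op permutes_swap_id)
  also have "\<dots> = - act g t" using * by (simp add: act_def fun_eq_iff)
  finally show "swap_op d i j (act g t) = - act g t" .
qed

lemma act_swap_sum: "act g (swap_sum d t) = swap_sum d (act g t)"
  by (auto simp: swap_sum_def act_sum act_perm_op permutes_swap_id intro!: sum.cong)

lemma subspace_dual:
  assumes "vector_space scale"
  shows "fs.subspace (dual scale)"
proof (rule fs.subspaceI)
  show "0 \<in> dual scale"
    using assms by (auto simp: dual_def Vector_Spaces.linear_iff vector_space_mult)
  show "\<alpha> + \<beta> \<in> dual scale" if "\<alpha> \<in> dual scale" "\<beta> \<in> dual scale" for \<alpha> \<beta>
    using dual_add assms that by blast
  show "fscale c \<alpha> \<in> dual scale" if "\<alpha> \<in> dual scale" for c \<alpha>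
    using that by (auto simp: dual_def Vector_Spaces.linear_iff fscale_def algebra_simps)
qed

lemma dual_comp:
  assumes "\<alpha> \<in> dual scale" "Vector_Spaces.linear scale scale g"
  shows "\<alpha> \<circ> g \<in> dual scale"
  using assms by (auto simp: dual_def Vector_Spaces.linear_iff)

section \<open>Operators in the linear span of the general linear group\<close>

inductive_set gl_span ::
  "('k::field \<Rightarrow> 'v::ab_group_add \<Rightarrow> 'v) \<Rightarrow> (('k, 'v) tensor \<Rightarrow> ('k, 'v) tensor) set"
  for scale where
  act: "g \<in> GL scale \<Longrightarrow> act g \<in> gl_span scale"
| add: "\<Phi> \<in> gl_span scale \<Longrightarrow> \<Psi> \<in> gl_span scale \<Longrightarrow> (\<lambda>t. \<Phi> t + \<Psi> t) \<in> gl_span scale"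
| scale: "\<Phi> \<in> gl_span scale \<Longrightarrow> (\<lambda>t. fscale c (\<Phi> t)) \<in> gl_span scale"

definition gl_stable ::
  "('k::field \<Rightarrow> 'v::ab_group_add \<Rightarrow> 'v) \<Rightarrow> ('k, 'v) tensor set \<Rightarrow> bool" where
  "gl_stable scale U \<longleftrightarrow> fs.subspace U \<and> (\<forall>g\<in>GL scale. \<forall>t\<in>U. act g t \<in> U)"

lemma GL_comp: "g \<in> GL scale \<Longrightarrow> h \<in> GL scale \<Longrightarrow> g \<circ> h \<in> GL scale"
  by (auto simp: GL_def Vector_Spaces.linear_iff intro: bij_comp)

lemma gl_span_comp:
  assumes "\<Phi> \<in> gl_span scale" "\<Psi> \<in> gl_span scale"
  shows "(\<lambda>t. \<Phi> (\<Psi> t)) \<in> gl_span scale"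
  using assms(1)
proof (induction rule: gl_span.induct)
  case (act g)
  show ?case using assms(2)
  proof (induction rule: gl_span.induct)
    case (act h)
    then show ?case using gl_span.act[OF GL_comp[OF \<open>g \<in> GL scale\<close> act]] by (simp add: act_act)
  qed (simp_all only: act_linear gl_span.add gl_span.scale)
qed (simp_all only: gl_span.add gl_span.scale)

lemma GL_homD:
  assumes "\<phi> \<in> GL_hom scale U W"
  shows "x \<in> U \<Longrightarrow> \<phi> x \<in> W"
    and "x \<in> U \<Longrightarrow> y \<in> U \<Longrightarrow> \<phi> (x + y) = \<phi> x + \<phi> y"
    and "x \<in> U \<Longrightarrow> \<phi> (fscale c x) = fscale c (\<phi> x)"
    and "g \<in> GL scale \<Longrightarrow> x \<in> U \<Longrightarrow> \<phi> (act g x) = act g (\<phi> x)"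
  using assms unfolding GL_hom_def by blast+

lemma gl_stable_gl_span:
  assumes "gl_stable scale U" "\<Phi> \<in> gl_span scale" "t \<in> U"
  shows "\<Phi> t \<in> U"
  using assms(2,3)
  by (induction arbitrary: t rule: gl_span.induct)
    (use assms(1) in \<open>auto simp: gl_stable_def intro: fs.subspace_add fs.subspace_scale\<close>)

lemma GL_hom_gl_span:
  assumes "gl_stable scale U" "\<phi> \<in> GL_hom scale U W" "\<Phi> \<in> gl_span scale" "t \<in> U"
  shows "\<phi> (\<Phi> t) = \<Phi> (\<phi> t)"
  using assms(3,4)
proof (induction arbitrary: t rule: gl_span.induct)
  case (act g)
  then show ?case by (rule GL_homD(4)[OF assms(2)])
next
  case (add \<Phi> \<Psi>)
  then show ?case
    by (metis GL_homD(2)[OF assms(2)] gl_stable_gl_span[OF assms(1)])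
next
  case (scale \<Phi> c)
  then show ?case
    by (metis GL_homD(3)[OF assms(2)] gl_stable_gl_span[OF assms(1)])
qed

text \<open>Agreement is asked on \<open>tensor_power\<close> only, because the operators to be
  compared are matched by multilinearity.\<close>

definition gl_realized ::
  "('k::field \<Rightarrow> 'v::ab_group_add \<Rightarrow> 'v) \<Rightarrow> nat \<Rightarrow> (('k, 'v) tensor \<Rightarrow> ('k, 'v) tensor) \<Rightarrow> bool" where
  "gl_realized scale d \<Psi> \<longleftrightarrow> (\<exists>\<Phi>\<in>gl_span scale. \<forall>t\<in>tensor_power scale d. \<Psi> t = \<Phi> t)"

lemma gl_realized_cong:
  "gl_realized scale d \<Psi> \<Longrightarrow> (\<And>t. t \<in> tensor_power scale d \<Longrightarrow> \<Psi>' t = \<Psi> t) \<Longrightarrow> gl_realized scale d \<Psi>'"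
  by (auto simp: gl_realized_def)

lemma gl_realized_add:
  "gl_realized scale d \<Phi> \<Longrightarrow> gl_realized scale d \<Psi> \<Longrightarrow> gl_realized scale d (\<lambda>t. \<Phi> t + \<Psi> t)"
  unfolding gl_realized_def by (metis (no_types, lifting) gl_span.add)

lemma gl_realized_scale:
  "gl_realized scale d \<Phi> \<Longrightarrow> gl_realized scale d (\<lambda>t. fscale c (\<Phi> t))"
  unfolding gl_realized_def by (metis (no_types, lifting) gl_span.scale)

lemma gl_realized_diff:
  assumes "gl_realized scale d \<Phi>" "gl_realized scale d \<Psi>"
  shows "gl_realized scale d (\<lambda>t. \<Phi> t - \<Psi> t)"
  using gl_realized_add[OF assms(1) gl_realized_scale[OF assms(2), of "- 1"]]
  by (rule gl_realized_cong) simp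

lemma gl_realized_sum:
  assumes "gl_realized scale d (\<lambda>t. t)" "finite A" "\<And>i. i \<in> A \<Longrightarrow> gl_realized scale d (\<Phi> i)"
  shows "gl_realized scale d (\<lambda>t. \<Sum>i\<in>A. \<Phi> i t)"
  using assms(2,3)
proof (induction A rule: finite_induct)
  case empty
  show ?case by (rule gl_realized_cong[OF gl_realized_scale[OF assms(1), of 0]]) (metis sum.empty fs.scale_zero_left)
qed (auto intro: gl_realized_add)

text \<open>Evaluating a polynomial at the powers of \<open>2\<close> suffices to extract its coefficients: passing
  from \<open>f(x)\<close> to \<open>f(2 x) - 2\<^sup>n f(x)\<close> kills the coefficient of degree \<open>n\<close>.\<close>

lemma gl_realized_coefficient:
  fixes scale :: "'k::field_char_0 \<Rightarrow> 'v::ab_group_add \<Rightarrow> 'v"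
  assumes id: "gl_realized scale d (\<lambda>t. t)"
    and "\<And>m. gl_realized scale d (\<lambda>t. \<Sum>k\<le>n. fscale ((2 ^ m) ^ k) (\<Phi> k t))"
    and "k \<le> n"
  shows "gl_realized scale d (\<Phi> k)"
  using assms(2,3)
proof (induction n arbitrary: \<Phi> k)
  case 0
  show ?case by (rule gl_realized_cong[OF "0.prems"(1)]) (use "0.prems"(2) in simp)
next
  case (Suc n)
  let ?f = "\<lambda>m t. \<Sum>k\<le>Suc n. fscale ((2 ^ m) ^ k) (\<Phi> k t)"
  have low: "gl_realized scale d (\<Phi> k)" if "k \<le> n" for k
  proof -
    let ?\<Psi> = "\<lambda>k t. fscale (2 ^ k - 2 ^ Suc n) (\<Phi> k t)"
    have "gl_realized scale d (?\<Psi> k)"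
    proof (rule Suc.IH[OF _ that])
      fix m
      have "(\<Sum>k\<le>n. fscale ((2 ^ m) ^ k) (?\<Psi> k t)) = ?f (Suc m) t - fscale (2 ^ Suc n) (?f m t)" for t
      proof -
        have "?f (Suc m) t - fscale (2 ^ Suc n) (?f m t) =
            (\<Sum>k\<le>Suc n. fscale ((2 ^ m) ^ k) (?\<Psi> k t))"
          unfolding fs.scale_sum_right sum_subtractf[symmetric]
        proof (intro sum.cong refl)
          fix k
          have "(2 ^ Suc m :: 'k) ^ k = 2 ^ k * (2 ^ m) ^ k"
            by (simp only: power_Suc power_mult_distrib)
          then have "(2 ^ Suc m) ^ k - 2 ^ Suc n * (2 ^ m) ^ k = (2 ^ m) ^ k * (2 ^ k - 2 ^ Suc n :: 'k)"
            by (simp only: right_diff_distrib mult.commute)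
          then show "fscale ((2 ^ Suc m) ^ k) (\<Phi> k t) - fscale (2 ^ Suc n) (fscale ((2 ^ m) ^ k) (\<Phi> k t)) =
              fscale ((2 ^ m) ^ k) (?\<Psi> k t)"
            by (simp only: fs.scale_scale fs.scale_left_diff_distrib[symmetric])
        qed
        then show ?thesis by simp
      qed
      then show "gl_realized scale d (\<lambda>t. \<Sum>k\<le>n. fscale ((2 ^ m) ^ k) (?\<Psi> k t))"
        by (intro gl_realized_cong[OF gl_realized_diff[OF Suc.prems(1) gl_realized_scale[OF Suc.prems(1)]]])
    qed
    moreover have "(2 ^ k - 2 ^ Suc n :: 'k) \<noteq> 0"
    proof -
      have "(of_nat (2 ^ k) :: 'k) \<noteq> of_nat (2 ^ Suc n)"
        unfolding of_nat_eq_iff using that power_strict_increasing[of k "Suc n" "2 :: nat"] by simp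
      then show ?thesis by simp
    qed
    ultimately show ?thesis
      using gl_realized_scale[of scale d "?\<Psi> k" "1 / (2 ^ k - 2 ^ Suc n)"] by simp
  qed
  show ?case
  proof (cases "k = Suc n")
    case True
    have "gl_realized scale d (\<lambda>t. ?f 0 t - (\<Sum>k\<le>n. \<Phi> k t))"
      by (intro gl_realized_diff gl_realized_sum Suc.prems(1) id low) auto
    then show ?thesis using True by simp
  qed (use low Suc.prems in simp)
qed

lemma tensor_power_zero_slot:
  assumes vs: "vector_space scale" and t: "t \<in> tensor_power scale d" "\<alpha>s \<in> covectors scale d" "i < d"
  shows "t (\<alpha>s[i := 0]) = 0"
  using tensor_power_scale[OF t, of 0 0] fs.subspace_0[OF subspace_dual[OF vs]]
  by (simp add: fscale_def zero_fun_def)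

lemma tensor_power_sum:
  assumes vs: "vector_space scale" and t: "t \<in> tensor_power scale d" "\<alpha>s \<in> covectors scale d" "i < d"
    and f: "\<And>b. b \<in> B \<Longrightarrow> f b \<in> dual scale"
  shows "t (\<alpha>s[i := \<Sum>b\<in>B. f b]) = (\<Sum>b\<in>B. t (\<alpha>s[i := f b]))"
  using f
proof (induction B rule: infinite_finite_induct)
  case (insert b B)
  have "(\<Sum>b\<in>B. f b) \<in> dual scale"
    using insert by (intro fs.subspace_sum subspace_dual[OF vs]) auto
  then have 1: "t (\<alpha>s[i := f b + (\<Sum>b\<in>B. f b)]) = t (\<alpha>s[i := f b]) + t (\<alpha>s[i := \<Sum>b\<in>B. f b])"
    using insert by (intro tensor_power_add[OF t]) auto
  have 2: "t (\<alpha>s[i := \<Sum>b\<in>B. f b]) = (\<Sum>b\<in>B. t (\<alpha>s[i := f b]))"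
    using insert by blast
  show ?case
    by (simp only: sum.insert[OF insert.hyps] 1 2)
qed (simp_all add: tensor_power_zero_slot[OF vs t])

lemma sum_swap_pairs:
  "(\<Sum>b\<in>B. \<Sum>c\<in>B. \<Sum>a\<in>A. \<Sum>e\<in>A. T a e b c) = (\<Sum>a\<in>A. \<Sum>e\<in>A. \<Sum>b\<in>B. \<Sum>c\<in>B. T a e b c)"
proof -
  have "(\<Sum>b\<in>B. \<Sum>c\<in>B. \<Sum>a\<in>A. \<Sum>e\<in>A. T a e b c) = (\<Sum>b\<in>B. \<Sum>a\<in>A. \<Sum>c\<in>B. \<Sum>e\<in>A. T a e b c)"
    by (intro sum.cong refl sum.swap)
  also have "\<dots> = (\<Sum>a\<in>A. \<Sum>b\<in>B. \<Sum>e\<in>A. \<Sum>c\<in>B. T a e b c)"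
    by (subst sum.swap) (intro sum.cong refl sum.swap)
  also have "\<dots> = (\<Sum>a\<in>A. \<Sum>e\<in>A. \<Sum>b\<in>B. \<Sum>c\<in>B. T a e b c)"
    by (intro sum.cong refl sum.swap)
  finally show ?thesis .
qed

section \<open>Coordinates and matrix units\<close>

locale tensor_space = finite_dimensional_vector_space scale Basis
  for scale :: "'k::field_char_0 \<Rightarrow> 'v::ab_group_add \<Rightarrow> 'v" and Basis :: "'v set"
begin

definition coord :: "'v \<Rightarrow> 'v \<Rightarrow> 'k" where
  "coord b v = representation Basis v b"

lemma coord_dual: "coord b \<in> dual scale"
  using representation_add[OF independent_Basis] representation_scale[OF independent_Basis]
  by (simp add: dual_def Vector_Spaces.linear_iff vector_space_axioms vector_space_mult coord_def span_Basis)

lemma coord_Basis: "b \<in> Basis \<Longrightarrow> coord c b = (if c = b then 1 else 0)"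
  by (simp add: coord_def representation_basis[OF independent_Basis])

lemma sum_coord: "(\<Sum>b\<in>Basis. scale (coord b v) b) = v"
  unfolding coord_def
  by (rule sum_representation_eq) (simp_all add: independent_Basis span_Basis finite_Basis)

lemma dual_linear:
  assumes "\<alpha> \<in> dual scale"
  shows "\<alpha> (v + w) = \<alpha> v + \<alpha> w" "\<alpha> (scale c v) = c * \<alpha> v" "\<alpha> (\<Sum>i\<in>A. f i) = (\<Sum>i\<in>A. \<alpha> (f i))"
proof -
  show add: "\<alpha> (v + w) = \<alpha> v + \<alpha> w" for v w
    using assms by (simp add: dual_def Vector_Spaces.linear_iff)
  show scale: "\<alpha> (scale c v) = c * \<alpha> v" for c v
    using assms by (simp add: dual_def Vector_Spaces.linear_iff)
  have "\<alpha> 0 = 0" using scale[of 0 0] by simp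
  then show "\<alpha> (\<Sum>i\<in>A. f i) = (\<Sum>i\<in>A. \<alpha> (f i))"
    using sum_comp_morphism[of \<alpha> f A] add by (simp add: o_def)
qed

lemma dual_expand:
  assumes "\<alpha> \<in> dual scale"
  shows "\<alpha> = (\<Sum>b\<in>Basis. fscale (\<alpha> b) (coord b))"
proof
  fix v
  have "\<alpha> v = \<alpha> (\<Sum>b\<in>Basis. scale (coord b v) b)" by (simp add: sum_coord)
  also have "\<dots> = (\<Sum>b\<in>Basis. fscale (\<alpha> b) (coord b)) v"
    using assms by (simp add: dual_linear sum_fun_apply fscale_def mult.commute)
  finally show "\<alpha> v = (\<Sum>b\<in>Basis. fscale (\<alpha> b) (coord b)) v" .
qed

lemma tensor_power_expand:
  assumes t: "t \<in> tensor_power scale d" "\<alpha>s \<in> covectors scale d" "i < d" and \<beta>: "\<beta> \<in> dual scale"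
  shows "t (\<alpha>s[i := \<beta>]) = (\<Sum>b\<in>Basis. \<beta> b * t (\<alpha>s[i := coord b]))"
proof -
  have "t (\<alpha>s[i := \<beta>]) = t (\<alpha>s[i := \<Sum>b\<in>Basis. fscale (\<beta> b) (coord b)])"
    using dual_expand[OF \<beta>] by simp
  also have "\<dots> = (\<Sum>b\<in>Basis. \<beta> b * t (\<alpha>s[i := coord b]))"
    using tensor_power_sum[OF vector_space_axioms t, of Basis "\<lambda>b. fscale (\<beta> b) (coord b)"]
      fs.subspace_scale[OF subspace_dual[OF vector_space_axioms] coord_dual]
    by (simp add: tensor_power_scale[OF t coord_dual])
  finally show ?thesis .
qed

definition matrix_unit :: "'v \<Rightarrow> 'v \<Rightarrow> 'v \<Rightarrow> 'v" where
  "matrix_unit b c v = scale (coord c v) b"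

lemma linear_matrix_unit: "Vector_Spaces.linear scale scale (matrix_unit b c)"
  using dual_linear[OF coord_dual] by (simp add: Vector_Spaces.linear_iff vector_space_axioms matrix_unit_def scale_left_distrib)

text \<open>The square of E = \<open>matrix_unit b c\<close> is \<open>coord c b\<close> times E.
  Hence the inverse of 1 + r E has the form 1 - s E, and \<open>s\<close> solves the resulting
  linear equation.\<close>

lemma transvection_GL:
  assumes "b \<in> Basis" and r: "1 + r * coord c b \<noteq> 0"
  shows "(\<lambda>v. v + scale r (matrix_unit b c v)) \<in> GL scale"
proof -
  note lin = linear_matrix_unit[of b c, unfolded Vector_Spaces.linear_iff]
  define s where "s = r / (1 + r * coord c b)"
  let ?g = "\<lambda>v. v + scale r (matrix_unit b c v)" and ?h = "\<lambda>v. v + scale (- s) (matrix_unit b c v)"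
  have sr: "s * (1 + r * coord c b) = r" using r by (simp add: s_def)
  have coord: "coord c (v + scale x (matrix_unit b c v)) = coord c v * (1 + x * coord c b)" for v x
    by (simp add: matrix_unit_def dual_linear[OF coord_dual] algebra_simps)
  have comb: "v + scale x (matrix_unit b c v) + scale y (matrix_unit b c (v + scale x (matrix_unit b c v)))
      = v + scale (x + y * (1 + x * coord c b)) (matrix_unit b c v)" for v x y
    unfolding matrix_unit_def[of b c "v + _"] coord
    unfolding matrix_unit_def scale_scale add.assoc scale_left_distrib[symmetric]
    by (rule arg_cong[of _ _ "\<lambda>z. v + scale z b"]) (simp add: algebra_simps)
  have "r + - s * (1 + r * coord c b) = 0" "- s + r * (1 + - s * coord c b) = 0"
    using sr by (simp_all add: algebra_simps)
  then have "?h (?g v) = v" "?g (?h v) = v" for v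
    unfolding comb by simp_all
  then have "bij ?g" by (intro o_bij[of ?h]) (auto simp: fun_eq_iff)
  moreover have "Vector_Spaces.linear scale scale ?g"
    using lin by (simp add: Vector_Spaces.linear_iff vector_space_axioms scale_right_distrib scale_left_commute algebra_simps)
  ultimately show ?thesis by (simp add: GL_def)
qed

lemma GL_id: "id \<in> GL scale"
  by (simp add: GL_def Vector_Spaces.linear_iff vector_space_axioms)

lemma gl_realized_id: "gl_realized scale d (\<lambda>t. t)"
  unfolding gl_realized_def by (rule bexI[OF _ gl_span.act[OF GL_id]]) (simp add: act_id)

text \<open>This keeps the default value zero stable under \<open>act\<close>: composing with a
  linear bijection cannot turn a function that is not linear into a covector.\<close>

lemma covectors_map_comp:
  assumes g: "g \<in> GL scale"
  shows "map (\<lambda>\<alpha>. \<alpha> \<circ> g) \<alpha>s \<in> covectors scale d \<longleftrightarrow> \<alpha>s \<in> covectors scale d"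
proof -
  have lin: "Vector_Spaces.linear scale scale g" and bij: "bij g" using g by (auto simp: GL_def)
  have "\<alpha> \<circ> g \<in> dual scale \<longleftrightarrow> \<alpha> \<in> dual scale" for \<alpha>
  proof
    assume *: "\<alpha> \<circ> g \<in> dual scale"
    have "Vector_Spaces.linear scale (*) \<alpha>"
      unfolding Vector_Spaces.linear_iff
    proof (intro conjI allI vector_space_axioms vector_space_mult)
      fix x y c
      obtain u w where uw: "x = g u" "y = g w" using bij_is_surj[OF bij] by (metis surjD)
      have "g (u + w) = g u + g w" "g (scale c u) = scale c (g u)"
        using lin by (simp_all add: Vector_Spaces.linear_iff)
      then show "\<alpha> (x + y) = \<alpha> x + \<alpha> y" "\<alpha> (scale c x) = c * \<alpha> x"
        using dual_linear(1)[OF *, of u w] dual_linear(2)[OF *, of c u] by (metis comp_apply uw)+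
    qed
    then show "\<alpha> \<in> dual scale" by (simp add: dual_def)
  qed (use dual_comp lin in blast)
  then show ?thesis by (auto simp: covectors_def)
qed

lemma gl_stable_tensor_power: "gl_stable scale (tensor_power scale d)"
  unfolding gl_stable_def
proof (intro conjI subspace_tensor_power ballI)
  fix g t assume g: "g \<in> GL scale" and t: "t \<in> tensor_power scale d"
  have lin: "Vector_Spaces.linear scale scale g" using g by (simp add: GL_def)
  let ?m = "map (\<lambda>\<alpha>. \<alpha> \<circ> g)"
  show "act g t \<in> tensor_power scale d"
    unfolding tensor_power_def
  proof (intro CollectI conjI allI ballI impI)
    fix \<alpha>s assume "\<alpha>s \<notin> covectors scale d"
    then show "act g t \<alpha>s = 0"
      by (simp add: act_def covectors_map_comp[OF g] tensor_power_outside[OF t])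
  next
    fix \<alpha>s i and \<beta> \<gamma> :: "'v \<Rightarrow> 'k" and c
    assume *: "\<alpha>s \<in> covectors scale d" "i < d" "\<beta> \<in> dual scale" "\<gamma> \<in> dual scale"
    have "(\<beta> + \<gamma>) \<circ> g = (\<beta> \<circ> g) + (\<gamma> \<circ> g)" "fscale c \<beta> \<circ> g = fscale c (\<beta> \<circ> g)"
      by (simp_all add: fun_eq_iff fscale_def)
    then show "act g t (\<alpha>s[i := \<beta> + \<gamma>]) = act g t (\<alpha>s[i := \<beta>]) + act g t (\<alpha>s[i := \<gamma>])"
      "act g t (\<alpha>s[i := fscale c \<beta>]) = c * act g t (\<alpha>s[i := \<beta>])"
      using * dual_comp[OF _ lin] t
      by (simp_all add: act_def map_update covectors_map_comp[OF g] tensor_power_add tensor_power_scale)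
  qed
qed

lemma gl_realized_comp:
  assumes "gl_realized scale d \<Phi>" "gl_realized scale d \<Psi>"
  shows "gl_realized scale d (\<lambda>t. \<Phi> (\<Psi> t))"
proof -
  obtain \<Phi>' \<Psi>' where *: "\<Phi>' \<in> gl_span scale" "\<forall>t\<in>tensor_power scale d. \<Phi> t = \<Phi>' t"
    "\<Psi>' \<in> gl_span scale" "\<forall>t\<in>tensor_power scale d. \<Psi> t = \<Psi>' t"
    using assms by (auto simp: gl_realized_def)
  then show ?thesis
    unfolding gl_realized_def
    by (intro bexI[OF _ gl_span_comp[OF *(1,3)]])
      (use gl_stable_gl_span[OF gl_stable_tensor_power] in auto)
qed

lemma gl_stable_bialternating:
  assumes "C1 \<subseteq> {..<d}" "C2 \<subseteq> {..<d}"
  shows "gl_stable scale (bialternating scale d C1 C2)"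
  using gl_stable_tensor_power assms subspace_bialternating
  by (auto simp: gl_stable_def bialternating_def act_alternating)

section \<open>The Lie algebra action and its Casimir element\<close>

primrec slot_coeff ::
  "('v \<Rightarrow> 'v) \<Rightarrow> ('k, 'v) tensor \<Rightarrow> nat \<Rightarrow> nat \<Rightarrow> ('v \<Rightarrow> 'k) list \<Rightarrow> 'k" where
  "slot_coeff A t 0 k \<alpha>s = (if k = 0 then t \<alpha>s else 0)"
| "slot_coeff A t (Suc m) k \<alpha>s = slot_coeff A t m k \<alpha>s +
    (if k = 0 then 0 else slot_coeff A t m (k - 1) (\<alpha>s[m := \<alpha>s ! m \<circ> A]))"

lemma slot_coeff_eq_0: "m < k \<Longrightarrow> slot_coeff A t m k \<alpha>s = 0"
  by (induction m arbitrary: k \<alpha>s) auto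

lemma slot_coeff_0: "slot_coeff A t m 0 \<alpha>s = t \<alpha>s"
  by (induction m) auto

lemma slot_coeff_1: "slot_coeff A t m 1 \<alpha>s = (\<Sum>a<m. t (\<alpha>s[a := \<alpha>s ! a \<circ> A]))"
  by (induction m) (auto simp: slot_coeff_0 simp del: comp_apply)

text \<open>\<open>slot_coeff A t m k\<close> sums the values of \<open>t\<close> over all ways to
  compose \<open>k\<close> of the first \<open>m\<close> entries with \<open>A\<close>. So the
  action of 1 + r A is a polynomial in \<open>r\<close> with these coefficients. Changing only the
  first \<open>m\<close> entries is what makes an induction possible.\<close>

lemma slot_coeff_expand:
  assumes t: "t \<in> tensor_power scale d" and A: "Vector_Spaces.linear scale scale A"
    and \<alpha>s: "\<alpha>s \<in> covectors scale d" and m: "m \<le> d"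
  shows "t (map (\<lambda>\<alpha>. \<alpha> + fscale r (\<alpha> \<circ> A)) (take m \<alpha>s) @ drop m \<alpha>s) =
    (\<Sum>k\<le>m. r ^ k * slot_coeff A t m k \<alpha>s)"
  using m \<alpha>s
proof (induction m arbitrary: \<alpha>s)
  case 0
  then show ?case by simp
next
  case (Suc m)
  let ?f = "\<lambda>\<alpha>. \<alpha> + fscale r (\<alpha> \<circ> A)"
  let ?p = "\<lambda>m \<alpha>s. map ?f (take m \<alpha>s) @ drop m \<alpha>s"
  have m: "m < d" "m < length \<alpha>s" and len: "length \<alpha>s = d" using Suc.prems by (auto simp: covectors_def)
  have dual: "\<alpha>s ! m \<in> dual scale" "\<alpha>s ! m \<circ> A \<in> dual scale"
    using covectors_nth[OF Suc.prems(2) m(1)] dual_comp[OF _ A] by auto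
  have f_dual: "?f \<alpha> \<in> dual scale" if "\<alpha> \<in> dual scale" for \<alpha>
    using that dual_comp[OF that A] by (intro fs.subspace_add fs.subspace_scale subspace_dual[OF vector_space_axioms])
  have p: "?p m \<alpha>s \<in> covectors scale d"
    using Suc.prems m f_dual set_take_subset[of m \<alpha>s] set_drop_subset[of m \<alpha>s]
    unfolding covectors_def by (auto simp del: set_drop_subset set_take_subset)
  have "?p (Suc m) \<alpha>s = (?p m \<alpha>s)[m := \<alpha>s ! m + fscale r (\<alpha>s ! m \<circ> A)]"
    using m by (simp add: take_Suc_conv_app_nth list_update_append flip: Cons_nth_drop_Suc)
  then have "t (?p (Suc m) \<alpha>s) = t ((?p m \<alpha>s)[m := \<alpha>s ! m]) + r * t ((?p m \<alpha>s)[m := \<alpha>s ! m \<circ> A])"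
    using tensor_power_add[OF t p m(1) dual(1) fs.subspace_scale[OF subspace_dual[OF vector_space_axioms] dual(2)]]
      tensor_power_scale[OF t p m(1) dual(2)] by simp
  also have "(?p m \<alpha>s)[m := \<alpha>s ! m] = ?p m \<alpha>s"
    using m by (intro list_update_same_conv[THEN iffD2]) (auto simp: nth_append)
  also have "(?p m \<alpha>s)[m := \<alpha>s ! m \<circ> A] = ?p m (\<alpha>s[m := \<alpha>s ! m \<circ> A])"
    using m by (simp add: list_update_append drop_update_swap)
  also have "t (?p m \<alpha>s) = (\<Sum>k\<le>m. r ^ k * slot_coeff A t m k \<alpha>s)"
    by (rule Suc.IH) (use Suc.prems in auto)
  also have "t (?p m (\<alpha>s[m := \<alpha>s ! m \<circ> A])) = (\<Sum>k\<le>m. r ^ k * slot_coeff A t m k (\<alpha>s[m := \<alpha>s ! m \<circ> A]))"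
    by (rule Suc.IH) (use Suc.prems dual in \<open>simp_all add: covectors_update\<close>)
  finally have *: "t (?p (Suc m) \<alpha>s) = (\<Sum>k\<le>m. r ^ k * slot_coeff A t m k \<alpha>s) +
      r * (\<Sum>k\<le>m. r ^ k * slot_coeff A t m k (\<alpha>s[m := \<alpha>s ! m \<circ> A]))" .
  have "(\<Sum>k\<le>Suc m. r ^ k * slot_coeff A t (Suc m) k \<alpha>s) =
      (\<Sum>k\<le>Suc m. r ^ k * slot_coeff A t m k \<alpha>s) +
      (\<Sum>k\<le>Suc m. r ^ k * (if k = 0 then 0 else slot_coeff A t m (k - 1) (\<alpha>s[m := \<alpha>s ! m \<circ> A])))"
    by (simp only: slot_coeff.simps distrib_left sum.distrib)
  also have "(\<Sum>k\<le>Suc m. r ^ k * (if k = 0 then 0 else slot_coeff A t m (k - 1) (\<alpha>s[m := \<alpha>s ! m \<circ> A])))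
      = r * (\<Sum>k\<le>m. r ^ k * slot_coeff A t m k (\<alpha>s[m := \<alpha>s ! m \<circ> A]))"
    by (subst sum.atMost_Suc_shift) (simp add: sum_distrib_left mult_ac)
  finally show ?case
    unfolding * by (simp add: slot_coeff_eq_0)
qed

text \<open>The action of a Lie algebra element by derivations. The guard is needed because
  \<open>\<alpha> \<circ> A\<close> can be a covector although \<open>\<alpha>\<close> is
  not.\<close>

definition deriv_op :: "nat \<Rightarrow> ('v \<Rightarrow> 'v) \<Rightarrow> ('k, 'v) tensor \<Rightarrow> ('k, 'v) tensor" where
  "deriv_op d A t = (\<lambda>\<alpha>s. if \<alpha>s \<in> covectors scale d then \<Sum>a<d. t (\<alpha>s[a := \<alpha>s ! a \<circ> A]) else 0)"

text \<open>The derivation is the linear coefficient of the action of 1 + r A. The samples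
  \<open>r = 2 ^ m\<close> serve twice: they separate the degrees, and \<open>1 + 2 ^ m\<close> is
  nonzero, which keeps 1 + r A invertible also for \<open>b = c\<close>.\<close>

lemma gl_realized_deriv_op:
  assumes bc: "b \<in> Basis" "c \<in> Basis" and d: "d > 0"
  shows "gl_realized scale d (deriv_op d (matrix_unit b c))"
proof -
  let ?A = "matrix_unit b c"
  let ?\<Phi> = "\<lambda>k t \<alpha>s. if \<alpha>s \<in> covectors scale d then slot_coeff ?A t d k \<alpha>s else 0"
  have "gl_realized scale d (?\<Phi> 1)"
  proof (rule gl_realized_coefficient[OF gl_realized_id])
    show "1 \<le> d" using d by simp
    fix m
    let ?r = "2 ^ m :: 'k"
    let ?g = "\<lambda>v. v + scale ?r (?A v)"
    have "1 + ?r * coord c b \<noteq> 0"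
    proof -
      have "(of_nat (1 + 2 ^ m) :: 'k) \<noteq> 0" unfolding of_nat_eq_0_iff by simp
      then show ?thesis using bc by (simp add: coord_Basis)
    qed
    then have g: "?g \<in> GL scale" by (rule transvection_GL[OF bc(1)])
    have "act ?g t = (\<Sum>k\<le>d. fscale (?r ^ k) (?\<Phi> k t))" if t: "t \<in> tensor_power scale d" for t
    proof
      fix \<alpha>s
      show "act ?g t \<alpha>s = (\<Sum>k\<le>d. fscale (?r ^ k) (?\<Phi> k t)) \<alpha>s"
      proof (cases "\<alpha>s \<in> covectors scale d")
        case True
        then have len: "length \<alpha>s = d" by (simp add: covectors_def)
        have eq: "map (\<lambda>\<alpha>. \<alpha> \<circ> ?g) \<alpha>s = map (\<lambda>\<alpha>. \<alpha> + fscale ?r (\<alpha> \<circ> ?A)) \<alpha>s"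
        proof (rule map_cong[OF refl])
          fix \<alpha> assume "\<alpha> \<in> set \<alpha>s"
          then have "\<alpha> \<in> dual scale" using True by (auto simp: covectors_def)
          then show "\<alpha> \<circ> ?g = \<alpha> + fscale ?r (\<alpha> \<circ> ?A)"
            by (simp add: fun_eq_iff fscale_def dual_linear)
        qed
        show ?thesis
          using slot_coeff_expand[OF t linear_matrix_unit[of b c] True order_refl, of ?r] True len
          unfolding act_def eq by (simp add: sum_fun_apply fscale_apply del: comp_apply plus_fun_apply)
      next
        case False
        then show ?thesis
          using covectors_map_comp[OF g] tensor_power_outside[OF t]
          by (simp add: act_def sum_fun_apply fscale_apply)
      qed
    qed
    then show "gl_realized scale d (\<lambda>t. \<Sum>k\<le>d. fscale (?r ^ k) (?\<Phi> k t))"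
      unfolding gl_realized_def by (intro bexI[OF _ gl_span.act[OF g]]) simp
  qed
  then show ?thesis
    by (rule gl_realized_cong) (simp add: deriv_op_def fun_eq_iff slot_coeff_1[unfolded One_nat_def] )
qed

lemma dual_comp_matrix_unit:
  assumes "\<alpha> \<in> dual scale"
  shows "\<alpha> \<circ> matrix_unit b c = fscale (\<alpha> b) (coord c)"
  using assms by (simp add: fun_eq_iff matrix_unit_def dual_linear fscale_def)

text \<open>Composing the derivations gives one term for each ordered pair of slots. In a single
  slot the products of matrix units sum to \<open>card Basis\<close> times the identity, in two
  different slots to the swap. As \<open>swap_sum\<close> also counts the \<open>d\<close> diagonal
  pairs, \<open>d\<close> is subtracted from the scalar.\<close>

lemma casimir_expand:
  assumes t: "t \<in> tensor_power scale d"
  shows "(\<Sum>b\<in>Basis. \<Sum>c\<in>Basis. deriv_op d (matrix_unit b c) (deriv_op d (matrix_unit c b) t)) =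
    swap_sum d t + fscale (of_nat d * of_nat (card Basis) - of_nat d) t" (is "?L = ?R")
proof
  fix \<alpha>s
  show "?L \<alpha>s = ?R \<alpha>s"
  proof (cases "\<alpha>s \<in> covectors scale d")
    case False
    then show ?thesis
      using tensor_power_outside[OF t] tensor_power_outside[OF swap_sum_tensor_power[OF t]]
      by (simp add: sum_fun_apply deriv_op_def fscale_apply)
  next
    case \<alpha>s: True
    then have len: "length \<alpha>s = d" by (simp add: covectors_def)
    define T where "T a e b c = t (\<alpha>s[a := \<alpha>s ! a \<circ> matrix_unit b c,
      e := \<alpha>s[a := \<alpha>s ! a \<circ> matrix_unit b c] ! e \<circ> matrix_unit c b])" for a e b c
    have dual: "\<alpha>s ! a \<in> dual scale" if "a < d" for a
      using covectors_nth[OF \<alpha>s that] .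
    have cov: "\<alpha>s[a := \<alpha>s ! a \<circ> matrix_unit b c] \<in> covectors scale d" if "a < d" for a b c
      using \<alpha>s dual_comp[OF dual[OF that] linear_matrix_unit] by (rule covectors_update)
    have "?L \<alpha>s = (\<Sum>b\<in>Basis. \<Sum>c\<in>Basis. \<Sum>a<d. \<Sum>e<d. T a e b c)"
      using \<alpha>s cov by (simp add: sum_fun_apply deriv_op_def T_def)
    also have "\<dots> = (\<Sum>a<d. \<Sum>e<d. \<Sum>b\<in>Basis. \<Sum>c\<in>Basis. T a e b c)"
      by (rule sum_swap_pairs)
    also have "\<dots> = (\<Sum>a<d. \<Sum>e<d. (if a = e then of_nat (card Basis) * t \<alpha>s - t \<alpha>s else 0) + swap_op d a e t \<alpha>s)"
    proof (intro sum.cong refl)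
      fix a e assume ae: "a \<in> {..<d}" "e \<in> {..<d}"
      show "(\<Sum>b\<in>Basis. \<Sum>c\<in>Basis. T a e b c) =
          (if a = e then of_nat (card Basis) * t \<alpha>s - t \<alpha>s else 0) + swap_op d a e t \<alpha>s"
      proof (cases "a = e")
        case True
        have "T a e b c = (\<alpha>s ! a) b * t (\<alpha>s[a := coord b])" if "c \<in> Basis" for b c
          using True ae len dual[of a] that
          by (simp add: T_def dual_comp_matrix_unit fs.subspace_scale[OF subspace_dual[OF vector_space_axioms] coord_dual]
              fscale_apply coord_Basis tensor_power_scale[OF t \<alpha>s _ coord_dual])
        then have "(\<Sum>b\<in>Basis. \<Sum>c\<in>Basis. T a e b c) =
            of_nat (card Basis) * (\<Sum>b\<in>Basis. (\<alpha>s ! a) b * t (\<alpha>s[a := coord b]))"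
          by (simp add: sum_distrib_left)
        also have "\<dots> = of_nat (card Basis) * t \<alpha>s"
          using tensor_power_expand[OF t \<alpha>s _ dual[of a], of a] ae by simp
        finally show ?thesis
          using True ae len by (simp add: perm_op_def)
      next
        case False
        have "T a e b c = (\<alpha>s ! a) b * ((\<alpha>s ! e) c * t (\<alpha>s[a := coord c, e := coord b]))" for b c
        proof -
          have "T a e b c = t (\<alpha>s[a := fscale ((\<alpha>s ! a) b) (coord c), e := fscale ((\<alpha>s ! e) c) (coord b)])"
            using False ae len dual by (simp add: T_def dual_comp_matrix_unit)
          also have "\<dots> = (\<alpha>s ! e) c * t (\<alpha>s[a := fscale ((\<alpha>s ! a) b) (coord c), e := coord b])"
            using ae by (intro tensor_power_scale[OF t covectors_update[OF \<alpha>s] _ coord_dual])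
              (auto intro: fs.subspace_scale[OF subspace_dual[OF vector_space_axioms] coord_dual])
          also have "t (\<alpha>s[a := fscale ((\<alpha>s ! a) b) (coord c), e := coord b]) =
              (\<alpha>s ! a) b * t (\<alpha>s[e := coord b, a := coord c])"
            using ae False tensor_power_scale[OF t covectors_update[OF \<alpha>s coord_dual] _ coord_dual]
            by (simp add: list_update_swap)
          finally show ?thesis using False by (simp add: list_update_swap mult_ac)
        qed
        then have "(\<Sum>b\<in>Basis. \<Sum>c\<in>Basis. T a e b c) =
            (\<Sum>b\<in>Basis. (\<alpha>s ! a) b * (\<Sum>c\<in>Basis. (\<alpha>s ! e) c * t (\<alpha>s[e := coord b, a := coord c])))"
          using False by (simp add: sum_distrib_left list_update_swap)
        also have "\<dots> = (\<Sum>b\<in>Basis. (\<alpha>s ! a) b * t (\<alpha>s[e := coord b, a := \<alpha>s ! e]))"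
          using ae dual by (simp add: tensor_power_expand[OF t covectors_update[OF \<alpha>s coord_dual], symmetric])
        also have "\<dots> = t (\<alpha>s[a := \<alpha>s ! e, e := \<alpha>s ! a])"
          using ae dual False
          by (simp add: list_update_swap[of e a] tensor_power_expand[OF t covectors_update[OF \<alpha>s], symmetric])
        also have "\<dots> = swap_op d a e t \<alpha>s"
          using ae len by (simp add: perm_op_def permute_list_transpose)
        finally show ?thesis using False by simp
      qed
    qed
    also have "\<dots> = of_nat d * (of_nat (card Basis) * t \<alpha>s - t \<alpha>s) + swap_sum d t \<alpha>s"
      by (simp add: sum.distrib swap_sum_def sum_fun_apply)
    also have "\<dots> = ?R \<alpha>s" by (simp add: fscale_apply algebra_simps)
    finally show ?thesis .
  qed
qed

lemma gl_realized_swap_sum: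
  assumes "d > 0"
  shows "gl_realized scale d (swap_sum d)"
proof -
  define D where "D b c t = deriv_op d (matrix_unit b c) (deriv_op d (matrix_unit c b) t)" for b c t
  have "gl_realized scale d (D b c)" if "b \<in> Basis" "c \<in> Basis" for b c
    by (rule gl_realized_cong[OF gl_realized_comp[OF gl_realized_deriv_op[OF that assms]
            gl_realized_deriv_op[OF that(2,1) assms]]]) (rule D_def)
  then have "gl_realized scale d (\<lambda>t. \<Sum>c\<in>Basis. D b c t)" if "b \<in> Basis" for b
    by (rule gl_realized_sum[where \<Phi>="D b", OF gl_realized_id finite_Basis]) (use that in blast)
  then have "gl_realized scale d (\<lambda>t. \<Sum>b\<in>Basis. \<Sum>c\<in>Basis. D b c t)"
    by (rule gl_realized_sum[where \<Phi>="\<lambda>b t. \<Sum>c\<in>Basis. D b c t", OF gl_realized_id finite_Basis])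
  from gl_realized_diff[OF this gl_realized_scale[OF gl_realized_id]]
  show ?thesis
    by (rule gl_realized_cong[where \<Psi>="\<lambda>t. (\<Sum>b\<in>Basis. \<Sum>c\<in>Basis. D b c t) -
        fscale (of_nat d * of_nat (card Basis) - of_nat d) t"])
      (simp only: D_def casimir_expand add_diff_cancel_right')
qed

lemma GL_hom_swap_sum:
  assumes U: "gl_stable scale U" "U \<subseteq> tensor_power scale d" and W: "W \<subseteq> tensor_power scale d"
    and \<phi>: "\<phi> \<in> GL_hom scale U W" and d: "d > 0" and t: "t \<in> U"
  shows "swap_sum d t \<in> U" "\<phi> (swap_sum d t) = swap_sum d (\<phi> t)"
proof -
  obtain \<Phi> where \<Phi>: "\<Phi> \<in> gl_span scale" "\<forall>t\<in>tensor_power scale d. swap_sum d t = \<Phi> t"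
    using gl_realized_swap_sum[OF d] by (auto simp: gl_realized_def)
  have "\<phi> t \<in> W" using \<phi> t by (auto simp: GL_hom_def)
  then have "swap_sum d t = \<Phi> t" "swap_sum d (\<phi> t) = \<Phi> (\<phi> t)" using \<Phi> U W t by auto
  then show "swap_sum d t \<in> U" "\<phi> (swap_sum d t) = swap_sum d (\<phi> t)"
    using gl_stable_gl_span[OF U(1) \<Phi>(1) t] GL_hom_gl_span[OF U(1) \<phi> \<Phi>(1) t] by simp_all
qed

end

section \<open>The projection onto an isotypic component\<close>

interpretation fs_pair: vector_space_pair
  "fscale :: 'k::field \<Rightarrow> ('a \<Rightarrow> 'k) \<Rightarrow> 'a \<Rightarrow> 'k" "fscale :: 'k \<Rightarrow> ('b \<Rightarrow> 'k) \<Rightarrow> 'b \<Rightarrow> 'k"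
  by (rule vector_space_pair.intro) (rule fs.vector_space_axioms)+

text \<open>The map is linear only on \<open>U\<close>, so it is replaced by a linear map
  \<open>g\<close> agreeing with it on a basis \<open>B\<close>. The set \<open>S\<close> supplies
  the finite dimension.\<close>

lemma inj_endomorphism_surj:
  fixes U :: "('a \<Rightarrow> 'k::field) set"
  assumes U: "fs.subspace U" and S: "finite S" "U \<subseteq> fs.span S"
    and add: "\<And>x y. x \<in> U \<Longrightarrow> y \<in> U \<Longrightarrow> \<theta> (x + y) = \<theta> x + \<theta> y"
    and scale: "\<And>c x. x \<in> U \<Longrightarrow> \<theta> (fscale c x) = fscale c (\<theta> x)"
    and into: "\<theta> ` U \<subseteq> U" and inj: "inj_on \<theta> U"
  shows "\<theta> ` U = U"
proof
  obtain B where B: "B \<subseteq> U" "fs.independent B" "U \<subseteq> fs.span B"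
    using fs.basis_exists[of U] by metis
  have span_B: "fs.span B = U"
    using B(3) fs.span_minimal[OF B(1) U] by (rule equalityI[rotated])
  have fin: "finite B"
    using fs.independent_span_bound[OF S(1) B(2) subset_trans[OF B(1) S(2)]] by simp
  obtain g where g: "Vector_Spaces.linear fscale fscale g" "\<forall>x\<in>B. g x = \<theta> x"
    using fs_pair.linear_independent_extend[OF B(2), of \<theta>] by auto
  interpret g: Vector_Spaces.linear fscale fscale g by (rule g(1))
  have zero: "\<theta> 0 = 0"
    using scale[OF fs.subspace_0[OF U], of 0] by (simp only: fs.scale_zero_left)
  have eq: "x \<in> U \<and> g x = \<theta> x" if "x \<in> fs.span B" for x
    using that
  proof (induction rule: fs.span_induct_alt)
    case base
    show ?case by (intro conjI fs.subspace_0[OF U]) (simp only: zero g.zero)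
  next
    case (step c b y)
    have b: "b \<in> U" "fscale c b \<in> U" using step B(1) fs.subspace_scale[OF U] by blast+
    have y: "y \<in> U" "g y = \<theta> y" using step by auto
    have "\<theta> (fscale c b + y) = fscale c (\<theta> b) + \<theta> y"
      by (simp only: add[OF b(2) y(1)] scale[OF b(1)])
    moreover have "g b = \<theta> b" using g(2) step by blast
    then have "g (fscale c b + y) = fscale c (\<theta> b) + \<theta> y"
      by (simp only: g.add g.scale y(2))
    ultimately show ?case using fs.subspace_add[OF U b(2) y(1)] by (simp only: simp_thms)
  qed
  have inj_g: "inj_on g (fs.span B)"
    using inj eq unfolding inj_on_def span_B by simp
  have indep: "fs.independent (g ` B)"
    using g.independent_inj_on_image[OF B(2) inj_g] .
  have card: "card (g ` B) = card B"
    using inj_g B(1) span_B by (intro card_image) (auto intro: inj_on_subset)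
  have gB: "g ` B \<subseteq> fs.span B" using eq into span_B B(1) by fastforce
  show "U \<subseteq> \<theta> ` U"
  proof
    fix y assume y: "y \<in> U"
    \<comment> \<open>Otherwise \<open>y\<close> together with the image of \<open>B\<close> would
      be more than \<open>card B\<close> independent elements in the span of
      \<open>B\<close>.\<close>
    have "y \<in> fs.span (g ` B)"
    proof (rule ccontr)
      assume n: "y \<notin> fs.span (g ` B)"
      then have "fs.independent (insert y (g ` B))"
        using indep by (rule fs.independent_insertI)
      moreover have "insert y (g ` B) \<subseteq> fs.span B" using y span_B gB by blast
      ultimately have "card (insert y (g ` B)) \<le> card B"
        using fs.independent_span_bound[OF fin] by blast
      moreover have "y \<notin> g ` B" using n fs.span_base by blast
      ultimately show False using card fin by simp
    qed
    then obtain x where "x \<in> fs.span B" "y = g x"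
      unfolding g.span_image by blast
    then show "y \<in> \<theta> ` U" using eq by auto
  qed
qed (rule into)

lemma GL_homI:
  assumes "\<And>x. x \<in> U \<Longrightarrow> \<phi> x \<in> W"
    and "\<And>x y. x \<in> U \<Longrightarrow> y \<in> U \<Longrightarrow> \<phi> (x + y) = \<phi> x + \<phi> y"
    and "\<And>c x. x \<in> U \<Longrightarrow> \<phi> (fscale c x) = fscale c (\<phi> x)"
    and "\<And>g x. g \<in> GL scale \<Longrightarrow> x \<in> U \<Longrightarrow> \<phi> (act g x) = act g (\<phi> x)"
  shows "\<phi> \<in> GL_hom scale U W"
  using assms unfolding GL_hom_def by blast

lemma gl_stableD:
  assumes "gl_stable scale U"
  shows "fs.subspace U" "0 \<in> U" "x \<in> U \<Longrightarrow> y \<in> U \<Longrightarrow> x + y \<in> U" "x \<in> U \<Longrightarrow> y \<in> U \<Longrightarrow> x - y \<in> U"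
    "x \<in> U \<Longrightarrow> fscale c x \<in> U" "g \<in> GL scale \<Longrightarrow> x \<in> U \<Longrightarrow> act g x \<in> U"
  using assms unfolding gl_stable_def
  by (blast intro: fs.subspace_0 fs.subspace_add fs.subspace_diff fs.subspace_scale)+

lemma GL_hom_inverse:
  assumes U: "gl_stable scale U" and \<phi>: "\<phi> \<in> GL_hom scale U W" "bij_betw \<phi> U W"
  shows "inv_into U \<phi> \<in> GL_hom scale W U"
proof (rule GL_homI)
  have inj: "inj_on \<phi> U" and img: "\<phi> ` U = W" using \<phi>(2) by (auto simp: bij_betw_def)
  have inv: "inv_into U \<phi> w \<in> U" "\<phi> (inv_into U \<phi> w) = w" if "w \<in> W" for w
    using that inv_into_into[of w \<phi> U] f_inv_into_f[of w \<phi> U] img by auto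
  show "inv_into U \<phi> w \<in> U" if "w \<in> W" for w using inv that by blast
  show "inv_into U \<phi> (w + z) = inv_into U \<phi> w + inv_into U \<phi> z" if "w \<in> W" "z \<in> W" for w z
    by (rule inv_into_f_eq[OF inj]) (use that inv gl_stableD(3)[OF U] GL_homD(2)[OF \<phi>(1)] in metis)+
  show "inv_into U \<phi> (fscale c w) = fscale c (inv_into U \<phi> w)" if "w \<in> W" for c w
    by (rule inv_into_f_eq[OF inj]) (use that inv gl_stableD(5)[OF U] GL_homD(3)[OF \<phi>(1)] in metis)+
  show "inv_into U \<phi> (act g w) = act g (inv_into U \<phi> w)" if "g \<in> GL scale" "w \<in> W" for g w
    by (rule inv_into_f_eq[OF inj]) (use that inv gl_stableD(6)[OF U] GL_homD(4)[OF \<phi>(1)] in metis)+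
qed

lemma gl_stable_image:
  assumes U: "gl_stable scale U" and \<phi>: "\<phi> \<in> GL_hom scale U W"
  shows "gl_stable scale (\<phi> ` U)"
  unfolding gl_stable_def
proof (intro conjI ballI fs.subspaceI)
  have "\<phi> 0 = 0"
    using GL_homD(3)[OF \<phi> gl_stableD(2)[OF U], of 0] by (metis fs.scale_zero_left)
  then show "0 \<in> \<phi> ` U" using gl_stableD(2)[OF U] by (metis imageI)
  show "x + y \<in> \<phi> ` U" if "x \<in> \<phi> ` U" "y \<in> \<phi> ` U" for x y
    using that by (metis (no_types, lifting) GL_homD(2)[OF \<phi>] gl_stableD(3)[OF U] image_iff)
  show "fscale c x \<in> \<phi> ` U" if "x \<in> \<phi> ` U" for c x
    using that by (metis (no_types, lifting) GL_homD(3)[OF \<phi>] gl_stableD(5)[OF U] image_iff)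
  show "act g x \<in> \<phi> ` U" if "g \<in> GL scale" "x \<in> \<phi> ` U" for g x
    using that by (metis (no_types, lifting) GL_homD(4)[OF \<phi>] gl_stableD(6)[OF U] image_iff)
qed

context tensor_space
begin

text \<open>By \<open>inj\<close> and \<open>surj\<close>, \<open>\<Psi>\<close> restricts to an
  isomorphism of the eigenspace \<open>Xc\<close> with \<open>W\<close>; by \<open>dec\<close>,
  \<open>Xc\<close> and the image of \<open>swap_sum - c\<close> span \<open>X\<close>. Every
  equivariant projection whose image is isomorphic to \<open>W\<close> is then the one onto
  \<open>Xc\<close> along that image, so the description in \<open>component\<close> is
  definite.\<close>

lemma component_eq_0_iff:
  assumes X: "gl_stable scale X" "X \<subseteq> tensor_power scale d" "d > 0"
    and fin: "finite S" "X \<subseteq> fs.span S"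
    and W: "W \<subseteq> tensor_power scale d" "\<And>w. w \<in> W \<Longrightarrow> swap_sum d w = fscale c w"
    and \<Psi>: "\<Psi> \<in> GL_hom scale X W"
    and inj: "\<And>x. x \<in> X \<Longrightarrow> swap_sum d x = fscale c x \<Longrightarrow> \<Psi> x = 0 \<Longrightarrow> x = 0"
    and surj: "\<And>w. w \<in> W \<Longrightarrow> \<exists>x\<in>X. swap_sum d x = fscale c x \<and> \<Psi> x = w"
    and dec: "\<And>x. x \<in> X \<Longrightarrow> \<exists>u\<in>X. \<exists>v\<in>X. swap_sum d u = fscale c u \<and>
      x = u + (swap_sum d v - fscale c v)"
    and x: "x \<in> X"
  shows "component scale X W x = 0 \<longleftrightarrow> \<Psi> x = 0"
proof -
  define Xc where "Xc = {x \<in> X. swap_sum d x = fscale c x}"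
  have XcX: "Xc \<subseteq> X" by (auto simp: Xc_def)
  have Xc: "gl_stable scale Xc"
    unfolding gl_stable_def
  proof (intro conjI ballI fs.subspaceI)
    show "0 \<in> Xc" unfolding Xc_def
      using gl_stableD(2)[OF X(1)] by (metis (mono_tags, lifting) mem_Collect_eq swap_sum_linear(4) fs.scale_zero_right)
    show "x + y \<in> Xc" if "x \<in> Xc" "y \<in> Xc" for x y
      using that gl_stableD(3)[OF X(1)] unfolding Xc_def mem_Collect_eq
      by (simp only: swap_sum_linear fs.scale_right_distrib)
    show "fscale a x \<in> Xc" if "x \<in> Xc" for a x
      using that gl_stableD(5)[OF X(1)] unfolding Xc_def mem_Collect_eq
      by (simp only: swap_sum_linear fs.scale_left_commute[of c a])
    show "act g x \<in> Xc" if "g \<in> GL scale" "x \<in> Xc" for g x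
      using that gl_stableD(6)[OF X(1)] unfolding Xc_def mem_Collect_eq
      by (simp only: act_swap_sum[symmetric] act_linear(3)[symmetric])
  qed
  have \<Psi>c: "\<Psi> \<in> GL_hom scale Xc W"
    using \<Psi> XcX by (intro GL_homI) (auto dest: GL_homD)
  have \<Psi>diff: "\<Psi> (y - z) = \<Psi> y - \<Psi> z" if "y \<in> X" "z \<in> X" for y z
  proof -
    have "\<Psi> (y - z + z) = \<Psi> (y - z) + \<Psi> z"
      by (rule GL_homD(2)[OF \<Psi> gl_stableD(4)[OF X(1) that] that(2)])
    then show ?thesis by (metis add_diff_cancel diff_add_cancel)
  qed
  have bij: "bij_betw \<Psi> Xc W"
    unfolding bij_betw_def
  proof
    show "inj_on \<Psi> Xc"
    proof (rule inj_onI)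
      fix y z assume yz: "y \<in> Xc" "z \<in> Xc" "\<Psi> y = \<Psi> z"
      then have "\<Psi> (y - z) = 0" using \<Psi>diff XcX by (metis diff_self subsetD)
      moreover have "y - z \<in> Xc" using gl_stableD(4)[OF Xc] yz by blast
      ultimately have "y - z = 0" using inj unfolding Xc_def by blast
      then show "y = z" by (metis eq_iff_diff_eq_0)
    qed
    show "\<Psi> ` Xc = W"
      using surj GL_homD(1)[OF \<Psi>c] unfolding Xc_def by (auto simp: image_iff)
  qed
  have \<Psi>T: "\<Psi> (swap_sum d v) = fscale c (\<Psi> v)" "swap_sum d v \<in> X" if "v \<in> X" for v
    using GL_hom_swap_sum[OF X(1,2) W(1) \<Psi> X(3) that] W(2) GL_homD(1)[OF \<Psi> that] by auto
  have proj: "\<pi> (u + (swap_sum d v - fscale c v)) = u"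
    if \<pi>: "equivariant_projection scale X W \<pi>" and u: "u \<in> Xc" and v: "v \<in> X" for \<pi> u v
  proof -
    have hom: "\<pi> \<in> GL_hom scale X X" and idem: "\<And>y. y \<in> X \<Longrightarrow> \<pi> (\<pi> y) = \<pi> y"
      using \<pi> by (auto simp: equivariant_projection_def)
    obtain \<psi> where \<psi>: "\<psi> \<in> GL_hom scale (\<pi> ` X) W" "bij_betw \<psi> (\<pi> ` X) W"
      using \<pi> by (auto simp: equivariant_projection_def GL_isomorphic_def)
    define N where "N = \<pi> ` X"
    have N: "gl_stable scale N" unfolding N_def by (rule gl_stable_image[OF X(1) hom])
    have NX: "N \<subseteq> X" unfolding N_def using GL_homD(1)[OF hom] by blast
    note \<psi> = \<psi>[folded N_def]
    \<comment> \<open>The isomorphism with \<open>W\<close> commutes with \<open>swap_sum\<close>,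
      so the eigenvalue \<open>c\<close> passes from \<open>W\<close> to the image of the
      projection.\<close>
    have NXc: "N \<subseteq> Xc"
    proof
      fix y assume y: "y \<in> N"
      note T = GL_hom_swap_sum[OF N subset_trans[OF NX X(2)] W(1) \<psi>(1) X(3) y]
      have "\<psi> (swap_sum d y) = \<psi> (fscale c y)"
        using T(2) W(2)[OF GL_homD(1)[OF \<psi>(1) y]] GL_homD(3)[OF \<psi>(1) y] by metis
      then have "swap_sum d y = fscale c y"
        using \<psi>(2) T(1) gl_stableD(5)[OF N y] by (metis bij_betw_def inj_onD)
      then show "y \<in> Xc" using y NX by (auto simp: Xc_def)
    qed
    \<comment> \<open>\<open>\<theta>\<close> embeds \<open>Xc\<close> into \<open>N\<close> by way
      of \<open>W\<close>. As an injective endomorphism of the finite-dimensional \<open>Xc\<close>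
      it is onto, so \<open>N\<close> is all of \<open>Xc\<close>.\<close>
    define \<theta> where "\<theta> y = inv_into N \<psi> (\<Psi> y)" for y
    note inv = GL_hom_inverse[OF N \<psi>]
    have \<theta>N: "\<theta> y \<in> N" if "y \<in> Xc" for y
      unfolding \<theta>_def using GL_homD(1)[OF inv] GL_homD(1)[OF \<Psi>c] that by blast
    have "\<theta> ` Xc = Xc"
    proof (rule inj_endomorphism_surj[OF gl_stableD(1)[OF Xc] fin(1) subset_trans[OF XcX fin(2)]])
      show "\<theta> (y + z) = \<theta> y + \<theta> z" if "y \<in> Xc" "z \<in> Xc" for y z
        using that unfolding \<theta>_def by (metis GL_homD(1,2)[OF \<Psi>c] GL_homD(2)[OF inv])
      show "\<theta> (fscale a y) = fscale a (\<theta> y)" if "y \<in> Xc" for a y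
        using that unfolding \<theta>_def by (metis GL_homD(1,3)[OF \<Psi>c] GL_homD(3)[OF inv])
      show "\<theta> ` Xc \<subseteq> Xc" using \<theta>N NXc by blast
      show "inj_on \<theta> Xc"
        using bij inj_on_inv_into[of W \<psi> N] \<psi>(2) unfolding \<theta>_def bij_betw_def inj_on_def
        by (metis imageI subset_refl)
    qed
    moreover have "\<theta> ` Xc \<subseteq> N" using \<theta>N by (rule image_subsetI)
    ultimately have "Xc \<subseteq> N" by simp
    then obtain z where "z \<in> X" "u = \<pi> z" using u unfolding N_def by blast
    then have "\<pi> u = u" using idem by simp
    \<comment> \<open>\<open>\<pi>\<close> commutes with \<open>swap_sum\<close>, and
      \<open>\<pi> v\<close> already lies in the eigenspace.\<close>
    moreover have "\<pi> (swap_sum d v - fscale c v) = 0"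
    proof -
      have "\<pi> v \<in> Xc" using v NXc unfolding N_def by blast
      then have "\<pi> (swap_sum d v) = fscale c (\<pi> v)"
        using GL_hom_swap_sum(2)[OF X(1,2) X(2) hom X(3) v] by (simp add: Xc_def)
      moreover have "\<pi> (swap_sum d v - fscale c v + fscale c v) =
          \<pi> (swap_sum d v - fscale c v) + \<pi> (fscale c v)"
        using gl_stableD(4,5)[OF X(1)] \<Psi>T(2)[OF v] v by (intro GL_homD(2)[OF hom]) auto
      ultimately show ?thesis using GL_homD(3)[OF hom v] by (metis add_cancel_left_left diff_add_cancel)
    qed
    moreover have "\<pi> (u + (swap_sum d v - fscale c v)) = \<pi> u + \<pi> (swap_sum d v - fscale c v)"
      using gl_stableD(4,5)[OF X(1)] \<Psi>T(2)[OF v] v u XcX by (intro GL_homD(2)[OF hom]) auto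
    ultimately show ?thesis by (simp only: add_0_right)
  qed
  \<comment> \<open>Existence of a projection: follow \<open>\<Psi>\<close> by the inverse of its
    restriction to \<open>Xc\<close>.\<close>
  define \<pi>0 where "\<pi>0 y = inv_into Xc \<Psi> (\<Psi> y)" for y
  note inv = GL_hom_inverse[OF Xc \<Psi>c bij]
  have \<pi>0: "\<pi>0 y \<in> Xc" "\<Psi> (\<pi>0 y) = \<Psi> y" if "y \<in> X" for y
    using GL_homD(1)[OF \<Psi> that] bij inv_into_into[of "\<Psi> y" \<Psi> Xc] f_inv_into_f[of "\<Psi> y" \<Psi> Xc]
    by (auto simp: \<pi>0_def bij_betw_def)
  have \<pi>0c: "\<pi>0 y = y" if "y \<in> Xc" for y
    unfolding \<pi>0_def using bij that by (simp add: bij_betw_def)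
  have proj0: "equivariant_projection scale X W \<pi>0"
    unfolding equivariant_projection_def
  proof (intro conjI ballI)
    show "\<pi>0 \<in> GL_hom scale X X"
    proof (rule GL_homI)
      show "\<pi>0 y \<in> X" if "y \<in> X" for y using \<pi>0(1)[OF that] XcX by blast
      show "\<pi>0 (y + z) = \<pi>0 y + \<pi>0 z" if "y \<in> X" "z \<in> X" for y z
        using that unfolding \<pi>0_def by (metis GL_homD(1,2)[OF \<Psi>] GL_homD(2)[OF inv])
      show "\<pi>0 (fscale a y) = fscale a (\<pi>0 y)" if "y \<in> X" for a y
        using that unfolding \<pi>0_def by (metis GL_homD(1,3)[OF \<Psi>] GL_homD(3)[OF inv])
      show "\<pi>0 (act g y) = act g (\<pi>0 y)" if "g \<in> GL scale" "y \<in> X" for g y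
        using that unfolding \<pi>0_def by (metis GL_homD(1,4)[OF \<Psi>] GL_homD(4)[OF inv])
    qed
    show "\<pi>0 (\<pi>0 y) = \<pi>0 y" if "y \<in> X" for y using \<pi>0(1)[OF that] \<pi>0c by blast
    have "\<pi>0 ` X = Xc" using \<pi>0(1) \<pi>0c XcX by (auto simp: image_iff) (metis subsetD)
    then show "GL_isomorphic scale (\<pi>0 ` X) W"
      unfolding GL_isomorphic_def using \<Psi>c bij by auto
  qed
  obtain u v where uv: "u \<in> Xc" "v \<in> X" "x = u + (swap_sum d v - fscale c v)"
    using dec[OF x] by (auto simp: Xc_def)
  have "component scale X W x = u"
    unfolding component_def
    by (rule the_equality) (use proj[OF _ uv(1,2)] proj0 uv(3) in metis)+
  moreover have "\<pi>0 x = u" using proj[OF proj0 uv(1,2)] uv(3) by simp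
  ultimately show ?thesis
    using \<pi>0[OF x] inj unfolding Xc_def
    by (metis (mono_tags, lifting) GL_homD(3)[OF \<Psi> x, of 0] fs.scale_zero_left mem_Collect_eq x
        \<Psi>diff diff_self)
qed

end

section \<open>The square of an exterior power\<close>

lemma covectors_append:
  "\<gamma>s @ \<beta>s \<in> covectors scale (m + n) \<longleftrightarrow> \<beta>s \<in> covectors scale n" if "\<gamma>s \<in> covectors scale m"
  using that by (auto simp: covectors_def)

lemma tensor_power_section_right:
  assumes t: "t \<in> tensor_power scale (m + n)" and \<gamma>: "\<gamma>s \<in> covectors scale m"
  shows "(\<lambda>\<beta>s. t (\<gamma>s @ \<beta>s)) \<in> tensor_power scale n"
  unfolding tensor_power_def
proof (intro CollectI conjI allI ballI impI)
  fix \<beta>s assume "\<beta>s \<notin> covectors scale n"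
  then show "t (\<gamma>s @ \<beta>s) = 0"
    using tensor_power_outside[OF t] covectors_append[OF \<gamma>] by blast
next
  fix \<alpha>s i \<beta> \<delta> c assume *: "\<alpha>s \<in> covectors scale n" "i < n" "\<beta> \<in> dual scale" "\<delta> \<in> dual scale"
  have len: "length \<gamma>s = m" using \<gamma> by (simp add: covectors_def)
  have upd: "\<gamma>s @ \<alpha>s[i := y] = (\<gamma>s @ \<alpha>s)[m + i := y]" for y
    using len by (simp add: list_update_append)
  show "t (\<gamma>s @ \<alpha>s[i := \<beta> + \<delta>]) = t (\<gamma>s @ \<alpha>s[i := \<beta>]) + t (\<gamma>s @ \<alpha>s[i := \<delta>])"
    "t (\<gamma>s @ \<alpha>s[i := fscale c \<beta>]) = c * t (\<gamma>s @ \<alpha>s[i := \<beta>])"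
    unfolding upd using * covectors_append[OF \<gamma>, of \<alpha>s n]
    by (simp_all add: tensor_power_add[OF t] tensor_power_scale[OF t])
qed

lemma tensor_power_section_left:
  assumes t: "t \<in> tensor_power scale (m + n)" and \<beta>: "\<beta>s \<in> covectors scale n"
  shows "(\<lambda>\<gamma>s. t (\<gamma>s @ \<beta>s)) \<in> tensor_power scale m"
  unfolding tensor_power_def
proof (intro CollectI conjI allI ballI impI)
  fix \<gamma>s assume "\<gamma>s \<notin> covectors scale m"
  then have "\<gamma>s @ \<beta>s \<notin> covectors scale (m + n)" using \<beta> by (auto simp: covectors_def)
  then show "t (\<gamma>s @ \<beta>s) = 0" by (rule tensor_power_outside[OF t])
next
  fix \<alpha>s i \<gamma> \<delta> c assume *: "\<alpha>s \<in> covectors scale m" "i < m" "\<gamma> \<in> dual scale" "\<delta> \<in> dual scale"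
  have len: "length \<alpha>s = m" using * by (simp add: covectors_def)
  have upd: "\<alpha>s[i := y] @ \<beta>s = (\<alpha>s @ \<beta>s)[i := y]" for y
    using len *(2) by (simp add: list_update_append)
  show "t (\<alpha>s[i := \<gamma> + \<delta>] @ \<beta>s) = t (\<alpha>s[i := \<gamma>] @ \<beta>s) + t (\<alpha>s[i := \<delta>] @ \<beta>s)"
    "t (\<alpha>s[i := fscale c \<gamma>] @ \<beta>s) = c * t (\<alpha>s[i := \<gamma>] @ \<beta>s)"
    unfolding upd using * covectors_append[OF *(1), of \<beta>s n] \<beta>
    by (simp_all add: tensor_power_add[OF t] tensor_power_scale[OF t])
qed

definition words :: "'a set \<Rightarrow> nat \<Rightarrow> 'a list set" where
  "words B n = {xs. set xs \<subseteq> B \<and> length xs = n}"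

lemma finite_words: "finite B \<Longrightarrow> finite (words B n)"
  by (simp add: words_def finite_lists_length_eq)

lemma sum_words_Suc: "(\<Sum>xs\<in>words B (Suc n). f xs) = (\<Sum>b\<in>B. \<Sum>xs\<in>words B n. f (b # xs))"
  unfolding sum.cartesian_product
  by (rule sum.reindex_bij_witness[of _ "\<lambda>(b, xs). b # xs" "\<lambda>xs. (hd xs, tl xs)"])
    (auto simp: words_def length_Suc_conv)

lemma words_0: "words B 0 = {[]}"
  by (auto simp: words_def)

context tensor_space
begin

text \<open>Polarization gives one direction, the invertibility of 2 the other.\<close>

lemma ext_power_iff_alternating:
  "P \<in> ext_power scale s \<longleftrightarrow> P \<in> tensor_power scale s \<and> alternating s {..<s} P"
proof
  assume P: "P \<in> ext_power scale s"
  then have t: "P \<in> tensor_power scale s" by (simp add: ext_power_def)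
  have "swap_op s i j P = - P" if ij: "i < s" "j < s" "i \<noteq> j" for i j
  proof
    fix \<alpha>s
    show "swap_op s i j P \<alpha>s = (- P) \<alpha>s"
    proof (cases "\<alpha>s \<in> covectors scale s")
      case False
      then show ?thesis
        using tensor_power_outside[OF t] tensor_power_outside[OF swap_op_tensor_power[OF ij(1,2) t]]
        by simp
    next
      case \<alpha>s: True
      then have len: "length \<alpha>s = s" by (simp add: covectors_def)
      have "P (\<alpha>s[i := a, j := a]) = 0" if "a \<in> dual scale" for a
      proof -
        have "\<alpha>s[i := a, j := a] \<in> covectors scale s" "\<alpha>s[i := a, j := a] ! i = \<alpha>s[i := a, j := a] ! j"
          using \<alpha>s that ij len by (simp_all add: covectors_update nth_list_update)
        then show ?thesis using P ij unfolding ext_power_def by blast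
      qed
      then show ?thesis using swap_op_polarization[OF vector_space_axioms t \<alpha>s ij] by simp
    qed
  qed
  then show "P \<in> tensor_power scale s \<and> alternating s {..<s} P"
    using t by (simp add: alternating_def)
next
  assume P: "P \<in> tensor_power scale s \<and> alternating s {..<s} P"
  then have "P \<alpha>s = 0" if "\<alpha>s \<in> covectors scale s" "i < s" "j < s" "i \<noteq> j" "\<alpha>s ! i = \<alpha>s ! j" for \<alpha>s i j
    using that by (intro alternating_eq_0[of s "{..<s}" P i j]) (simp_all add: covectors_def)
  then show "P \<in> ext_power scale s"
    using P by (simp add: ext_power_def)
qed

lemma multilinear_expand:
  assumes "t \<in> tensor_power scale n" "\<alpha>s \<in> covectors scale n"
  shows "t \<alpha>s = (\<Sum>I\<in>words Basis n. (\<Prod>i<n. (\<alpha>s ! i) (I ! i)) * t (map coord I))"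
  using assms
proof (induction n arbitrary: t \<alpha>s)
  case 0
  then show ?case by (simp add: words_0 covectors_def)
next
  case (Suc n)
  obtain \<alpha> \<beta>s where \<alpha>s: "\<alpha>s = \<alpha> # \<beta>s" using Suc.prems(2) by (cases \<alpha>s) (auto simp: covectors_def)
  have \<alpha>: "\<alpha> \<in> dual scale" and \<beta>s: "\<beta>s \<in> covectors scale n"
    using Suc.prems(2) by (auto simp: \<alpha>s covectors_def)
  have sec: "(\<lambda>\<beta>s. t (coord b # \<beta>s)) \<in> tensor_power scale n" for b
    using tensor_power_section_right[of t scale 1 n "[coord b]"] Suc.prems(1) coord_dual
    by (simp add: covectors_def)
  have "t \<alpha>s = (\<Sum>b\<in>Basis. \<alpha> b * t (coord b # \<beta>s))"
    using tensor_power_expand[OF Suc.prems zero_less_Suc \<alpha>] by (simp add: \<alpha>s)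
  also have "\<dots> = (\<Sum>b\<in>Basis. \<alpha> b * (\<Sum>I\<in>words Basis n. (\<Prod>i<n. (\<beta>s ! i) (I ! i)) * t (coord b # map coord I)))"
    using Suc.IH[OF sec \<beta>s] by simp
  also have "\<dots> = (\<Sum>I\<in>words Basis (Suc n). (\<Prod>i<Suc n. (\<alpha>s ! i) (I ! i)) * t (map coord I))"
    by (simp add: sum_words_Suc prod.lessThan_Suc_shift \<alpha>s sum_distrib_left mult.assoc
        del: prod.lessThan_Suc)
  finally show ?case .
qed

text \<open>Supplies the finite spanning set for the dimension count in
  \<open>component_eq_0_iff\<close>.\<close>

lemma tensor_power_finite_span: "\<exists>S. finite S \<and> tensor_power scale n \<subseteq> fs.span S"
proof -
  define m where "m I = (\<lambda>\<alpha>s. if \<alpha>s \<in> covectors scale n then \<Prod>i<n. (\<alpha>s ! i) (I ! i) else 0)" for I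
  have "t \<in> fs.span (m ` words Basis n)" if t: "t \<in> tensor_power scale n" for t
  proof -
    have "t = (\<Sum>I\<in>words Basis n. fscale (t (map coord I)) (m I))"
    proof
      fix \<alpha>s show "t \<alpha>s = (\<Sum>I\<in>words Basis n. fscale (t (map coord I)) (m I)) \<alpha>s"
        using multilinear_expand[OF t, of \<alpha>s] tensor_power_outside[OF t, of \<alpha>s]
        by (cases "\<alpha>s \<in> covectors scale n") (simp_all add: sum_fun_apply fscale_apply m_def mult.commute)
    qed
    also have "\<dots> \<in> fs.span (m ` words Basis n)"
      by (intro fs.span_sum fs.span_scale fs.span_base) blast
    finally show ?thesis .
  qed
  then show ?thesis using finite_words[OF finite_Basis] by (intro exI[of _ "m ` words Basis n"]) auto
qed

section \<open>Wedge products as alternating tensors\<close>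

lemma wedge_permute_list:
  assumes \<tau>: "\<tau> permutes {..<length ws}" and \<alpha>s: "\<alpha>s \<in> covectors scale (length ws)"
  shows "wedge scale ws (permute_list \<tau> \<alpha>s) = of_int (sign \<tau>) * wedge scale ws \<alpha>s"
proof -
  let ?n = "length ws"
  have len: "length \<alpha>s = ?n" using \<alpha>s by (simp add: covectors_def)
  have perm: "permutation \<sigma>" if "\<sigma> permutes {..<?n}" for \<sigma>
    using that permutes_imp_permutation[of "{..<?n}"] by blast
  have "wedge scale ws (permute_list \<tau> \<alpha>s) =
      (\<Sum>\<sigma> | \<sigma> permutes {..<?n}. of_int (sign \<sigma>) * (\<Prod>i<?n. (\<alpha>s ! \<tau> i) (ws ! \<sigma> i)))"
    using covectors_permute_list[OF \<tau> len] \<alpha>s \<tau> len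
    by (auto simp: wedge_def permute_list_nth intro!: sum.cong prod.cong)
  also have "\<dots> = (\<Sum>\<sigma> | \<sigma> permutes {..<?n}. of_int (sign (\<sigma> \<circ> \<tau>)) * (\<Prod>i<?n. (\<alpha>s ! \<tau> i) (ws ! \<sigma> (\<tau> i))))"
    by (subst sum_permutations_compose_right[OF \<tau>]) simp
  also have "\<dots> = (\<Sum>\<sigma> | \<sigma> permutes {..<?n}. of_int (sign \<tau>) * (of_int (sign \<sigma>) * (\<Prod>i<?n. (\<alpha>s ! i) (ws ! \<sigma> i))))"
  proof (intro sum.cong refl)
    fix \<sigma> assume "\<sigma> \<in> {\<sigma>. \<sigma> permutes {..<?n}}"
    then have "sign (\<sigma> \<circ> \<tau>) = sign \<sigma> * sign \<tau>"
      using perm \<tau> by (simp add: sign_compose)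
    moreover have "(\<Prod>i<?n. (\<alpha>s ! \<tau> i) (ws ! \<sigma> (\<tau> i))) = (\<Prod>i<?n. (\<alpha>s ! i) (ws ! \<sigma> i))"
      using prod.permute[OF \<tau>, of "\<lambda>i. (\<alpha>s ! i) (ws ! \<sigma> i)"] by (simp add: o_def)
    ultimately show "of_int (sign (\<sigma> \<circ> \<tau>)) * (\<Prod>i<?n. (\<alpha>s ! \<tau> i) (ws ! \<sigma> (\<tau> i))) =
        of_int (sign \<tau>) * (of_int (sign \<sigma>) * (\<Prod>i<?n. (\<alpha>s ! i) (ws ! \<sigma> i)))"
      by (simp add: mult_ac)
  qed
  finally show ?thesis using \<alpha>s by (simp add: wedge_def sum_distrib_left)
qed

lemma wedge_tensor_power: "wedge scale ws \<in> tensor_power scale (length ws)"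
  unfolding tensor_power_def
proof (intro CollectI conjI allI ballI impI)
  let ?n = "length ws"
  show "wedge scale ws \<alpha>s = 0" if "\<alpha>s \<notin> covectors scale ?n" for \<alpha>s
    using that by (simp add: wedge_def)
  fix \<alpha>s i and \<beta> \<gamma> :: "'v \<Rightarrow> 'k" and c
  assume *: "\<alpha>s \<in> covectors scale ?n" "i < ?n" "\<beta> \<in> dual scale" "\<gamma> \<in> dual scale"
  have len: "length \<alpha>s = ?n" using * by (simp add: covectors_def)
  have split: "(\<Prod>k<?n. (\<alpha>s[i := \<delta>] ! k) (ws ! \<sigma> k)) =
      \<delta> (ws ! \<sigma> i) * (\<Prod>k\<in>{..<?n} - {i}. (\<alpha>s ! k) (ws ! \<sigma> k))" for \<delta> :: "'v \<Rightarrow> 'k" and \<sigma>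
    using *(2) len by (subst prod.remove[of _ i]) auto
  have w: "wedge scale ws (\<alpha>s[i := \<delta>]) = (\<Sum>\<sigma> | \<sigma> permutes {..<?n}. of_int (sign \<sigma>) *
      (\<delta> (ws ! \<sigma> i) * (\<Prod>k\<in>{..<?n} - {i}. (\<alpha>s ! k) (ws ! \<sigma> k))))" if "\<delta> \<in> dual scale" for \<delta>
    using covectors_update[OF *(1) that] by (simp add: wedge_def split)
  show "wedge scale ws (\<alpha>s[i := \<beta> + \<gamma>]) = wedge scale ws (\<alpha>s[i := \<beta>]) + wedge scale ws (\<alpha>s[i := \<gamma>])"
    using * dual_add[OF vector_space_axioms *(3,4)] by (simp add: w sum.distrib[symmetric] algebra_simps)
  show "wedge scale ws (\<alpha>s[i := fscale c \<beta>]) = c * wedge scale ws (\<alpha>s[i := \<beta>])"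
    using * fs.subspace_scale[OF subspace_dual[OF vector_space_axioms] *(3)]
    by (simp add: w sum_distrib_left fscale_apply mult_ac)
qed

lemma wedge_ext_power: "wedge scale ws \<in> ext_power scale (length ws)"
  unfolding ext_power_iff_alternating alternating_def
proof (intro conjI wedge_tensor_power ballI impI ext)
  fix i j \<alpha>s assume ij: "i \<in> {..<length ws}" "j \<in> {..<length ws}" "i \<noteq> j"
  show "swap_op (length ws) i j (wedge scale ws) \<alpha>s = (- wedge scale ws) \<alpha>s"
  proof (cases "\<alpha>s \<in> covectors scale (length ws)")
    case True
    then show ?thesis
      using wedge_permute_list[OF permutes_swap_id[OF ij(1,2)] True] ij
      by (simp add: perm_op_def covectors_def sign_swap_id)
  next
    case False
    then show ?thesis
      using tensor_power_outside[OF wedge_tensor_power False] ij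
        tensor_power_outside[OF swap_op_tensor_power[OF _ _ wedge_tensor_power] False]
      by simp
  qed
qed

text \<open>Expand \<open>u\<close> at every permutation of the tuple and collect the signs:
  antisymmetrizing the elementary tensor of a word gives its wedge product. The factor
  \<open>fact s\<close> counts the permutations.\<close>

lemma alternating_wedge_expand:
  assumes u: "u \<in> tensor_power scale s" "alternating s {..<s} u" and \<gamma>: "\<gamma>s \<in> covectors scale s"
  shows "of_nat (fact s) * u \<gamma>s = (\<Sum>I\<in>words Basis s. wedge scale I \<gamma>s * u (map coord I))"
proof -
  have len: "length \<gamma>s = s" using \<gamma> by (simp add: covectors_def)
  let ?S = "{\<sigma>. \<sigma> permutes {..<s}}"
  have "u \<gamma>s = of_int (sign \<sigma>) * u (permute_list \<sigma> \<gamma>s)" if "\<sigma> \<in> ?S" for \<sigma>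
  proof -
    have "perm_op s \<sigma> u = fscale (of_int (sign \<sigma>)) u"
      using perm_op_alternating[of \<sigma> "{..<s}" s u] that u degree_tensor_power by blast
    then have "perm_op s \<sigma> u \<gamma>s = of_int (sign \<sigma>) * u \<gamma>s" by (simp add: fscale_apply)
    then have "u (permute_list \<sigma> \<gamma>s) = of_int (sign \<sigma>) * u \<gamma>s" using len by (simp add: perm_op_def)
    then show ?thesis by (simp add: mult.assoc[symmetric] flip: of_int_mult)
  qed
  then have "(\<Sum>\<sigma>\<in>?S. u \<gamma>s) = (\<Sum>\<sigma>\<in>?S. of_int (sign \<sigma>) * u (permute_list \<sigma> \<gamma>s))"
    by (rule sum.cong[OF refl])
  moreover have "(\<Sum>\<sigma>\<in>?S. u \<gamma>s) = of_nat (fact s) * u \<gamma>s"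
    using card_permutations[of "{..<s}" s] by simp
  moreover have "u (permute_list \<sigma> \<gamma>s) =
      (\<Sum>I\<in>words Basis s. (\<Prod>i<s. (\<gamma>s ! \<sigma> i) (I ! i)) * u (map coord I))" if "\<sigma> \<in> ?S" for \<sigma>
    using multilinear_expand[OF u(1), of "permute_list \<sigma> \<gamma>s"] that \<gamma> len covectors_permute_list[of \<sigma> s \<gamma>s scale]
    by (simp add: permute_list_nth)
  ultimately have "of_nat (fact s) * u \<gamma>s = (\<Sum>\<sigma>\<in>?S. of_int (sign \<sigma>) *
      (\<Sum>I\<in>words Basis s. (\<Prod>i<s. (\<gamma>s ! \<sigma> i) (I ! i)) * u (map coord I)))"
    by simp
  also have "\<dots> = (\<Sum>I\<in>words Basis s. (\<Sum>\<sigma>\<in>?S. of_int (sign \<sigma>) * (\<Prod>i<s. (\<gamma>s ! \<sigma> i) (I ! i))) * u (map coord I))"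
    by (simp add: sum_distrib_left sum_distrib_right mult.assoc sum.swap[of _ ?S])
  also have "\<dots> = (\<Sum>I\<in>words Basis s. wedge scale I \<gamma>s * u (map coord I))"
  proof (intro sum.cong refl arg_cong2[of _ _ _ _ "(*)"])
    fix I assume "I \<in> words Basis s"
    then have I: "length I = s" by (simp add: words_def)
    have "wedge scale I \<gamma>s = (\<Sum>\<sigma>\<in>?S. of_int (sign \<sigma>) * (\<Prod>i<s. (\<gamma>s ! i) (I ! \<sigma> i)))"
      using \<gamma> by (simp add: wedge_def I)
    \<comment> \<open>\<open>wedge\<close> permutes the vectors, whereas the expansion permutes the
      covectors; inverting \<open>\<sigma>\<close> passes from one to the other.\<close>
    also have "\<dots> = (\<Sum>\<sigma>\<in>?S. of_int (sign (inv \<sigma>)) * (\<Prod>i<s. (\<gamma>s ! i) (I ! inv \<sigma> i)))"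
      by (rule sum_permutations_inverse)
    also have "\<dots> = (\<Sum>\<sigma>\<in>?S. of_int (sign \<sigma>) * (\<Prod>i<s. (\<gamma>s ! \<sigma> i) (I ! i)))"
    proof (intro sum.cong refl)
      fix \<sigma> assume "\<sigma> \<in> ?S"
      then have \<sigma>: "\<sigma> permutes {..<s}" by simp
      have "sign (inv \<sigma>) = sign \<sigma>"
        using permutes_imp_permutation[OF _ \<sigma>] by (simp add: sign_inverse)
      moreover have "(\<Prod>i<s. (\<gamma>s ! i) (I ! inv \<sigma> i)) = (\<Prod>i<s. (\<gamma>s ! \<sigma> i) (I ! i))"
        using prod.permute[OF \<sigma>, of "\<lambda>i. (\<gamma>s ! i) (I ! inv \<sigma> i)"] permutes_inverses[OF \<sigma>]
        by (simp add: o_def)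
      ultimately show "of_int (sign (inv \<sigma>)) * (\<Prod>i<s. (\<gamma>s ! i) (I ! inv \<sigma> i)) =
          of_int (sign \<sigma>) * (\<Prod>i<s. (\<gamma>s ! \<sigma> i) (I ! i))" by simp
    qed
    finally show "(\<Sum>\<sigma>\<in>?S. of_int (sign \<sigma>) * (\<Prod>i<s. (\<gamma>s ! \<sigma> i) (I ! i))) = wedge scale I \<gamma>s" ..
  qed
  finally show ?thesis .
qed

section \<open>Tensor products of two alternating tensors\<close>

lemma covectors_take_drop:
  "\<alpha>s \<in> covectors scale (m + n) \<longleftrightarrow> take m \<alpha>s \<in> covectors scale m \<and> drop m \<alpha>s \<in> covectors scale n"
  if "n > 0"
proof -
  have "set \<alpha>s = set (take m \<alpha>s) \<union> set (drop m \<alpha>s)" by (metis append_take_drop_id set_append)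
  then show ?thesis using that by (auto simp: covectors_def)
qed

lemma tensor_prod_bialternating:
  assumes P: "P \<in> ext_power scale s" and Q: "Q \<in> ext_power scale s" and s: "s > 0"
  shows "tensor_prod s P Q \<in> bialternating scale (s + s) {..<s} {s..<s + s}"
proof -
  have tP: "P \<in> tensor_power scale s" "alternating s {..<s} P"
    and tQ: "Q \<in> tensor_power scale s" "alternating s {..<s} Q"
    using P Q by (simp_all add: ext_power_iff_alternating)
  note cov = covectors_take_drop[OF s, of _ s]
  have "tensor_prod s P Q \<in> tensor_power scale (s + s)"
    unfolding tensor_power_def
  proof (intro CollectI conjI allI ballI impI)
    show "tensor_prod s P Q \<alpha>s = 0" if "\<alpha>s \<notin> covectors scale (s + s)" for \<alpha>s
      using that tensor_power_outside[OF tP(1)] tensor_power_outside[OF tQ(1)] cov[of \<alpha>s]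
      by (auto simp: tensor_prod_def)
    fix \<alpha>s i \<beta> \<gamma> c
    assume *: "\<alpha>s \<in> covectors scale (s + s)" "i < s + s" "\<beta> \<in> dual scale" "\<gamma> \<in> dual scale"
    have len: "length \<alpha>s = s + s" using * by (simp add: covectors_def)
    have c: "take s \<alpha>s \<in> covectors scale s" "drop s \<alpha>s \<in> covectors scale s" using * cov by auto
    have "tensor_prod s P Q (\<alpha>s[i := \<beta> + \<gamma>]) =
          tensor_prod s P Q (\<alpha>s[i := \<beta>]) + tensor_prod s P Q (\<alpha>s[i := \<gamma>]) \<and>
        tensor_prod s P Q (\<alpha>s[i := fscale c \<beta>]) = c * tensor_prod s P Q (\<alpha>s[i := \<beta>])"
    proof (cases "i < s")
      case True
      have "tensor_prod s P Q (\<alpha>s[i := y]) = P ((take s \<alpha>s)[i := y]) * Q (drop s \<alpha>s)" for y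
        using True by (simp add: tensor_prod_def take_update_swap)
      then show ?thesis
        using tensor_power_add[OF tP(1) c(1) True *(3,4)] tensor_power_scale[OF tP(1) c(1) True *(3)]
        by (simp add: algebra_simps del: plus_fun_apply)
    next
      case False
      then have i: "i - s < s" using *(2) by simp
      have "tensor_prod s P Q (\<alpha>s[i := y]) = P (take s \<alpha>s) * Q ((drop s \<alpha>s)[i - s := y])" for y
        using False by (simp add: tensor_prod_def drop_update_swap)
      then show ?thesis
        using tensor_power_add[OF tQ(1) c(2) i *(3,4)] tensor_power_scale[OF tQ(1) c(2) i *(3)]
        by (simp add: algebra_simps del: plus_fun_apply)
    qed
    then show "tensor_prod s P Q (\<alpha>s[i := \<beta> + \<gamma>]) =
        tensor_prod s P Q (\<alpha>s[i := \<beta>]) + tensor_prod s P Q (\<alpha>s[i := \<gamma>])"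
      "tensor_prod s P Q (\<alpha>s[i := fscale c \<beta>]) = c * tensor_prod s P Q (\<alpha>s[i := \<beta>])"
      by blast+
  qed
  moreover have "alternating (s + s) {..<s} (tensor_prod s P Q)"
    unfolding alternating_def
  proof (intro ballI impI ext)
    fix i j \<alpha>s assume ij: "i \<in> {..<s}" "j \<in> {..<s}" "i \<noteq> j"
    show "swap_op (s + s) i j (tensor_prod s P Q) \<alpha>s = (- tensor_prod s P Q) \<alpha>s"
    proof (cases "length \<alpha>s = s + s")
      case True
      have "P (permute_list (transpose i j) (take s \<alpha>s)) = - P (take s \<alpha>s)"
      proof -
        have "swap_op s i j P (take s \<alpha>s) = - P (take s \<alpha>s)"
          using tP(2) ij by (simp add: alternating_def)
        then show ?thesis using True by (simp add: perm_op_def)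
      qed
      then show ?thesis
        using True ij
        by (simp add: perm_op_def tensor_prod_def permute_list_transpose take_update_swap)
    qed (use tensor_power_outside[OF tQ(1)] in \<open>auto simp: perm_op_def tensor_prod_def covectors_def\<close>)
  qed
  moreover have "alternating (s + s) {s..<s + s} (tensor_prod s P Q)"
    unfolding alternating_def
  proof (intro ballI impI ext)
    fix i j \<alpha>s assume ij: "i \<in> {s..<s + s}" "j \<in> {s..<s + s}" "i \<noteq> j"
    show "swap_op (s + s) i j (tensor_prod s P Q) \<alpha>s = (- tensor_prod s P Q) \<alpha>s"
    proof (cases "length \<alpha>s = s + s")
      case True
      have "i - s < s" "j - s < s" "i - s \<noteq> j - s" using ij by auto
      have "Q (permute_list (transpose (i - s) (j - s)) (drop s \<alpha>s)) = - Q (drop s \<alpha>s)"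
      proof -
        have "swap_op s (i - s) (j - s) Q (drop s \<alpha>s) = - Q (drop s \<alpha>s)"
          using tQ(2) \<open>i - s < s\<close> \<open>j - s < s\<close> \<open>i - s \<noteq> j - s\<close> by (simp add: alternating_def)
        then show ?thesis using True by (simp add: perm_op_def)
      qed
      moreover have "permute_list (transpose (i - s) (j - s)) (drop s \<alpha>s) =
          (drop s \<alpha>s)[i - s := \<alpha>s ! j, j - s := \<alpha>s ! i]"
        using True ij by (subst permute_list_transpose) auto
      ultimately show ?thesis
        using True ij
        by (simp add: perm_op_def tensor_prod_def permute_list_transpose drop_update_swap)
    qed (use tensor_power_outside[OF tQ(1)] in \<open>auto simp: perm_op_def tensor_prod_def covectors_def\<close>)
  qed
  ultimately show ?thesis by (simp add: bialternating_def)
qed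

text \<open>For the nontrivial inclusion freeze the second half of the arguments and expand the
  first half by \<open>alternating_wedge_expand\<close>. The coefficient of each wedge product is
  the alternating tensor \<open>Q I\<close> in the second half.\<close>

lemma ext_square_eq:
  assumes s: "s > 0"
  shows "ext_square scale s = bialternating scale (s + s) {..<s} {s..<s + s}"
proof
  show "ext_square scale s \<subseteq> bialternating scale (s + s) {..<s} {s..<s + s}"
    unfolding ext_square_def
    by (rule fs.span_minimal[OF _ subspace_bialternating]) (use tensor_prod_bialternating s in blast)
  show "bialternating scale (s + s) {..<s} {s..<s + s} \<subseteq> ext_square scale s"
  proof
    fix t :: "('k, 'v) tensor" assume t: "t \<in> bialternating scale (s + s) {..<s} {s..<s + s}"
    then have tp: "t \<in> tensor_power scale (s + s)" and
      alt: "alternating (s + s) {..<s} t" "alternating (s + s) {s..<s + s} t"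
      by (auto simp: bialternating_def)
    note cov = covectors_take_drop[OF s, of _ s]
    define Q where "Q I = (\<lambda>\<beta>s. t (map coord I @ \<beta>s))" for I
    have I_cov: "map coord I \<in> covectors scale s" if "I \<in> words Basis s" for I
      using that coord_dual by (auto simp: words_def covectors_def)
    have Q: "Q I \<in> ext_power scale s" if I: "I \<in> words Basis s" for I
      unfolding ext_power_iff_alternating
    proof
      show "Q I \<in> tensor_power scale s"
        unfolding Q_def by (rule tensor_power_section_right[OF tp I_cov[OF I]])
      have lenI: "length I = s" using I by (simp add: words_def)
      show "alternating s {..<s} (Q I)"
        unfolding alternating_def
      proof (intro ballI impI ext)
        fix i j \<beta>s assume ij: "i \<in> {..<s}" "j \<in> {..<s}" "i \<noteq> j"
        show "swap_op s i j (Q I) \<beta>s = (- Q I) \<beta>s"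
        proof (cases "length \<beta>s = s")
          case True
          have "swap_op (s + s) (s + i) (s + j) t (map coord I @ \<beta>s) = - t (map coord I @ \<beta>s)"
            using alt(2) ij by (simp add: alternating_def)
          then show ?thesis
            using ij lenI True
            by (simp add: perm_op_def Q_def permute_list_transpose list_update_append nth_append)
        next
          case False
          then show ?thesis
            using lenI tensor_power_outside[OF tp, of "map coord I @ \<beta>s"]
            by (simp add: perm_op_def Q_def covectors_def)
        qed
      qed
    qed
    have "fscale (of_nat (fact s)) t = (\<Sum>I\<in>words Basis s. tensor_prod s (wedge scale I) (Q I))"
    proof
      fix \<alpha>s
      show "fscale (of_nat (fact s)) t \<alpha>s = (\<Sum>I\<in>words Basis s. tensor_prod s (wedge scale I) (Q I)) \<alpha>s"
      proof (cases "\<alpha>s \<in> covectors scale (s + s)")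
        case True
        then have c: "take s \<alpha>s \<in> covectors scale s" "drop s \<alpha>s \<in> covectors scale s" using cov by auto
        have "alternating s {..<s} (\<lambda>\<gamma>s. t (\<gamma>s @ drop s \<alpha>s))"
          unfolding alternating_def
        proof (intro ballI impI ext)
          fix i j \<gamma>s assume ij: "i \<in> {..<s}" "j \<in> {..<s}" "i \<noteq> j"
          show "swap_op s i j (\<lambda>\<gamma>s. t (\<gamma>s @ drop s \<alpha>s)) \<gamma>s = (- (\<lambda>\<gamma>s. t (\<gamma>s @ drop s \<alpha>s))) \<gamma>s"
          proof (cases "length \<gamma>s = s")
            case len: True
            have "swap_op (s + s) i j t (\<gamma>s @ drop s \<alpha>s) = - t (\<gamma>s @ drop s \<alpha>s)"
              using alt(1) ij by (simp add: alternating_def)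
            then show ?thesis
              using ij len True
              by (simp add: perm_op_def permute_list_transpose list_update_append nth_append covectors_def)
          next
            case False
            then have "\<gamma>s @ drop s \<alpha>s \<notin> covectors scale (s + s)" using True by (auto simp: covectors_def)
            then show ?thesis using False tensor_power_outside[OF tp] by (simp add: perm_op_def)
          qed
        qed
        from alternating_wedge_expand[OF tensor_power_section_left[OF tp c(2)] this c(1)]
        show ?thesis by (simp add: fscale_apply sum_fun_apply tensor_prod_def Q_def)
      next
        case False
        have "tensor_prod s (wedge scale I) (Q I) \<alpha>s = 0" if I: "I \<in> words Basis s" for I
          using tensor_power_outside[OF _ False] tensor_prod_bialternating[OF _ Q[OF I] s]
            wedge_ext_power[of I] I
          by (auto simp: words_def bialternating_def)
        then show ?thesis using tensor_power_outside[OF tp False] by (simp add: fscale_apply sum_fun_apply)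
      qed
    qed
    then have "t = fscale (1 / of_nat (fact s)) (\<Sum>I\<in>words Basis s. tensor_prod s (wedge scale I) (Q I))"
      by (metis fact_nonzero fs.scale_one fs.scale_scale nonzero_eq_divide_eq of_nat_eq_0_iff)
    also have "\<dots> \<in> ext_square scale s"
      unfolding ext_square_def
    proof (intro fs.span_scale fs.span_sum fs.span_base)
      fix I assume I: "I \<in> words Basis s"
      then have "wedge scale I \<in> ext_power scale s" using wedge_ext_power[of I] by (simp add: words_def)
      then show "tensor_prod s (wedge scale I) (Q I) \<in>
          {tensor_prod s P Q |P Q. P \<in> ext_power scale s \<and> Q \<in> ext_power scale s}"
        using Q[OF I] by blast
    qed
    finally show "t \<in> ext_square scale s" .
  qed
qed

end

section \<open>The component as an explicit tensor\<close>

text \<open>Each move takes the first place of the current second column, so the columns remain an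
  initial and a final segment.\<close>

definition two_shift :: "nat \<Rightarrow> ('k::field, 'v) tensor \<Rightarrow> ('k, 'v) tensor" where
  "two_shift s t = shift_op (s + s) {..<Suc s} (Suc s) (shift_op (s + s) {..<s} s t)"

lemma row_op_two_shift_linear:
  "row_op p q (two_shift s (t + u)) = row_op p q (two_shift s t) + row_op p q (two_shift s u)"
  "row_op p q (two_shift s (t - u)) = row_op p q (two_shift s t) - row_op p q (two_shift s u)"
  "row_op p q (two_shift s (fscale c t)) = fscale c (row_op p q (two_shift s t))"
  by (simp_all only: two_shift_def shift_op_linear row_op_linear)

lemma row_op_tensor_power:
  assumes "t \<in> tensor_power scale (p + q)"
  shows "row_op p q t \<in> tensor_power scale (p + q)"
  unfolding row_op_def using assms
  by (intro fs.subspace_sum[OF subspace_tensor_power] perm_op_tensor_power) (auto simp: row_group_def)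

lemma row_op_image_swap_sum:
  assumes "q \<le> p" and t: "t \<in> bialternating scale (p + q) {..<p} {p..<p + q}"
  shows "row_op p q (swap_sum (p + q) t - fscale (content p q) t) = 0"
  using row_op_eigentensor[OF assms] swap_sum_row_op[of p q t]
  by (simp add: row_op_linear)

context tensor_space
begin

text \<open>The projection lemma is applied to \<open>row_op\<close> after two moves. On the
  eigenspace of \<open>content p q\<close> each move is undone, up to a nonzero scalar, by the move
  back, and \<open>row_op\<close> is injective there.\<close>

lemma component_ext_square_eq_0_iff:
  assumes s: "2 \<le> s" and x: "x \<in> ext_square scale s"
  shows "component scale (ext_square scale s) (Y scale (s + 2) (int s - 2)) x = 0 \<longleftrightarrow>
    row_op (s + 2) (s - 2) (two_shift s x) = 0"
proof -
  define q where "q = s - 2"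
  define p where "p = s + 2"
  define d where "d = p + q"
  have d: "d = s + s" "s + s = p + q" "q \<le> p" "d > 0" using s by (auto simp: d_def p_def q_def)
  let ?c = "content p q :: 'k"
  let ?e = "content s s :: 'k" and ?f = "content (Suc s) (Suc q) :: 'k"
  let ?L = "bialternating scale d {..<s} {s..<d}"
  let ?M = "bialternating scale d {..<Suc s} {Suc s..<d}"
  let ?N = "bialternating scale d {..<p} {p..<d}"
  define E1 :: "('k, 'v) tensor \<Rightarrow> _" where "E1 = shift_op d {..<s} s"
  define F1 :: "('k, 'v) tensor \<Rightarrow> _" where "F1 = shift_op d {Suc s..<d} s"
  define E2 :: "('k, 'v) tensor \<Rightarrow> _" where "E2 = shift_op d {..<Suc s} (Suc s)"
  define F2 :: "('k, 'v) tensor \<Rightarrow> _" where "F2 = shift_op d {p..<d} (Suc s)"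
  have sets: "insert s {..<s} = {..<Suc s}" "insert s {Suc s..<d} = {s..<d}"
    "insert (Suc s) {..<Suc s} = {..<p}" "insert (Suc s) {p..<d} = {Suc s..<d}"
    using d s by (auto simp: p_def)
  have cards: "card {..<s} = s" "card {Suc s..<d} + 1 = s" "card {..<Suc s} = Suc s" "card {p..<d} + 1 = Suc q"
    using d(1) s by (simp_all add: p_def q_def)
  have cols: "columns d {..<s} {s..<d}" "columns d {..<Suc s} {Suc s..<d}" "columns d {..<p} {p..<d}"
    using d(1) s by (auto simp: columns_def p_def)
  have E1M: "E1 t \<in> ?M" if "t \<in> ?L" for t
    unfolding E1_def
    by (rule shift_op_bialternating[of "{..<s}" d "{Suc s..<d}" "s" t scale, unfolded sets])
      (use d(1) s that in \<open>auto simp: p_def bialternating_commute\<close>)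
  have F1M: "F1 t \<in> ?L" if "t \<in> ?M" for t
    unfolding F1_def
    by (rule shift_op_bialternating[of "{Suc s..<d}" d "{..<s}" "s" t scale, unfolded sets, unfolded bialternating_commute[of scale d "{s..<d}"]])
      (use d(1) s that in \<open>auto simp: p_def bialternating_commute\<close>)
  have E2M: "E2 t \<in> ?N" if "t \<in> ?M" for t
    unfolding E2_def
    by (rule shift_op_bialternating[of "{..<Suc s}" d "{p..<d}" "Suc s" t scale, unfolded sets])
      (use d(1) s that in \<open>auto simp: p_def bialternating_commute\<close>)
  have F2M: "F2 t \<in> ?M" if "t \<in> ?N" for t
    unfolding F2_def
    by (rule shift_op_bialternating[of "{p..<d}" d "{..<Suc s}" "Suc s" t scale, unfolded sets, unfolded bialternating_commute[of scale d "{Suc s..<d}"]])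
      (use d(1) s that in \<open>auto simp: p_def bialternating_commute\<close>)
  have FE1: "fscale 2 (F1 (E1 t)) = fscale ?e t - swap_sum d t" if "t \<in> ?L" for t
    unfolding F1_def E1_def
    by (rule shift_op_shift_op_columns[of d "{..<s}" s "{Suc s..<d}" t scale, unfolded sets cards])
      (use cols that in auto)
  have EF1: "fscale 2 (E1 (F1 t)) = fscale ?e t - swap_sum d t" if "t \<in> ?M" for t
    unfolding F1_def E1_def
    by (rule shift_op_shift_op_columns'[of d "{..<s}" s "{Suc s..<d}" t scale, unfolded sets cards])
      (use cols that in auto)
  have FE2: "fscale 2 (F2 (E2 t)) = fscale ?f t - swap_sum d t" if "t \<in> ?M" for t
    unfolding F2_def E2_def
    by (rule shift_op_shift_op_columns[of d "{..<Suc s}" "Suc s" "{p..<d}" t scale, unfolded sets cards])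
      (use cols that in \<open>auto simp: p_def\<close>)
  have EF2: "fscale 2 (E2 (F2 t)) = fscale ?f t - swap_sum d t" if "t \<in> ?N" for t
    unfolding F2_def E2_def
    by (rule shift_op_shift_op_columns'[of d "{..<Suc s}" "Suc s" "{p..<d}" t scale, unfolded sets cards])
      (use cols that in \<open>auto simp: p_def\<close>)
  have T: "swap_sum d (E1 t) = E1 (swap_sum d t)" "swap_sum d (F1 t) = F1 (swap_sum d t)"
    "swap_sum d (E2 t) = E2 (swap_sum d t)" "swap_sum d (F2 t) = F2 (swap_sum d t)" for t
    unfolding E1_def F1_def E2_def F2_def using d(1) s
    by (auto intro!: swap_sum_shift_op simp: p_def)
  have scale: "E1 (fscale a t) = fscale a (E1 t)" "F1 (fscale a t) = fscale a (F1 t)"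
    "E2 (fscale a t) = fscale a (E2 t)" "F2 (fscale a t) = fscale a (F2 t)" for a t
    by (simp_all only: E1_def F1_def E2_def F2_def shift_op_linear)
  have zero: "F1 0 = 0" "F2 0 = 0"
    by (simp_all only: F1_def F2_def shift_op_linear)
  \<comment> \<open>The two shapes passed on the way, with columns \<open>s\<close>,
    \<open>s\<close> and \<open>s + 1\<close>, \<open>s - 1\<close>, have shorter first columns than
    the target shape.\<close>
  have ne: "?e - ?c \<noteq> 0" "?f - ?c \<noteq> 0"
  proof -
    have "?c \<noteq> ?e"
      by (rule content_neq[OF d(2)]) (simp_all add: p_def)
    moreover have "?c \<noteq> ?f"
    proof (rule content_neq)
      show "Suc s + Suc q = p + q" "Suc s < p" by (simp_all add: p_def)
      show "Suc q \<le> Suc s" using s by (simp add: q_def)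
    qed
    ultimately show "?e - ?c \<noteq> 0" "?f - ?c \<noteq> 0" by simp_all
  qed
  have X: "ext_square scale s = ?L"
    using ext_square_eq[of s] s d by simp
  define W where "W = Y scale (s + 2) (int s - 2)"
  have "int s - 2 = int q" using s by (simp add: q_def)
  then have W: "W = row_op p q ` ?N"
    unfolding W_def using Y_eq_row_op[of scale p q] by (simp add: d_def p_def)
  define \<Psi> :: "('k, 'v) tensor \<Rightarrow> _" where "\<Psi> t = row_op p q (two_shift s t)" for t
  have \<Psi>_E: "\<Psi> t = row_op p q (E2 (E1 t))" for t
    by (simp only: \<Psi>_def two_shift_def E1_def E2_def d(1))
  obtain S where S: "finite S" "tensor_power scale d \<subseteq> fs.span S"
    using tensor_power_finite_span by blast
  have M0t: "?L \<subseteq> tensor_power scale d" by (auto simp: bialternating_def)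
  have stable: "gl_stable scale ?L"
    by (rule gl_stable_bialternating) (use d in auto)
  have "component scale ?L W x = 0 \<longleftrightarrow> \<Psi> x = 0"
  proof (rule component_eq_0_iff[where d = d and c = ?c and S = S])
    show "gl_stable scale ?L" "?L \<subseteq> tensor_power scale d" "d > 0" "finite S" by fact+
    show "?L \<subseteq> fs.span S" using M0t S(2) by blast
    show "W \<subseteq> tensor_power scale d"
      unfolding W d_def using row_op_tensor_power by (auto simp: bialternating_def)
    show "swap_sum d w = fscale ?c w" if "w \<in> W" for w
      using that row_op_eigentensor[OF d(3)] unfolding W d_def by auto
    show "\<Psi> \<in> GL_hom scale ?L W"
    proof (rule GL_homI)
      show "\<Psi> t \<in> W" if "t \<in> ?L" for t
        unfolding \<Psi>_E W using E1M E2M that by blast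
      show "\<Psi> (t + u) = \<Psi> t + \<Psi> u" for t u
        by (simp only: \<Psi>_def row_op_two_shift_linear)
      show "\<Psi> (fscale a t) = fscale a (\<Psi> t)" for a t
        by (simp only: \<Psi>_def row_op_two_shift_linear)
      show "\<Psi> (act g t) = act g (\<Psi> t)" for g t
        unfolding \<Psi>_E E1_def E2_def using d(1) s by (simp add: act_row_op act_shift_op)
    qed
    show "t = 0" if t: "t \<in> ?L" "swap_sum d t = fscale ?c t" and 0: "\<Psi> t = 0" for t
    proof -
      have eig: "swap_sum d (E1 t) = fscale ?c (E1 t)" "swap_sum d (E2 (E1 t)) = fscale ?c (E2 (E1 t))"
        by (simp_all only: T t(2) scale)
      have "E2 (E1 t) = 0"
        using row_op_inj[OF vector_space_axioms d(3), of "E2 (E1 t)"] E2M[OF E1M[OF t(1)]] eig(2) 0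
        unfolding \<Psi>_E d_def by blast
      then have "fscale (?f - ?c) (E1 t) = fscale 2 (F2 0)"
        using FE2[OF E1M[OF t(1)]] eig(1) by (simp only: fs.scale_left_diff_distrib)
      then have "E1 t = 0" using ne by (simp only: zero fs.scale_zero_right fs.scale_eq_0_iff simp_thms)
      then have "fscale (?e - ?c) t = fscale 2 (F1 0)"
        using FE1[OF t(1)] t(2) by (simp only: fs.scale_left_diff_distrib)
      then show "t = 0" using ne by (simp only: zero fs.scale_zero_right fs.scale_eq_0_iff simp_thms)
    qed
    show "\<exists>t\<in>?L. swap_sum d t = fscale ?c t \<and> \<Psi> t = w" if wW: "w \<in> W" for w
    proof -
      obtain m where m: "m \<in> ?N" "w = row_op p q m" using wW W by blast
      have "card {p..<d} \<le> card {..<p}" using d by (simp add: d_def)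
      then obtain u v where uv: "u \<in> ?N" "v \<in> ?N" "swap_sum d u = fscale ?c u"
        "m = u + (swap_sum d v - fscale ?c v)"
        using eigen_decomposition[OF cols(3) m(1) d_def[symmetric] d(3)] by blast
      \<comment> \<open>The values of \<open>row_op\<close> are eigentensors for \<open>?c\<close>,
        so it kills the image of \<open>swap_sum - ?c\<close>, and \<open>m\<close> may be replaced
        by its eigentensor \<open>u\<close>.\<close>
      have "w = row_op p q u + row_op p q (swap_sum d v - fscale ?c v)"
        by (simp only: m(2) uv(4) row_op_linear)
      also have "row_op p q (swap_sum d v - fscale ?c v) = 0"
        using row_op_image_swap_sum[OF d(3)] uv(2) unfolding d_def by blast
      finally have w: "w = row_op p q u" by (simp only: add_0_right)
      \<comment> \<open>On eigentensors for \<open>?c\<close>, twice \<open>E1\<close> after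
        \<open>F1\<close> is the scalar \<open>?e - ?c\<close>, and twice \<open>E2\<close> after
        \<open>F2\<close> is \<open>?f - ?c\<close>. This factor normalizes \<open>F1 (F2 u)\<close>
        to a preimage of \<open>u\<close>.\<close>
      let ?k = "4 / ((?e - ?c) * (?f - ?c))"
      define t where "t = fscale ?k (F1 (F2 u))"
      have tM: "t \<in> ?L"
        unfolding t_def by (intro fs.subspace_scale subspace_bialternating F1M F2M uv)
      have eig: "swap_sum d (F2 u) = fscale ?c (F2 u)" "swap_sum d t = fscale ?c t"
        by (simp_all only: t_def T uv(3) scale swap_sum_linear fs.scale_left_commute[of ?k])
      have "fscale 2 (E1 (F1 (F2 u))) = fscale (?e - ?c) (F2 u)"
        using EF1[OF F2M[OF uv(1)]] eig(1) by (simp only: fs.scale_left_diff_distrib)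
      then have "fscale 4 (E2 (E1 (F1 (F2 u)))) = fscale 2 (E2 (fscale (?e - ?c) (F2 u)))"
        by (metis (no_types, lifting) scale(3) fs.scale_scale mult_2_right numeral_Bit0 one_add_one
            mult_numeral_1_right numerals(1))
      also have "\<dots> = fscale (?e - ?c) (fscale 2 (E2 (F2 u)))"
        by (simp only: scale fs.scale_left_commute[of 2])
      also have "\<dots> = fscale (?e - ?c) (fscale (?f - ?c) u)"
        using EF2[OF uv(1)] uv(3) by (simp only: fs.scale_left_diff_distrib)
      finally have *: "fscale 4 (E2 (E1 (F1 (F2 u)))) = fscale ((?e - ?c) * (?f - ?c)) u"
        by (simp only: fs.scale_scale)
      have "E2 (E1 t) = fscale (1 / ((?e - ?c) * (?f - ?c))) (fscale 4 (E2 (E1 (F1 (F2 u)))))"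
        by (simp only: t_def scale fs.scale_scale) simp
      also have "\<dots> = u" unfolding * using ne by simp
      finally have "\<Psi> t = w" by (simp only: \<Psi>_E w)
      then show ?thesis using tM eig(2) by blast
    qed
    show "\<exists>u\<in>?L. \<exists>v\<in>?L. swap_sum d u = fscale ?c u \<and> t = u + (swap_sum d v - fscale ?c v)"
      if "t \<in> ?L" for t
      by (rule eigen_decomposition[OF cols(1) that d_def[symmetric] d(3)]) (use d in auto)
    show "x \<in> ?L" using x X by simp
  qed
  then show ?thesis by (simp only: X W_def \<Psi>_def p_def q_def)
qed

end

section \<open>The three-term relations\<close>

text \<open>Each affine function of \<open>r\<close> has at most one root, and the field is
  infinite. This is used to change an entry of two tuples at once without making \<open>P\<close>
  vanish at either.\<close>

lemma avoid_two_roots: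
  fixes a b c d :: "'k::field_char_0"
  assumes "a \<noteq> 0" "d \<noteq> 0"
  shows "\<exists>r. a + r * b \<noteq> 0 \<and> c + r * d \<noteq> 0"
proof -
  obtain r where r: "r \<notin> {- (a / b), - (c / d)}"
    using ex_new_if_finite[OF infinite_UNIV_char_0[where ?'a='k], of "{- (a / b), - (c / d)}"] by auto
  have "a + r * b \<noteq> 0"
  proof (cases "b = 0")
    case False
    have "a + r * b = (r - - (a / b)) * b" using False by (simp add: algebra_simps)
    then show ?thesis using False r eq_neg_iff_add_eq_0[of r "a / b"] by simp
  qed (use assms in simp)
  moreover have "c + r * d = (r - - (c / d)) * d" using assms by (simp add: algebra_simps)
  ultimately show ?thesis
    using assms r eq_neg_iff_add_eq_0[of r "c / d"] by (intro exI[of _ r]) simp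
qed

context tensor_space
begin

lemma tensor_power_combination:
  assumes t: "t \<in> tensor_power scale d" "\<alpha>s \<in> covectors scale d" "i < d"
    and dual: "\<xi> \<in> dual scale" "\<And>k. k \<in> K \<Longrightarrow> f k \<in> dual scale"
  shows "\<xi> - (\<Sum>k\<in>K. fscale (c k) (f k)) \<in> dual scale"
    and "t (\<alpha>s[i := \<xi>]) = t (\<alpha>s[i := \<xi> - (\<Sum>k\<in>K. fscale (c k) (f k))]) + (\<Sum>k\<in>K. c k * t (\<alpha>s[i := f k]))"
proof -
  note sub = subspace_dual[OF vector_space_axioms]
  let ?S = "\<Sum>k\<in>K. fscale (c k) (f k)"
  have S: "?S \<in> dual scale" using dual(2) by (intro fs.subspace_sum fs.subspace_scale sub)
  show d: "\<xi> - ?S \<in> dual scale" using dual(1) S by (rule fs.subspace_diff[OF sub])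
  have "t (\<alpha>s[i := \<xi> - ?S + ?S]) = t (\<alpha>s[i := \<xi> - ?S]) + t (\<alpha>s[i := ?S])"
    by (rule tensor_power_add[OF t d S])
  moreover have "t (\<alpha>s[i := ?S]) = (\<Sum>k\<in>K. t (\<alpha>s[i := fscale (c k) (f k)]))"
    using dual(2) by (intro tensor_power_sum[OF vector_space_axioms t] fs.subspace_scale sub)
  moreover have "\<dots> = (\<Sum>k\<in>K. c k * t (\<alpha>s[i := f k]))"
    using dual(2) by (intro sum.cong refl tensor_power_scale[OF t])
  ultimately show "t (\<alpha>s[i := \<xi>]) = t (\<alpha>s[i := \<xi> - ?S]) + (\<Sum>k\<in>K. c k * t (\<alpha>s[i := f k]))"
    by (simp only: diff_add_cancel)
qed

section \<open>Cramer's rule and the one-place relation for simple tensors\<close>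

lemma wedge_eq_0:
  assumes "i < length ws" "j < length ws" "i \<noteq> j" "ws ! i = ws ! j"
  shows "wedge scale ws \<alpha>s = 0"
proof (cases "\<alpha>s \<in> covectors scale (length ws)")
  case True
  let ?n = "length ws" and ?\<tau> = "transpose i j"
  have \<tau>: "?\<tau> permutes {..<?n}" using assms by (intro permutes_swap_id) auto
  have ws: "ws ! ?\<tau> k = ws ! k" for k using assms by (simp add: transpose_def)
  have "wedge scale ws \<alpha>s = (\<Sum>\<sigma> | \<sigma> permutes {..<?n}. of_int (sign (?\<tau> \<circ> \<sigma>)) * (\<Prod>k<?n. (\<alpha>s ! k) (ws ! (?\<tau> \<circ> \<sigma>) k)))"
    using True unfolding wedge_def by (subst setum_permutations_compose_left[OF \<tau>]) simp
  also have "\<dots> = (\<Sum>\<sigma> | \<sigma> permutes {..<?n}. - (of_int (sign \<sigma>) * (\<Prod>k<?n. (\<alpha>s ! k) (ws ! \<sigma> k))))"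
  proof (intro sum.cong refl)
    fix \<sigma> assume "\<sigma> \<in> {\<sigma>. \<sigma> permutes {..<?n}}"
    then have "permutation \<sigma>" using permutes_imp_permutation[of "{..<?n}" \<sigma>] by simp
    then have "sign (?\<tau> \<circ> \<sigma>) = - sign \<sigma>"
      using assms by (simp add: sign_compose permutation_swap_id sign_swap_id)
    then show "of_int (sign (?\<tau> \<circ> \<sigma>)) * (\<Prod>k<?n. (\<alpha>s ! k) (ws ! (?\<tau> \<circ> \<sigma>) k)) =
        - (of_int (sign \<sigma>) * (\<Prod>k<?n. (\<alpha>s ! k) (ws ! \<sigma> k)))"
      by (simp add: ws)
  qed
  also have "\<dots> = - wedge scale ws \<alpha>s" using True by (simp add: wedge_def sum_negf)
  finally show ?thesis by (rule eq_uminus_self)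
qed (simp add: wedge_def)

text \<open>Cramer's rule: grouping the terms of \<open>\<Sum>\<^sub>i P(\<dots>, \<xi>, \<dots>) \<alpha>\<^sub>i(w\<^sub>k)\<close> by the vector that \<open>\<xi>\<close> is
  evaluated at replaces that vector by \<open>w\<^sub>k\<close> in the wedge product.\<close>

lemma wedge_cramer:
  assumes \<alpha>s: "\<alpha>s \<in> covectors scale (length ws)" and \<xi>: "\<xi> \<in> dual scale" and k: "k < length ws"
  shows "(\<Sum>i<length ws. wedge scale ws (\<alpha>s[i := \<xi>]) * (\<alpha>s ! i) (ws ! k)) = \<xi> (ws ! k) * wedge scale ws \<alpha>s"
proof -
  let ?n = "length ws" and ?S = "{\<sigma>. \<sigma> permutes {..<length ws}}"
  have len: "length \<alpha>s = ?n" using \<alpha>s by (simp add: covectors_def)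
  have summand: "(\<Prod>l<?n. (\<alpha>s[i := \<xi>] ! l) (ws ! \<sigma> l)) * (\<alpha>s ! i) (ws ! k) =
      \<xi> (ws ! \<sigma> i) * (\<Prod>l<?n. (\<alpha>s ! l) (ws[\<sigma> i := ws ! k] ! \<sigma> l))"
    if \<sigma>: "\<sigma> permutes {..<?n}" and i: "i < ?n" for \<sigma> i
  proof -
    have inj: "\<sigma> l = \<sigma> i \<longleftrightarrow> l = i" for l using permutes_inj[OF \<sigma>] by (auto simp: inj_eq)
    have lt: "\<sigma> i < ?n" using permutes_in_image[OF \<sigma>, of i] i by simp
    have "(\<Prod>l<?n. (\<alpha>s[i := \<xi>] ! l) (ws ! \<sigma> l)) =
        \<xi> (ws ! \<sigma> i) * (\<Prod>l\<in>{..<?n} - {i}. (\<alpha>s ! l) (ws ! \<sigma> l))"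
      using i len by (subst prod.remove[of _ i]) auto
    moreover have "(\<Prod>l\<in>{..<?n} - {i}. (\<alpha>s ! l) (ws[\<sigma> i := ws ! k] ! \<sigma> l)) =
        (\<Prod>l\<in>{..<?n} - {i}. (\<alpha>s ! l) (ws ! \<sigma> l))"
    proof (rule prod.cong[OF refl])
      fix l assume "l \<in> {..<?n} - {i}"
      then have "\<sigma> l \<noteq> \<sigma> i" using inj by simp
      then show "(\<alpha>s ! l) (ws[\<sigma> i := ws ! k] ! \<sigma> l) = (\<alpha>s ! l) (ws ! \<sigma> l)" by simp
    qed
    then have "(\<Prod>l<?n. (\<alpha>s ! l) (ws[\<sigma> i := ws ! k] ! \<sigma> l)) =
        (\<alpha>s ! i) (ws ! k) * (\<Prod>l\<in>{..<?n} - {i}. (\<alpha>s ! l) (ws ! \<sigma> l))"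
      using i lt by (subst prod.remove[of _ i]) simp_all
    ultimately show ?thesis by simp
  qed
  have "(\<Sum>i<?n. wedge scale ws (\<alpha>s[i := \<xi>]) * (\<alpha>s ! i) (ws ! k)) =
      (\<Sum>i<?n. \<Sum>\<sigma>\<in>?S. of_int (sign \<sigma>) * (\<xi> (ws ! \<sigma> i) * (\<Prod>l<?n. (\<alpha>s ! l) (ws[\<sigma> i := ws ! k] ! \<sigma> l))))"
  proof (intro sum.cong refl)
    fix i assume i: "i \<in> {..<?n}"
    have "wedge scale ws (\<alpha>s[i := \<xi>]) * (\<alpha>s ! i) (ws ! k) =
        (\<Sum>\<sigma>\<in>?S. of_int (sign \<sigma>) * ((\<Prod>l<?n. (\<alpha>s[i := \<xi>] ! l) (ws ! \<sigma> l)) * (\<alpha>s ! i) (ws ! k)))"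
      using covectors_update[OF \<alpha>s \<xi>] by (simp add: wedge_def sum_distrib_right mult.assoc)
    also have "\<dots> = (\<Sum>\<sigma>\<in>?S. of_int (sign \<sigma>) * (\<xi> (ws ! \<sigma> i) * (\<Prod>l<?n. (\<alpha>s ! l) (ws[\<sigma> i := ws ! k] ! \<sigma> l))))"
      using summand i by (intro sum.cong refl) auto
    finally show "wedge scale ws (\<alpha>s[i := \<xi>]) * (\<alpha>s ! i) (ws ! k) = \<dots>" .
  qed
  also have "\<dots> = (\<Sum>\<sigma>\<in>?S. \<Sum>i<?n. of_int (sign \<sigma>) * (\<xi> (ws ! \<sigma> i) * (\<Prod>l<?n. (\<alpha>s ! l) (ws[\<sigma> i := ws ! k] ! \<sigma> l))))"
    by (rule sum.swap)
  also have "\<dots> = (\<Sum>\<sigma>\<in>?S. \<Sum>m<?n. of_int (sign \<sigma>) * (\<xi> (ws ! m) * (\<Prod>l<?n. (\<alpha>s ! l) (ws[m := ws ! k] ! \<sigma> l))))"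
  proof (rule sum.cong[OF refl])
    fix \<sigma> assume "\<sigma> \<in> ?S"
    then have "\<sigma> permutes {..<?n}" by simp
    from sum.permute[OF this, of "\<lambda>m. of_int (sign \<sigma>) * (\<xi> (ws ! m) * (\<Prod>l<?n. (\<alpha>s ! l) (ws[m := ws ! k] ! \<sigma> l)))"]
    show "(\<Sum>i<?n. of_int (sign \<sigma>) * (\<xi> (ws ! \<sigma> i) * (\<Prod>l<?n. (\<alpha>s ! l) (ws[\<sigma> i := ws ! k] ! \<sigma> l)))) =
        (\<Sum>m<?n. of_int (sign \<sigma>) * (\<xi> (ws ! m) * (\<Prod>l<?n. (\<alpha>s ! l) (ws[m := ws ! k] ! \<sigma> l))))"
      by (simp add: o_def)
  qed
  also have "\<dots> = (\<Sum>m<?n. \<xi> (ws ! m) * wedge scale (ws[m := ws ! k]) \<alpha>s)"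
    using \<alpha>s by (subst sum.swap) (simp add: wedge_def sum_distrib_left mult_ac)
  also have "\<dots> = (\<Sum>m<?n. if m = k then \<xi> (ws ! k) * wedge scale ws \<alpha>s else 0)"
    using k by (intro sum.cong refl) (auto simp: wedge_eq_0[of _ _ k])
  also have "\<dots> = \<xi> (ws ! k) * wedge scale ws \<alpha>s" using k by simp
  finally show ?thesis .
qed

lemma wedge_zero_slot:
  assumes "i < length ws" "i < length \<alpha>s" "\<And>k. k < length ws \<Longrightarrow> n (ws ! k) = 0"
  shows "wedge scale ws (\<alpha>s[i := n]) = 0"
proof -
  have "(\<Prod>l<length ws. (\<alpha>s[i := n] ! l) (ws ! \<sigma> l)) = 0" if "\<sigma> permutes {..<length ws}" for \<sigma>
  proof (rule prod_zero)
    have "\<sigma> i < length ws" using permutes_in_image[OF that, of i] assms(1) by simp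
    then show "\<exists>l\<in>{..<length ws}. (\<alpha>s[i := n] ! l) (ws ! \<sigma> l) = 0"
      using assms by (intro bexI[of _ i]) auto
  qed simp
  then show ?thesis by (simp add: wedge_def sum.neutral del: prod_zero_iff)
qed

text \<open>By \<open>wedge_cramer\<close> the covector \<open>?n\<close> vanishes on every
  \<open>ws ! k\<close>, so putting it into the first slot of the second factor gives zero.
  Expanding that slot is exactly the relation for moving the place \<open>s\<close>.\<close>

lemma shift_op_wedge_square:
  assumes "length ws = s" "s > 0"
  shows "shift_op (s + s) {..<s} s (tensor_prod s (wedge scale ws) (wedge scale ws)) = 0"
proof
  fix \<gamma>s
  let ?P = "wedge scale ws" and ?T = "tensor_prod s (wedge scale ws) (wedge scale ws)"
  have P: "?P \<in> ext_power scale s" using wedge_ext_power assms by metis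
  have T: "?T \<in> tensor_power scale (s + s)"
    using tensor_prod_bialternating[OF P P assms(2)] by (simp add: bialternating_def)
  have tP: "?P \<in> tensor_power scale s" using P by (simp add: ext_power_def)
  show "shift_op (s + s) {..<s} s ?T \<gamma>s = 0 \<gamma>s"
  proof (cases "\<gamma>s \<in> covectors scale (s + s)")
    case False
    have "shift_op (s + s) {..<s} s ?T \<in> tensor_power scale (s + s)"
      using assms T by (intro shift_op_tensor_power) auto
    then show ?thesis using tensor_power_outside False by simp
  next
    case True
    define \<alpha>s where "\<alpha>s = take s \<gamma>s"
    define \<beta>s where "\<beta>s = drop s \<gamma>s"
    have cov: "\<alpha>s \<in> covectors scale s" "\<beta>s \<in> covectors scale s"
      using True covectors_take_drop[OF assms(2), of \<gamma>s s] by (auto simp: \<alpha>s_def \<beta>s_def)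
    have len: "length \<alpha>s = s" "length \<beta>s = s" using cov by (auto simp: covectors_def)
    have \<gamma>s: "\<gamma>s = \<alpha>s @ \<beta>s" by (simp add: \<alpha>s_def \<beta>s_def)
    let ?\<xi> = "\<beta>s ! 0"
    have \<xi>: "?\<xi> \<in> dual scale" using covectors_nth[OF cov(2)] assms by blast
    have \<alpha>: "\<alpha>s ! i \<in> dual scale" if "i < s" for i using covectors_nth[OF cov(1) that] .
    have swap: "swap_op (s + s) i s ?T \<gamma>s = ?P (\<alpha>s[i := ?\<xi>]) * ?P (\<beta>s[0 := \<alpha>s ! i])" if "i < s" for i
      using that len assms
      by (simp add: perm_op_def permute_list_transpose tensor_prod_def \<gamma>s nth_append list_update_append)
    let ?c = "\<lambda>i. ?P (\<alpha>s[i := ?\<xi>])"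
    let ?n = "fscale (?P \<alpha>s) ?\<xi> - (\<Sum>i<s. fscale (?c i) (\<alpha>s ! i))"
    have "?n (ws ! k) = 0" if "k < s" for k
      using wedge_cramer[of \<alpha>s ws ?\<xi> k] cov \<xi> that assms
      by (simp add: sum_fun_apply fscale_apply mult.commute)
    then have "?P (\<beta>s[0 := ?n]) = 0"
      using assms len by (intro wedge_zero_slot) auto
    moreover have "?P (\<beta>s[0 := fscale (?P \<alpha>s) ?\<xi>]) = ?P (\<beta>s[0 := ?n]) + (\<Sum>i<s. ?c i * ?P (\<beta>s[0 := \<alpha>s ! i]))"
      by (rule tensor_power_combination[OF tP cov(2) assms(2)])
        (use \<xi> \<alpha> fs.subspace_scale[OF subspace_dual[OF vector_space_axioms]] in auto)
    moreover have "?P (\<beta>s[0 := fscale (?P \<alpha>s) ?\<xi>]) = ?P \<alpha>s * ?P \<beta>s"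
      using tensor_power_scale[OF tP cov(2) assms(2) \<xi>] by simp
    ultimately have "?P \<alpha>s * ?P \<beta>s = (\<Sum>i<s. ?c i * ?P (\<beta>s[0 := \<alpha>s ! i]))" by simp
    moreover have "?T \<gamma>s = ?P \<alpha>s * ?P \<beta>s" by (simp add: tensor_prod_def \<alpha>s_def \<beta>s_def)
    ultimately show ?thesis
      using swap by (simp add: shift_op_def sum_fun_apply)
  qed
qed

section \<open>From the vanishing tensor to the three-term relations\<close>

lemma ext_power_adjacent:
  assumes P: "P \<in> ext_power scale s"
  shows "P (A @ x # y # B) = - P (A @ y # x # B)"
proof (cases "length (A @ x # y # B) = s")
  case True
  let ?i = "length A"
  have "swap_op s ?i (Suc ?i) P = - P"
    using P True by (simp add: ext_power_iff_alternating alternating_def)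
  then have "swap_op s ?i (Suc ?i) P (A @ y # x # B) = - P (A @ y # x # B)" by simp
  then show ?thesis using True by (simp add: perm_op_def permute_list_transpose nth_append list_update_append)
next
  case False
  then have "A @ x # y # B \<notin> covectors scale s" "A @ y # x # B \<notin> covectors scale s"
    by (auto simp: covectors_def)
  moreover have "P \<in> tensor_power scale s" using P by (simp add: ext_power_def)
  ultimately show ?thesis by (simp add: tensor_power_outside[of P scale s])
qed

lemma ext_power_move:
  assumes P: "P \<in> ext_power scale s"
  shows "P (A @ x # L @ B) = (- 1) ^ length L * P (A @ L @ x # B)"
proof (induction L arbitrary: A)
  case (Cons y L)
  have "P (A @ x # (y # L) @ B) = - P ((A @ [y]) @ x # L @ B)"
    using ext_power_adjacent[OF P, of A x y "L @ B"] by simp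
  also have "\<dots> = - ((- 1) ^ length L * P ((A @ [y]) @ L @ x # B))"
    by (simp only: Cons.IH)
  finally show ?case by simp
qed simp

text \<open>Both entries pass the whole of \<open>L\<close>, so the signs cancel. This brings the
  second factor of the product at \<open>\<tau>\<close> into the form with \<open>\<Phi>\<close> in
  front.\<close>

lemma ext_power_move_two:
  assumes P: "P \<in> ext_power scale s"
  shows "P (x # y # L) = P (L @ [x, y])"
proof -
  have "P (x # y # L) = (- 1) ^ Suc (length L) * P (y # L @ [x])"
    using ext_power_move[OF P, of "[]" x "y # L" "[]"] by simp
  also have "P (y # L @ [x]) = (- 1) ^ length L * P (L @ [y, x])"
    using ext_power_move[OF P, of "[]" y L "[x]"] by simp
  also have "P (L @ [y, x]) = - P (L @ [x, y])"
    using ext_power_adjacent[OF P, of L y x "[]"] by simp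
  finally show ?thesis by (simp flip: power_add mult_2)
qed

text \<open>In the final shape the tuple \<open>\<tau> a b c e\<close> fills the first column with
  \<open>\<Phi>, a, b, c, e\<close> and the second with \<open>\<Phi>\<close>. So
  \<open>row_op_diagonal\<close> applies, and the repetition of \<open>\<Phi>\<close> leaves only
  exchanges among the four letters.\<close>

lemma pluecker_three_term:
  assumes P: "P \<in> ext_power scale s" and s: "s = Suc (Suc q)"
    and zero: "row_op (s + 2) (s - 2) (two_shift s (tensor_prod s P P)) = 0"
    and \<Phi>: "\<Phi> \<in> covectors scale q" and dual: "a \<in> dual scale" "b \<in> dual scale" "c \<in> dual scale" "e \<in> dual scale"
  shows "P (\<Phi> @ [a, b]) * P (\<Phi> @ [c, e]) - P (\<Phi> @ [a, c]) * P (\<Phi> @ [b, e]) +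
    P (\<Phi> @ [a, e]) * P (\<Phi> @ [b, c]) = 0"
proof -
  let ?d = "s + s" and ?T = "tensor_prod s P P"
  have len: "length \<Phi> = q" using \<Phi> by (simp add: covectors_def)
  define \<tau> where "\<tau> a b c e = \<Phi> @ [a, b, c, e] @ \<Phi>" for a b c e
  define U where "U = shift_op ?d {..<s} s ?T"
  have \<tau>len: "length (\<tau> a b c e) = ?d" for a b c e using len s by (simp add: \<tau>_def)
  have T: "?T \<in> bialternating scale ?d {..<s} {s..<?d}"
    using tensor_prod_bialternating[OF P P] s by simp
  have U: "U \<in> bialternating scale ?d (insert s {..<s}) {Suc s..<?d}"
  proof -
    have "insert s {Suc s..<?d} = {s..<?d}" using s by auto
    then show ?thesis
      unfolding U_def using T s by (intro shift_op_bialternating) auto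
  qed
  have g: "P (\<Phi> @ [y, x]) = - P (\<Phi> @ [x, y])" for x y
    using ext_power_adjacent[OF P, of \<Phi> y x "[]"] by simp
  have T\<tau>: "?T (\<tau> a b c e) = P (\<Phi> @ [a, b]) * P (\<Phi> @ [c, e])" for a b c e
    using len s ext_power_move_two[OF P, of c e \<Phi>] by (simp add: tensor_prod_def \<tau>_def)
  have lt: "q < ?d" "Suc q < ?d" "s < ?d" "Suc s < ?d" using s by simp_all
  have perm: "permute_list (transpose i j) (\<tau> a b c e) = (\<tau> a b c e)[i := \<tau> a b c e ! j, j := \<tau> a b c e ! i]"
    if "i < ?d" "j < ?d" for i j a b c e
    using that \<tau>len by (simp add: permute_list_transpose)
  have nth: "\<tau> a b c e ! q = a" "\<tau> a b c e ! Suc q = b" "\<tau> a b c e ! s = c" "\<tau> a b c e ! Suc s = e"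
    "i < q \<Longrightarrow> \<tau> a b c e ! i = \<Phi> ! i" "i < q \<Longrightarrow> \<tau> a b c e ! (s + 2 + i) = \<Phi> ! i" for a b c e i
    using len s by (simp_all add: \<tau>_def nth_append nth_Cons')
  have upd: "(\<tau> a b c e)[q := x] = \<tau> x b c e" "(\<tau> a b c e)[Suc q := x] = \<tau> a x c e"
    "(\<tau> a b c e)[s := x] = \<tau> a b x e" "(\<tau> a b c e)[Suc s := x] = \<tau> a b c x" for a b c e x
    using len s by (simp_all add: \<tau>_def list_update_append)
  have U\<tau>: "U (\<tau> a b c e) = ?T (\<tau> a b c e) - ?T (\<tau> c b a e) - ?T (\<tau> a c b e)" for a b c e
  proof -
    \<comment> \<open>The exchange moves \<open>\<Phi> ! i\<close> into the second column, where it
      already occurs.\<close>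
    have low: "swap_op ?d i s ?T (\<tau> a b c e) = 0" if "i < q" for i
    proof -
      let ?\<beta>s = "permute_list (transpose i s) (\<tau> a b c e)"
      have "?T ?\<beta>s = 0"
      proof (rule alternating_eq_0[of ?d "{s..<?d}" _ s "s + 2 + i"])
        show "alternating ?d {s..<?d} ?T" using T by (simp add: bialternating_def)
        show "?\<beta>s ! s = ?\<beta>s ! (s + 2 + i)"
          using that s nth(5,6)[OF that, of a b c e] \<tau>len[of a b c e] perm[of i s a b c e] by simp
      qed (use that s \<tau>len in auto)
      then show ?thesis using \<tau>len by (simp add: perm_op_def)
    qed
    have "{..<s} = {..<q} \<union> {q, Suc q}" using s by auto
    then have "(\<Sum>i<s. swap_op ?d i s ?T (\<tau> a b c e)) = swap_op ?d q s ?T (\<tau> a b c e) + swap_op ?d (Suc q) s ?T (\<tau> a b c e)"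
      using low by (simp add: sum.union_disjoint)
    also have "\<dots> = ?T (\<tau> c b a e) + ?T (\<tau> a c b e)"
      using \<tau>len lt by (simp add: perm_op_def perm nth upd)
    finally show ?thesis by (simp add: U_def shift_op_def sum_fun_apply)
  qed
  have "two_shift s ?T (\<tau> a b c e) = U (\<tau> a b c e) - U (\<tau> e b c a) - U (\<tau> a e c b) - U (\<tau> a b e c)"
  proof -
    have low: "swap_op ?d i (Suc s) U (\<tau> a b c e) = 0" if "i < q" for i
    proof -
      let ?\<beta>s = "permute_list (transpose i (Suc s)) (\<tau> a b c e)"
      have "U ?\<beta>s = 0"
      proof (rule alternating_eq_0[of ?d "{Suc s..<?d}" _ "Suc s" "s + 2 + i"])
        show "alternating ?d {Suc s..<?d} U" using U by (simp add: bialternating_def)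
        show "?\<beta>s ! Suc s = ?\<beta>s ! (s + 2 + i)"
          using that s nth(5,6)[OF that, of a b c e] \<tau>len[of a b c e] perm[of i "Suc s" a b c e] by simp
      qed (use that s \<tau>len in auto)
      then show ?thesis using \<tau>len by (simp add: perm_op_def)
    qed
    have "{..<Suc s} = {..<q} \<union> {q, Suc q, s}" using s by auto
    then have "(\<Sum>i<Suc s. swap_op ?d i (Suc s) U (\<tau> a b c e)) =
        swap_op ?d q (Suc s) U (\<tau> a b c e) + swap_op ?d (Suc q) (Suc s) U (\<tau> a b c e) + swap_op ?d s (Suc s) U (\<tau> a b c e)"
      using low s by (simp add: sum.union_disjoint del: sum.lessThan_Suc)
    also have "\<dots> = U (\<tau> e b c a) + U (\<tau> a e c b) + U (\<tau> a b e c)"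
      using \<tau>len lt by (simp add: perm_op_def perm nth upd)
    finally show ?thesis by (simp add: two_shift_def shift_op_def[of _ "{..<Suc s}"] sum_fun_apply U_def[symmetric] del: sum.lessThan_Suc)
  qed
  \<comment> \<open>The value of \<open>U\<close> is already the three-term expression, a Pfaffian
    that changes sign under every transposition of the four letters. The three exchanges with
    \<open>e\<close> therefore add three more copies.\<close>
  also have "\<dots> = 4 * (P (\<Phi> @ [a, b]) * P (\<Phi> @ [c, e]) - P (\<Phi> @ [a, c]) * P (\<Phi> @ [b, e]) +
    P (\<Phi> @ [a, e]) * P (\<Phi> @ [b, c]))"
    unfolding U\<tau> T\<tau>
    by (simp add: g[of b a] g[of c a] g[of e a] g[of c b] g[of e b] g[of e c] algebra_simps)
  finally have 4: "two_shift s ?T (\<tau> a b c e) = \<dots>" .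
  have "row_op (s + 2) (s - 2) (two_shift s ?T) (\<tau> a b c e) =
      of_nat (card (row_group (s + 2) (s - 2))) * two_shift s ?T (\<tau> a b c e)"
    by (rule row_op_diagonal) (use s \<tau>len nth(5,6) in simp_all)
  then have "two_shift s ?T (\<tau> a b c e) = 0"
    using zero id_row_group[of "s + 2" "s - 2"] finite_row_group[of "s + 2" "s - 2"] by auto
  then show ?thesis using 4 by (metis mult_eq_0_iff zero_neq_numeral)
qed

section \<open>Simplicity from the three-term relations\<close>


lemma exists_permutation_two:
  assumes "i < n" "j < n" "i \<noteq> j" "k < n" "l < n" "k \<noteq> l"
  shows "\<exists>\<sigma>. \<sigma> permutes {..<n} \<and> \<sigma> k = i \<and> \<sigma> l = j"
proof -
  define i' where "i' = transpose j l i"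
  have i': "i' < n" "i' \<noteq> l" using assms by (auto simp: i'_def transpose_def)
  let ?\<sigma> = "transpose j l \<circ> transpose i' k"
  have "?\<sigma> permutes {..<n}"
    using assms i' by (intro permutes_compose permutes_swap_id) auto
  moreover have "?\<sigma> k = i" by (simp add: i'_def)
  moreover have "?\<sigma> l = j" using assms i' by simp
  ultimately show ?thesis by blast
qed

text \<open>A permutation brings the slots \<open>i\<close> and \<open>j\<close> to the end, where
  the three-term relation applies. Its sign enters each product twice and drops out.\<close>

lemma pluecker_exchange:
  assumes P: "P \<in> ext_power scale s" and s: "s = Suc (Suc q)"
    and three: "\<And>\<Phi> a b c e. \<lbrakk>\<Phi> \<in> covectors scale q; a \<in> dual scale; b \<in> dual scale;
      c \<in> dual scale; e \<in> dual scale\<rbrakk> \<Longrightarrow>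
      P (\<Phi> @ [a, b]) * P (\<Phi> @ [c, e]) - P (\<Phi> @ [a, c]) * P (\<Phi> @ [b, e]) +
        P (\<Phi> @ [a, e]) * P (\<Phi> @ [b, c]) = 0"
    and \<alpha>s: "\<alpha>s \<in> covectors scale s" and ij: "i < s" "j < s" "i \<noteq> j"
    and dual: "c \<in> dual scale" "e \<in> dual scale"
  shows "P \<alpha>s * P (\<alpha>s[i := c, j := e]) =
    P (\<alpha>s[i := c]) * P (\<alpha>s[j := e]) - P (\<alpha>s[i := e]) * P (\<alpha>s[j := c])"
proof -
  have tP: "P \<in> tensor_power scale s" "alternating s {..<s} P"
    using P by (simp_all add: ext_power_iff_alternating)
  have len: "length \<alpha>s = s" using \<alpha>s by (simp add: covectors_def)
  obtain \<sigma> where \<sigma>: "\<sigma> permutes {..<s}" "\<sigma> q = i" "\<sigma> (Suc q) = j"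
    using exists_permutation_two[OF ij, of q "Suc q"] s by auto
  define L where "L = permute_list \<sigma> \<alpha>s"
  define \<Phi> where "\<Phi> = take q L"
  define g where "g x y = P (\<Phi> @ [x, y])" for x y
  define \<epsilon> where "\<epsilon> = (of_int (sign \<sigma>) :: 'k)"
  have \<epsilon>: "\<epsilon> * \<epsilon> = 1" by (simp add: \<epsilon>_def flip: of_int_mult)
  have L: "L \<in> covectors scale s" "length L = s"
    using covectors_permute_list[OF \<sigma>(1) len] \<alpha>s len by (auto simp: L_def)
  have "\<Phi> \<in> covectors scale q"
    using L s set_take_subset[of q L] by (auto simp: \<Phi>_def covectors_def)
  have sgn: "P xs = \<epsilon> * P (permute_list \<sigma> xs)" if "length xs = s" for xs
  proof -
    have "perm_op s \<sigma> P xs = fscale \<epsilon> P xs"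
      unfolding \<epsilon>_def by (rule fun_cong[OF perm_op_alternating[OF \<sigma>(1) subset_refl tP(2) degree_tensor_power[OF tP(1)]]])
    then have "P (permute_list \<sigma> xs) = \<epsilon> * P xs" using that by (simp add: perm_op_def fscale_apply)
    then show ?thesis using \<epsilon> by (simp add: mult.assoc[symmetric])
  qed
  have upd: "P (\<alpha>s[i := x, j := y]) = \<epsilon> * g x y" for x y
  proof -
    have "permute_list \<sigma> (\<alpha>s[i := x, j := y]) = L[q := x, Suc q := y]"
      using permute_list_update[of \<sigma> \<alpha>s q x] permute_list_update[of \<sigma> "\<alpha>s[i := x]" "Suc q" y] \<sigma> len s
      by (simp add: L_def)
    also have "\<dots> = \<Phi> @ [x, y]"
    proof -
      have "L = \<Phi> @ [L ! q, L ! Suc q]"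
        using L(2) s by (intro nth_equalityI) (auto simp: \<Phi>_def nth_append less_Suc_eq)
      then obtain u v where uv: "L = \<Phi> @ [u, v]" by blast
      have "length \<Phi> = q" using L(2) s by (simp add: \<Phi>_def)
      then show ?thesis unfolding uv by (simp add: list_update_append)
    qed
    finally show ?thesis using sgn[of "\<alpha>s[i := x, j := y]"] len by (simp add: g_def)
  qed
  let ?a = "\<alpha>s ! i" and ?b = "\<alpha>s ! j"
  have ab: "?a \<in> dual scale" "?b \<in> dual scale" using covectors_nth[OF \<alpha>s] ij by auto
  have anti: "g y x = - g x y" for x y
    using ext_power_adjacent[OF P, of \<Phi> y x "[]"] by (simp add: g_def)
  have vals: "P \<alpha>s = \<epsilon> * g ?a ?b" "P (\<alpha>s[i := c]) = \<epsilon> * g c ?b" "P (\<alpha>s[j := e]) = \<epsilon> * g ?a e"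
    "P (\<alpha>s[i := e]) = \<epsilon> * g e ?b" "P (\<alpha>s[j := c]) = \<epsilon> * g ?a c"
    using upd[of ?a ?b] upd[of c ?b] upd[of ?a e] upd[of e ?b] upd[of ?a c] ij(3)
    by (simp_all add: list_update_swap[of i j])
  have "g ?a ?b * g c e = g ?a c * g ?b e - g ?a e * g ?b c"
    using three[OF \<open>\<Phi> \<in> covectors scale q\<close> ab dual] by (simp add: g_def algebra_simps)
  also have "\<dots> = g c ?b * g ?a e - g e ?b * g ?a c"
    by (simp add: anti[of c ?b] anti[of e ?b])
  finally have "g ?a ?b * g c e = g c ?b * g ?a e - g e ?b * g ?a c" .
  moreover have "\<epsilon> * x * (\<epsilon> * y) = x * y" for x y
    using \<epsilon> by (metis mult.assoc mult.left_commute mult_1)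
  ultimately show ?thesis by (simp only: vals upd)
qed

text \<open>\<open>annihilator P \<alpha>s\<close> are the covectors vanishing on the vectors \<open>\<xi> \<mapsto> P (\<dots>, \<xi>, \<dots>)\<close>
  obtained by freeing one argument. If \<open>P\<close> is a wedge product with \<open>P \<alpha>s \<noteq> 0\<close>, these vectors
  span its subspace.\<close>

definition annihilator :: "('k, 'v) tensor \<Rightarrow> ('v \<Rightarrow> 'k) list \<Rightarrow> ('v \<Rightarrow> 'k) set" where
  "annihilator P \<alpha>s = {n \<in> dual scale. \<forall>i<length \<alpha>s. P (\<alpha>s[i := n]) = 0}"

text \<open>Take \<open>e := n\<close> in the exchange relation: each product on the right has a
  factor that vanishes, and \<open>P \<alpha>s\<close> can be cancelled on the left.\<close>

lemma annihilator_exchange: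
  assumes ex: "\<And>\<alpha>s i j c e. \<lbrakk>\<alpha>s \<in> covectors scale s; i < s; j < s; i \<noteq> j; c \<in> dual scale; e \<in> dual scale\<rbrakk> \<Longrightarrow>
      P \<alpha>s * P (\<alpha>s[i := c, j := e]) = P (\<alpha>s[i := c]) * P (\<alpha>s[j := e]) - P (\<alpha>s[i := e]) * P (\<alpha>s[j := c])"
    and \<alpha>s: "\<alpha>s \<in> covectors scale s" and i: "i < s" and c: "c \<in> dual scale"
    and ne: "P \<alpha>s \<noteq> 0" and n: "n \<in> annihilator P \<alpha>s"
  shows "n \<in> annihilator P (\<alpha>s[i := c])"
proof -
  have len: "length \<alpha>s = s" using \<alpha>s by (simp add: covectors_def)
  have n': "n \<in> dual scale" "\<And>j. j < s \<Longrightarrow> P (\<alpha>s[j := n]) = 0" using n len by (auto simp: annihilator_def)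
  have "P (\<alpha>s[i := c, j := n]) = 0" if j: "j < s" for j
  proof (cases "i = j")
    case False
    then have "P \<alpha>s * P (\<alpha>s[i := c, j := n]) = 0"
      using ex[OF \<alpha>s i j False c n'(1)] n'(2) i j by simp
    then show ?thesis using ne by simp
  qed (use n'(2) j in simp)
  then show ?thesis using n'(1) len by (simp add: annihilator_def)
qed

text \<open>Induction on the number of leading slots in which the tuples may differ. Copying an
  entry of \<open>\<beta>s\<close> directly into \<open>\<alpha>s\<close> could make
  \<open>P\<close> vanish, so both tuples first receive a common combination \<open>?x\<close> of
  the two entries, chosen to keep both values nonzero.\<close>

lemma annihilator_subset:
  assumes t: "P \<in> tensor_power scale s"
    and ex: "\<And>\<alpha>s i j c e. \<lbrakk>\<alpha>s \<in> covectors scale s; i < s; j < s; i \<noteq> j; c \<in> dual scale; e \<in> dual scale\<rbrakk> \<Longrightarrow>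
      P \<alpha>s * P (\<alpha>s[i := c, j := e]) = P (\<alpha>s[i := c]) * P (\<alpha>s[j := e]) - P (\<alpha>s[i := e]) * P (\<alpha>s[j := c])"
    and "\<alpha>s \<in> covectors scale s" "\<beta>s \<in> covectors scale s" "P \<alpha>s \<noteq> 0" "P \<beta>s \<noteq> 0"
  shows "annihilator P \<alpha>s \<subseteq> annihilator P \<beta>s"
proof -
  have "annihilator P \<alpha>s \<subseteq> annihilator P \<beta>s"
    if "m \<le> s" "\<And>i. m \<le> i \<Longrightarrow> i < s \<Longrightarrow> \<alpha>s ! i = \<beta>s ! i"
      "\<alpha>s \<in> covectors scale s" "\<beta>s \<in> covectors scale s" "P \<alpha>s \<noteq> 0" "P \<beta>s \<noteq> 0" for m \<alpha>s \<beta>s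
    using that
  proof (induction m arbitrary: \<alpha>s \<beta>s)
    case 0
    then have "\<alpha>s = \<beta>s" by (intro nth_equalityI) (auto simp: covectors_def)
    then show ?case by simp
  next
    case (Suc m)
    have m: "m < s" using Suc.prems(1) by simp
    have len: "length \<alpha>s = s" "length \<beta>s = s" using Suc.prems by (auto simp: covectors_def)
    let ?a = "\<alpha>s ! m" and ?b = "\<beta>s ! m"
    have ab: "?a \<in> dual scale" "?b \<in> dual scale" using Suc.prems covectors_nth m by blast+
    obtain r where r: "P \<alpha>s + r * P (\<alpha>s[m := ?b]) \<noteq> 0" "P (\<beta>s[m := ?a]) + r * P \<beta>s \<noteq> 0"
      using avoid_two_roots[OF Suc.prems(5,6), of "P (\<alpha>s[m := ?b])" "P (\<beta>s[m := ?a])"] by blast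
    let ?x = "?a + fscale r ?b"
    have rb: "fscale r ?b \<in> dual scale" by (rule fs.subspace_scale[OF subspace_dual[OF vector_space_axioms] ab(2)])
    have x: "?x \<in> dual scale" by (rule dual_add[OF vector_space_axioms ab(1) rb])
    have "P (\<gamma>s[m := ?x]) = P (\<gamma>s[m := ?a]) + r * P (\<gamma>s[m := ?b])" if "\<gamma>s \<in> covectors scale s" for \<gamma>s
      by (simp only: tensor_power_add[OF t that m ab(1) rb] tensor_power_scale[OF t that m ab(2)])
    then have ne: "P (\<alpha>s[m := ?x]) \<noteq> 0" "P (\<beta>s[m := ?x]) \<noteq> 0"
      using r Suc.prems(3,4) by simp_all
    have "annihilator P \<alpha>s \<subseteq> annihilator P (\<alpha>s[m := ?x])"
      using annihilator_exchange[OF ex Suc.prems(3) m x Suc.prems(5)] by blast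
    also have "\<dots> \<subseteq> annihilator P (\<beta>s[m := ?x])"
    proof (rule Suc.IH)
      show "\<alpha>s[m := ?x] ! i = \<beta>s[m := ?x] ! i" if "m \<le> i" "i < s" for i
        using Suc.prems(2)[of i] that len by (cases "i = m") auto
    qed (use m Suc.prems x ne covectors_update in auto)
    also have "\<dots> \<subseteq> annihilator P (\<beta>s[m := ?x, m := ?b])"
      using annihilator_exchange[OF ex covectors_update[OF Suc.prems(4) x] m ab(2) ne(2)] by blast
    finally show ?case by simp
  qed
  from this[of s \<alpha>s \<beta>s] assms show ?thesis by simp
qed

text \<open>Modulo \<open>N\<close> the entries of \<open>\<alpha>s\<close> span the covectors, so
  multilinearity reduces every value of \<open>D\<close> to tuples drawn from
  \<open>\<alpha>s\<close>. On these, \<open>D\<close> is zero by a repetition or equals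
  \<open>D \<alpha>s\<close> up to sign. The induction counts the leading slots that are still
  arbitrary.\<close>

lemma ext_power_vanishing:
  assumes D: "D \<in> ext_power scale s" and \<alpha>s: "\<alpha>s \<in> covectors scale s" "D \<alpha>s = 0"
    and dec: "\<And>\<xi>. \<xi> \<in> dual scale \<Longrightarrow> \<exists>c. \<xi> - (\<Sum>k<s. fscale (c k) (\<alpha>s ! k)) \<in> N"
    and N: "\<And>\<beta>s i. \<beta>s \<in> covectors scale s \<Longrightarrow> i < s \<Longrightarrow> \<beta>s ! i \<in> N \<Longrightarrow> D \<beta>s = 0"
    and Nd: "N \<subseteq> dual scale"
  shows "D = 0"
proof -
  have t: "D \<in> tensor_power scale s" and alt: "alternating s {..<s} D"
    using D by (simp_all add: ext_power_iff_alternating)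
  have len: "length \<alpha>s = s" using \<alpha>s by (simp add: covectors_def)
  have "D \<beta>s = 0" if "m \<le> s" "\<beta>s \<in> covectors scale s" "\<And>i. m \<le> i \<Longrightarrow> i < s \<Longrightarrow> \<beta>s ! i \<in> set \<alpha>s" for m \<beta>s
    using that
  proof (induction m arbitrary: \<beta>s)
    case 0
    have len': "length \<beta>s = s" using 0 by (simp add: covectors_def)
    have "\<forall>i<s. \<exists>k<s. \<beta>s ! i = \<alpha>s ! k" using 0(3) len by (metis in_set_conv_nth le0)
    then obtain f where f: "\<And>i. i < s \<Longrightarrow> f i < s \<and> \<beta>s ! i = \<alpha>s ! f i" by metis
    show ?case
    proof (cases "inj_on f {..<s}")
      case True
      define \<sigma> where "\<sigma> i = (if i < s then f i else i)" for i
      have \<sigma>: "\<sigma> permutes {..<s}"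
        by (rule inj_imp_permutes) (use True f in \<open>auto simp: \<sigma>_def inj_on_def\<close>)
      have "permute_list \<sigma> \<alpha>s = \<beta>s"
        using f len len' \<sigma> by (intro nth_equalityI) (auto simp: permute_list_nth \<sigma>_def)
      then have "D \<beta>s = perm_op s \<sigma> D \<alpha>s" using len by (simp add: perm_op_def)
      also have "\<dots> = fscale (of_int (sign \<sigma>)) D \<alpha>s"
        by (rule fun_cong[OF perm_op_alternating[OF \<sigma> subset_refl alt degree_tensor_power[OF t]]])
      finally show ?thesis using \<alpha>s by (simp add: fscale_apply)
    next
      case False
      then obtain i j where "i < s" "j < s" "i \<noteq> j" "f i = f j" by (auto simp: inj_on_def)
      then show ?thesis using f len' by (intro alternating_eq_0[OF alt, of i j]) auto
    qed
  next
    case (Suc m)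
    have m: "m < s" using Suc.prems by simp
    have len': "length \<beta>s = s" using Suc.prems by (simp add: covectors_def)
    let ?\<xi> = "\<beta>s ! m"
    have \<xi>: "?\<xi> \<in> dual scale" using covectors_nth[OF Suc.prems(2) m] .
    obtain c where c: "?\<xi> - (\<Sum>k<s. fscale (c k) (\<alpha>s ! k)) \<in> N" using dec[OF \<xi>] by blast
    have dual: "\<alpha>s ! k \<in> dual scale" if "k < s" for k using covectors_nth[OF \<alpha>s(1) that] .
    have "D (\<beta>s[m := \<alpha>s ! k]) = 0" if "k < s" for k
    proof (rule Suc.IH)
      show "m \<le> s" using m by simp
      show "\<beta>s[m := \<alpha>s ! k] \<in> covectors scale s"
        by (rule covectors_update[OF Suc.prems(2) dual[OF that]])
      show "\<beta>s[m := \<alpha>s ! k] ! i \<in> set \<alpha>s" if "m \<le> i" "i < s" for i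
        using Suc.prems(3)[of i] that \<open>k < s\<close> len len' by (cases "i = m") auto
    qed
    moreover have "D (\<beta>s[m := ?\<xi> - (\<Sum>k<s. fscale (c k) (\<alpha>s ! k))]) = 0"
      by (rule N[OF covectors_update[OF Suc.prems(2)] m]) (use c Nd len' m in auto)
    moreover have "D (\<beta>s[m := ?\<xi>]) = D (\<beta>s[m := ?\<xi> - (\<Sum>k<s. fscale (c k) (\<alpha>s ! k))]) +
        (\<Sum>k<s. c k * D (\<beta>s[m := \<alpha>s ! k]))"
      by (rule tensor_power_combination(2)[OF t Suc.prems(2) m \<xi>]) (use dual in auto)
    ultimately show ?case by simp
  qed
  from this[of s] have "D \<beta>s = 0" for \<beta>s
    using tensor_power_outside[OF t] by (cases "\<beta>s \<in> covectors scale s") auto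
  then show ?thesis by (simp add: fun_eq_iff)
qed

lemma wedge_dual_tuple:
  assumes "length ws = s" "\<alpha>s \<in> covectors scale s"
    and "\<And>i k. i < s \<Longrightarrow> k < s \<Longrightarrow> (\<alpha>s ! i) (ws ! k) = (if i = k then 1 else 0)"
  shows "wedge scale ws \<alpha>s = 1"
proof -
  have "(\<Prod>i<s. (\<alpha>s ! i) (ws ! \<sigma> i)) = (if \<sigma> = id then 1 else 0)" if \<sigma>: "\<sigma> permutes {..<s}" for \<sigma>
  proof (cases "\<sigma> = id")
    case False
    then obtain i where i: "\<sigma> i \<noteq> i" by (auto simp: fun_eq_iff)
    then have "i < s" using permutes_not_in[OF \<sigma>, of i] by auto
    moreover from this have "\<sigma> i < s" using permutes_in_image[OF \<sigma>, of i] by simp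
    ultimately show ?thesis using False i assms(3)[of i "\<sigma> i"] by (auto intro!: prod_zero)
  qed (use assms(3) in simp)
  then have "wedge scale ws \<alpha>s = (\<Sum>\<sigma> | \<sigma> permutes {..<s}. if \<sigma> = id then 1 else 0)"
    using assms by (auto simp: wedge_def intro!: sum.cong)
  also have "\<dots> = 1" by (simp add: finite_permutations permutes_id)
  finally show ?thesis .
qed

text \<open>By finite dimension the functional that frees slot \<open>k\<close> is evaluation at a
  vector \<open>ws ! k\<close>, and \<open>P \<alpha>s = 1\<close> makes these vectors dual to
  \<open>\<alpha>s\<close>. \<open>P\<close> and the wedge product of \<open>ws\<close> agree at
  \<open>\<alpha>s\<close>, and both vanish once an argument annihilates all of \<open>ws\<close>,
  hence they are equal.\<close>

lemma simple_if_exchange: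
  assumes P: "P \<in> ext_power scale s" and s: "s \<ge> 1"
    and ex: "\<And>\<alpha>s i j c e. \<lbrakk>\<alpha>s \<in> covectors scale s; i < s; j < s; i \<noteq> j; c \<in> dual scale; e \<in> dual scale\<rbrakk> \<Longrightarrow>
      P \<alpha>s * P (\<alpha>s[i := c, j := e]) = P (\<alpha>s[i := c]) * P (\<alpha>s[j := e]) - P (\<alpha>s[i := e]) * P (\<alpha>s[j := c])"
  shows "simple scale s P"
proof (cases "P = 0")
  case True
  \<comment> \<open>The zero tensor is a product of zero vectors only because there is at least one
    factor.\<close>
  have zero: "wedge scale (replicate s 0) \<alpha>s = 0" for \<alpha>s
  proof (cases "\<alpha>s \<in> covectors scale s")
    case True
    then have "wedge scale (replicate s 0) (\<alpha>s[0 := \<alpha>s ! 0]) = 0"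
      using s covectors_nth[OF True] dual_linear(2)[of "\<alpha>s ! 0" 0 0]
      by (intro wedge_zero_slot) (auto simp: covectors_def)
    then show ?thesis by simp
  qed (simp add: wedge_def)
  show ?thesis
    unfolding simple_def by (rule exI[of _ "replicate s 0"]) (simp add: True zero fun_eq_iff)
next
  case False
  have t: "P \<in> tensor_power scale s" and alt: "alternating s {..<s} P"
    using P by (simp_all add: ext_power_iff_alternating)
  obtain \<beta>s where \<beta>s: "P \<beta>s \<noteq> 0" using False by (auto simp: fun_eq_iff)
  then have \<beta>c: "\<beta>s \<in> covectors scale s" using tensor_power_outside[OF t] by blast
  \<comment> \<open>Rescaling one entry normalizes the value of \<open>P\<close> to 1.\<close>
  define \<alpha>s where "\<alpha>s = \<beta>s[0 := fscale (1 / P \<beta>s) (\<beta>s ! 0)]"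
  have \<beta>0: "\<beta>s ! 0 \<in> dual scale" using covectors_nth[OF \<beta>c] s by simp
  have \<alpha>c: "\<alpha>s \<in> covectors scale s"
    unfolding \<alpha>s_def by (rule covectors_update[OF \<beta>c fs.subspace_scale[OF subspace_dual[OF vector_space_axioms] \<beta>0]])
  have P1: "P \<alpha>s = 1"
    using tensor_power_scale[OF t \<beta>c _ \<beta>0, of 0 "1 / P \<beta>s"] s \<beta>s by (simp add: \<alpha>s_def)
  have len: "length \<alpha>s = s" using \<alpha>c by (simp add: covectors_def)
  have dual: "\<alpha>s ! k \<in> dual scale" if "k < s" for k using covectors_nth[OF \<alpha>c that] .
  have delta: "P (\<alpha>s[k := \<alpha>s ! i]) = (if i = k then 1 else 0)" if "i < s" "k < s" for i k
  proof (cases "i = k")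
    case False
    then show ?thesis
      using that len by (auto intro!: alternating_eq_0[OF alt, of i k])
  qed (use P1 in simp)
  define ws where "ws = map (\<lambda>k. \<Sum>b\<in>Basis. scale (P (\<alpha>s[k := coord b])) b) [0..<s]"
  have ws: "length ws = s" by (simp add: ws_def)
  have ev: "\<xi> (ws ! k) = P (\<alpha>s[k := \<xi>])" if "\<xi> \<in> dual scale" "k < s" for \<xi> k
    using that tensor_power_expand[OF t \<alpha>c that(2,1)] by (simp add: ws_def dual_linear mult.commute)
  let ?Q = "wedge scale ws"
  have Q: "?Q \<in> ext_power scale s" using wedge_ext_power[of ws] ws by simp
  have Q1: "?Q \<alpha>s = 1"
    by (rule wedge_dual_tuple[OF ws \<alpha>c]) (simp add: ev dual delta)
  have "P - ?Q = 0"
  proof (rule ext_power_vanishing[OF _ \<alpha>c, where N = "annihilator P \<alpha>s"])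
    show "P - ?Q \<in> ext_power scale s"
      using P Q subspace_tensor_power[of scale s] subspace_alternating[of s "{..<s}"]
        fs.subspace_diff unfolding ext_power_iff_alternating by blast
    show "(P - ?Q) \<alpha>s = 0" using P1 Q1 by simp
    show "annihilator P \<alpha>s \<subseteq> dual scale" by (auto simp: annihilator_def)
    show "\<exists>c. \<xi> - (\<Sum>k<s. fscale (c k) (\<alpha>s ! k)) \<in> annihilator P \<alpha>s" if \<xi>: "\<xi> \<in> dual scale" for \<xi>
    proof
      \<comment> \<open>These are the coordinates of \<open>\<xi>\<close> in the dual system: by
        \<open>delta\<close> the remainder then vanishes on every \<open>ws ! k\<close>.\<close>
      let ?c = "\<lambda>k. P (\<alpha>s[k := \<xi>])"
      let ?n = "\<xi> - (\<Sum>k<s. fscale (?c k) (\<alpha>s ! k))"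
      have "P (\<alpha>s[j := ?n]) = 0" if j: "j < s" for j
      proof -
        have "P (\<alpha>s[j := \<xi>]) = P (\<alpha>s[j := ?n]) + (\<Sum>k<s. ?c k * P (\<alpha>s[j := \<alpha>s ! k]))"
          by (rule tensor_power_combination(2)[OF t \<alpha>c j \<xi>]) (use dual in auto)
        also have "(\<Sum>k<s. ?c k * P (\<alpha>s[j := \<alpha>s ! k])) = (\<Sum>k<s. if k = j then ?c k else 0)"
          using j by (intro sum.cong refl) (simp add: delta)
        also have "\<dots> = P (\<alpha>s[j := \<xi>])" using j by simp
        finally show ?thesis by (simp only: add_cancel_right_left)
      qed
      moreover have "?n \<in> dual scale"
        using tensor_power_combination(1)[OF t \<alpha>c _ \<xi>, of 0 "{..<s}" "\<lambda>k. \<alpha>s ! k" ?c] dual s by simp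
      ultimately show "?n \<in> annihilator P \<alpha>s" by (simp add: annihilator_def len)
    qed
    show "(P - ?Q) \<gamma>s = 0" if \<gamma>: "\<gamma>s \<in> covectors scale s" "i < s" "\<gamma>s ! i \<in> annihilator P \<alpha>s" for \<gamma>s i
    proof -
      have len': "length \<gamma>s = s" using \<gamma> by (simp add: covectors_def)
      \<comment> \<open>If the value were nonzero, \<open>\<gamma>s ! i\<close> would belong to the
        annihilator at \<open>\<gamma>s\<close> as well, and reinserting it into its own slot would
        give zero.\<close>
      have "P \<gamma>s = 0"
      proof (rule ccontr)
        assume ne: "P \<gamma>s \<noteq> 0"
        have "annihilator P \<alpha>s \<subseteq> annihilator P \<gamma>s"
          by (rule annihilator_subset[OF t ex \<alpha>c \<gamma>(1) _ ne]) (use P1 in auto)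
        then have "\<gamma>s ! i \<in> annihilator P \<gamma>s" using \<gamma>(3) by blast
        then have "P (\<gamma>s[i := \<gamma>s ! i]) = 0" using \<gamma>(2) len' unfolding annihilator_def by blast
        then show False using ne by simp
      qed
      moreover have "?Q (\<gamma>s[i := \<gamma>s ! i]) = 0"
        by (rule wedge_zero_slot) (use \<gamma> len len' ws ev in \<open>auto simp: annihilator_def\<close>)
      ultimately show ?thesis by simp
    qed
  qed
  then have "P = ?Q" by (metis eq_iff_diff_eq_0)
  then show ?thesis using ws unfolding simple_def by blast
qed

text \<open>Here too the description has to be shown definite: an isomorphism of the image with
  \<open>{0}\<close> makes a projection constant, hence zero.\<close>

lemma component_zero:
  assumes "0 \<in> X" "x \<in> X"
  shows "component scale X {0} x = 0"
proof -
  have "\<pi> x = 0" if \<pi>: "equivariant_projection scale X {0} \<pi>" for \<pi>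
  proof -
    have hom: "\<pi> \<in> GL_hom scale X X" using \<pi> by (simp add: equivariant_projection_def)
    obtain \<psi> where \<psi>: "bij_betw \<psi> (\<pi> ` X) {0 :: ('k, 'v) tensor}"
      using \<pi> by (auto simp: equivariant_projection_def GL_isomorphic_def)
    then have "inj_on \<psi> (\<pi> ` X)" "\<psi> (\<pi> x) = 0" "\<psi> (\<pi> 0) = 0"
      using assms by (auto simp: bij_betw_def)
    then have "\<pi> x = \<pi> 0" using assms by (metis imageI inj_onD)
    moreover have "\<pi> 0 = 0"
      using GL_homD(3)[OF hom assms(1), of 0] by (simp only: fs.scale_zero_left)
    ultimately show ?thesis by simp
  qed
  moreover have "equivariant_projection scale X {0} (\<lambda>_. 0)"
    unfolding equivariant_projection_def
  proof (intro conjI ballI refl)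
    have act0: "act g 0 = 0" for g by (simp add: act_def fun_eq_iff)
    then show "(\<lambda>_. 0) \<in> GL_hom scale X X"
      using assms(1) by (intro GL_homI) (simp_all only: act0 add_0_right fs.scale_zero_right)
    have "(\<lambda>_. 0) ` X = {0 :: ('k, 'v) tensor}" using assms by auto
    moreover have "id \<in> GL_hom scale {0} {0}"
      by (intro GL_homI) (simp_all only: id_apply singleton_iff)
    ultimately show "GL_isomorphic scale ((\<lambda>_. 0) ` X) {0}"
      unfolding GL_isomorphic_def by (metis bij_betw_id)
  qed
  ultimately show ?thesis
    unfolding component_def by (intro the_equality) metis+
qed

end

theorem theorem2:
  fixes scale :: "'k::field_char_0 \<Rightarrow> 'v::ab_group_add \<Rightarrow> 'v"
    and Basis :: "'v set"
    and s :: nat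
    and P :: "('k, 'v) tensor"
  assumes "finite_dimensional_vector_space scale Basis"
    and "s \<ge> 1"
    and "P \<in> ext_power scale s"
  shows "simple scale s P \<longleftrightarrow>
    component scale (ext_square scale s) (Y scale (s + 2) (int s - 2)) (tensor_prod s P P) = 0"
proof -
  interpret tensor_space scale Basis
    by (rule tensor_space.intro) (rule assms(1))
  show ?thesis
  proof (cases "s = 1")
    case True
    \<comment> \<open>With a single slot the exchange relations are vacuous, and the summand is zero
      by the convention for a negative second column.\<close>
    have "simple scale s P"
      by (rule simple_if_exchange[OF assms(3,2)]) (use True in auto)
    moreover have "component scale (ext_square scale s) (Y scale (s + 2) (int s - 2)) (tensor_prod s P P) = 0"
    proof -
      have "Y scale (s + 2) (int s - 2) = {0}" using True by (simp add: Y_def)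
      moreover have "0 \<in> ext_square scale s"
        unfolding ext_square_def by (rule fs.span_zero)
      moreover have "tensor_prod s P P \<in> ext_square scale s"
        unfolding ext_square_def using assms(3) by (intro fs.span_base) blast
      ultimately show ?thesis by (simp only: component_zero)
    qed
    ultimately show ?thesis by simp
  next
    case False
    then have s2: "2 \<le> s" using assms(2) by simp
    then obtain q where q: "s = Suc (Suc q)" by (metis Suc_le_D numeral_2_eq_2 Suc_le_mono)
    have mem: "tensor_prod s P P \<in> ext_square scale s"
      using tensor_prod_bialternating[OF assms(3,3)] s2 by (simp add: ext_square_eq)
    have "simple scale s P \<longleftrightarrow> row_op (s + 2) (s - 2) (two_shift s (tensor_prod s P P)) = 0"
    proof
      assume "simple scale s P"
      then obtain ws where ws: "length ws = s" "P = wedge scale ws" by (auto simp: simple_def)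
      have "shift_op (s + s) {..<s} s (tensor_prod s P P) = 0"
        unfolding ws(2) by (rule shift_op_wedge_square[OF ws(1)]) (use s2 in simp)
      then show "row_op (s + 2) (s - 2) (two_shift s (tensor_prod s P P)) = 0"
        by (simp only: two_shift_def shift_op_linear row_op_linear)
    next
      assume zero: "row_op (s + 2) (s - 2) (two_shift s (tensor_prod s P P)) = 0"
      show "simple scale s P"
        by (rule simple_if_exchange[OF assms(3,2)])
          (rule pluecker_exchange[OF assms(3) q pluecker_three_term[OF assms(3) q zero]])
    qed
    then show ?thesis using component_ext_square_eq_0_iff[OF s2 mem] by simp
  qed
qed

end
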